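(* Let $S_n^{(\ell,\max)}=S^+(N_n)$ and $S_n^{(\ell,\min)}=S^-(N_n)$, where $N_n$ is a galled tree chosen uniformly at random among all labeled galled trees with $n$ leaves. Then, as $n\to\infty$, \[ \mathbb{E}\big(S_n^{(\ell,\max)}\big)\sim\Big(\tfrac{47}{32}+\tfrac{39\sqrt{17}}{544}\Big)\sqrt{\pi}\,n^{3/2},\qquad \mathbb{E}\big(S_n^{(\ell,\min)}\big)\sim\Big(\tfrac{49}{32}-\tfrac{7\sqrt{17}}{544}\Big)\sqrt{\pi}\,n^{3/2}. \]
   Context: A (rooted, binary) phylogenetic network is a finite acyclic directed graph without multiple edges whose nodes are: a unique root (indegree 0, outdegree 2), leaves (indegree 1, outdegree 0), tree nodes (indegree 1, outdegree 2), and reticulation nodes (indegree 2, outdegree 1). A tree-cycle (gall) is a pair of edge-disjoint directed paths from a tree node (or the root) to a reticulation node all of whose intermediate nodes are tree nodes. A galled tree is a phylogenetic network in which every reticulation node lies in a tree-cycle and any two tree-cycles are node-disjoint. A labeled galled tree with $n$ leaves is one whose leaves are bijectively labeled by $\{1,\dots,n\}$; two such are identified if there is a digraph isomorphism preserving leaf labels. For a leaf $x$ of a galled tree $N$, $h^+(x)$ (resp. $h^-(x)$) is the length of a longest (resp. shortest) directed path from the root to $x$. The Sackin indices are $S^+(N)=\sum_{x} h^+(x)$ and $S^-(N)=\sum_x h^-(x)$, sums over all leaves of $N$. *)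

theory Defs
  imports Complex_Main "HOL-Library.Landau_Symbols"
begin

text \<open>A network is represented by a node set, an edge set and a leaf labelling
  (only its values on leaves matter).\<close>
type_synonym net = "nat set \<times> (nat \<times> nat) set \<times> (nat \<Rightarrow> nat)"

definition nodes :: "net \<Rightarrow> nat set" where "nodes N = fst N"
definition arcs :: "net \<Rightarrow> (nat \<times> nat) set" where "arcs N = fst (snd N)"
definition lab :: "net \<Rightarrow> nat \<Rightarrow> nat" where "lab N = snd (snd N)"

definition indeg :: "net \<Rightarrow> nat \<Rightarrow> nat" where
  "indeg N v = card {u. (u, v) \<in> arcs N}"
definition outdeg :: "net \<Rightarrow> nat \<Rightarrow> nat" where
  "outdeg N v = card {w. (v, w) \<in> arcs N}"

definition is_root :: "net \<Rightarrow> nat \<Rightarrow> bool" where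
  "is_root N v \<longleftrightarrow> v \<in> nodes N \<and> indeg N v = 0 \<and> outdeg N v = 2"
definition is_leaf :: "net \<Rightarrow> nat \<Rightarrow> bool" where
  "is_leaf N v \<longleftrightarrow> v \<in> nodes N \<and> indeg N v = 1 \<and> outdeg N v = 0"
definition is_tree_node :: "net \<Rightarrow> nat \<Rightarrow> bool" where
  "is_tree_node N v \<longleftrightarrow> v \<in> nodes N \<and> indeg N v = 1 \<and> outdeg N v = 2"
definition is_retic :: "net \<Rightarrow> nat \<Rightarrow> bool" where
  "is_retic N v \<longleftrightarrow> v \<in> nodes N \<and> indeg N v = 2 \<and> outdeg N v = 1"

definition leaves :: "net \<Rightarrow> nat set" where
  "leaves N = {v. is_leaf N v}"

text \<open>Rooted binary phylogenetic network: finite acyclic digraph (edges are a set,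
  so no multiple edges), a unique node of indegree 0 which is the root, every other
  node a leaf, tree node or reticulation node.\<close>
definition phylo_network :: "net \<Rightarrow> bool" where
  "phylo_network N \<longleftrightarrow>
     finite (nodes N) \<and> arcs N \<subseteq> nodes N \<times> nodes N \<and> acyclic (arcs N) \<and>
     (\<exists>!r. r \<in> nodes N \<and> indeg N r = 0) \<and>
     (\<forall>v \<in> nodes N. is_root N v \<or> is_leaf N v \<or> is_tree_node N v \<or> is_retic N v)"

definition the_root :: "net \<Rightarrow> nat" where
  "the_root N = (THE r. r \<in> nodes N \<and> indeg N r = 0)"

definition dpath :: "net \<Rightarrow> nat list \<Rightarrow> bool" where
  "dpath N xs \<longleftrightarrow> xs \<noteq> [] \<and> set xs \<subseteq> nodes N \<and> set (zip xs (tl xs)) \<subseteq> arcs N"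
definition path_edges :: "nat list \<Rightarrow> (nat \<times> nat) set" where
  "path_edges xs = set (zip xs (tl xs))"

definition tree_cycle :: "net \<Rightarrow> (nat \<times> nat) set \<Rightarrow> bool" where
  "tree_cycle N K \<longleftrightarrow> (\<exists>p q. dpath N p \<and> dpath N q \<and> hd p = hd q \<and> last p = last q \<and>
     (is_tree_node N (hd p) \<or> is_root N (hd p)) \<and> is_retic N (last p) \<and>
     path_edges p \<inter> path_edges q = {} \<and>
     (\<forall>w \<in> set (butlast (tl p)) \<union> set (butlast (tl q)). is_tree_node N w) \<and>
     K = path_edges p \<union> path_edges q)"

definition cycle_nodes :: "(nat \<times> nat) set \<Rightarrow> nat set" where
  "cycle_nodes K = fst ` K \<union> snd ` K"

definition galled_tree :: "net \<Rightarrow> bool" where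
  "galled_tree N \<longleftrightarrow> phylo_network N \<and>
     (\<forall>v. is_retic N v \<longrightarrow> (\<exists>K. tree_cycle N K \<and> v \<in> cycle_nodes K)) \<and>
     (\<forall>K1 K2. tree_cycle N K1 \<and> tree_cycle N K2 \<and> K1 \<noteq> K2 \<longrightarrow>
        cycle_nodes K1 \<inter> cycle_nodes K2 = {})"

definition labeled :: "nat \<Rightarrow> net \<Rightarrow> bool" where
  "labeled n N \<longleftrightarrow> bij_betw (lab N) (leaves N) {1..n}"

definition net_iso :: "net \<Rightarrow> net \<Rightarrow> bool" where
  "net_iso N1 N2 \<longleftrightarrow> (\<exists>f. bij_betw f (nodes N1) (nodes N2) \<and>
     (\<forall>x \<in> nodes N1. \<forall>y \<in> nodes N1. (x, y) \<in> arcs N1 \<longleftrightarrow> (f x, f y) \<in> arcs N2) \<and>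
     (\<forall>x \<in> leaves N1. lab N2 (f x) = lab N1 x))"

definition LGT :: "nat \<Rightarrow> net set" where
  "LGT n = {N. galled_tree N \<and> labeled n N}"

definition LGT_classes :: "nat \<Rightarrow> net set set" where
  "LGT_classes n = LGT n // {(N1, N2). N1 \<in> LGT n \<and> N2 \<in> LGT n \<and> net_iso N1 N2}"

definition hmax :: "net \<Rightarrow> nat \<Rightarrow> nat" where
  "hmax N x = Max {length p - 1 | p. dpath N p \<and> hd p = the_root N \<and> last p = x}"
definition hmin :: "net \<Rightarrow> nat \<Rightarrow> nat" where
  "hmin N x = Min {length p - 1 | p. dpath N p \<and> hd p = the_root N \<and> last p = x}"

definition sackin_max :: "net \<Rightarrow> nat" where
  "sackin_max N = (\<Sum>x \<in> leaves N. hmax N x)"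
definition sackin_min :: "net \<Rightarrow> nat" where
  "sackin_min N = (\<Sum>x \<in> leaves N. hmin N x)"

text \<open>Expectation of an isomorphism-invariant statistic under the uniform
  distribution on (isomorphism classes of) labeled galled trees with n leaves.\<close>
definition uniform_LGT_expectation :: "(net \<Rightarrow> nat) \<Rightarrow> nat \<Rightarrow> real" where
  "uniform_LGT_expectation f n =
     (\<Sum>C \<in> LGT_classes n. real (the_elem (f ` C))) / real (card (LGT_classes n))"

end

theory Submission
  imports Defs "HOL-Library.Multiset" "HOL-Combinatorics.Multiset_Permutations"
    "HOL-Complex_Analysis.Complex_Analysis"
begin

text \<open>
  Reading a galled tree from the root down, every node that is not inside a tree-cycle is a leaf, has two
  independent subtrees below it, or is the top of a tree-cycle; in the last case the network splits into
  the subtrees hanging off the two sides of the cycle and the one below the reticulation. Choosing a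
  left-right order at each of the \<open>k\<close> branchings turns an isomorphism class of labeled galled trees into
  exactly \<open>2^k\<close> ordered terms, so that \<open>n!\<close> cancels and the expectation is a quotient of weighted counts
  of unlabeled ordered terms. Their generating functions satisfy
  \<open>T = z + T\<^sup>2/2 + T (C\<^sup>2 - 1)/2\<close> with \<open>C = 1/(1 - T)\<close>, and \<open>H = z T'\<^sup>2 A(T)\<close> for the total Sackin index,
  with an explicit rational function \<open>A\<close>.

  The equation for \<open>T\<close> is equivalent to \<open>(1 - 8z)(1 - T)\<^sup>2 = (2T\<^sup>2 - 5T + 1)\<^sup>2\<close>. Hence
  \<open>T = (5 - E)/4 - (1 - 1/E)/4 \<cdot> sqrt (1 - 8z)\<close> where \<open>E = sqrt (9 - 4z + 4 sqrt (5 - 4z + z\<^sup>2))\<close> is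
  holomorphic in the unit disc and \<open>E(1/8) = sqrt 17\<close>. The coefficients of \<open>T\<close> are therefore asymptotic to a
  multiple of those of \<open>sqrt (1 - 8z)\<close>, while \<open>(1 - 8z) H\<close> converges absolutely at \<open>1/8\<close>, so that the
  coefficients of \<open>H\<close> divided by \<open>8^n\<close> converge to its value there.
\<close>

section \<open>Ordered terms and the networks they describe\<close>

text \<open>\<open>Gall c d t\<close> stands for a tree-cycle: the chains \<open>c\<close> and \<open>d\<close> list, from the top down, the subtrees
  hanging off its two sides, and \<open>t\<close> is the subtree below the reticulation node.\<close>
datatype 'a gt = Leaf 'a | Node "'a gt" "'a gt" | Gall "'a ch" "'a ch" "'a gt"
  and 'a ch = End | Chn "'a gt" "'a ch"

definition out :: "net \<Rightarrow> nat \<Rightarrow> nat set" where "out N v = {w. (v, w) \<in> arcs N}"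
definition par :: "net \<Rightarrow> nat \<Rightarrow> nat set" where "par N v = {u. (u, v) \<in> arcs N}"

text \<open>\<open>reps N v t V\<close>: the nodes below \<open>v\<close> form the set \<open>V\<close>, and \<open>t\<close> describes what they look like.
  \<open>chn N w u c r p V\<close>: a side of a tree-cycle is entered along the arc \<open>(w, u)\<close>, ends with the arc \<open>(p, r)\<close> into the
  reticulation node \<open>r\<close>, and \<open>V\<close> consists of its inner nodes together with everything hanging off them.\<close>
inductive reps :: "net \<Rightarrow> nat \<Rightarrow> nat gt \<Rightarrow> nat set \<Rightarrow> bool"
  and chn :: "net \<Rightarrow> nat \<Rightarrow> nat \<Rightarrow> nat ch \<Rightarrow> nat \<Rightarrow> nat \<Rightarrow> nat set \<Rightarrow> bool"
  for N where
  reps_Leaf: "out N v = {} \<Longrightarrow> l = lab N v \<Longrightarrow> reps N v (Leaf l) {v}"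
| reps_Node: "out N v = {x, y} \<Longrightarrow> x \<noteq> y \<Longrightarrow> par N x = {v} \<Longrightarrow> par N y = {v} \<Longrightarrow>
    reps N x a V \<Longrightarrow> reps N y b W \<Longrightarrow> v \<notin> V \<Longrightarrow> v \<notin> W \<Longrightarrow> V \<inter> W = {} \<Longrightarrow>
    X = insert v (V \<union> W) \<Longrightarrow> reps N v (Node a b) X"
| reps_Gall: "out N v = {x, y} \<Longrightarrow> x \<noteq> y \<Longrightarrow> chn N v x c r p V \<Longrightarrow> chn N v y d r q W \<Longrightarrow>
    par N r = {p, q} \<Longrightarrow> p \<noteq> q \<Longrightarrow> out N r = {s} \<Longrightarrow> par N s = {r} \<Longrightarrow> reps N s t U \<Longrightarrow>
    v \<notin> V \<Longrightarrow> v \<notin> W \<Longrightarrow> v \<notin> U \<Longrightarrow> v \<noteq> r \<Longrightarrow> r \<notin> U \<Longrightarrow>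
    V \<inter> W = {} \<Longrightarrow> V \<inter> U = {} \<Longrightarrow> W \<inter> U = {} \<Longrightarrow>
    X = insert v (insert r (V \<union> W \<union> U)) \<Longrightarrow> reps N v (Gall c d t) X"
| chn_End: "chn N w r End r w {}"
| chn_Chn: "out N u = {x, y} \<Longrightarrow> x \<noteq> y \<Longrightarrow> par N u = {w} \<Longrightarrow> par N x = {u} \<Longrightarrow>
    reps N x a V \<Longrightarrow> chn N u y c r p W \<Longrightarrow> u \<noteq> r \<Longrightarrow> u \<notin> V \<Longrightarrow> u \<notin> W \<Longrightarrow> r \<notin> V \<Longrightarrow>
    V \<inter> W = {} \<Longrightarrow> X = insert u (V \<union> W) \<Longrightarrow> chn N w u (Chn a c) r p X"

lemma reps_basic:
  shows "reps N v t V \<Longrightarrow> finite V \<and> v \<in> V"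
    and "chn N w u c r p V \<Longrightarrow> finite V \<and> r \<notin> V \<and> u \<in> insert r V \<and> p \<in> insert w V
      \<and> (u \<in> V \<longrightarrow> par N u = {w}) \<and> (u = r \<longrightarrow> V = {} \<and> p = w \<and> c = End)"
  by (induction rule: reps_chn.inducts) auto

lemma reps_out:
  shows "reps N v t V \<Longrightarrow> z \<in> V \<Longrightarrow> out N z \<subseteq> V"
    and "chn N w u c r p V \<Longrightarrow> z \<in> V \<Longrightarrow> out N z \<subseteq> insert r V"
proof (induction rule: reps_chn.inducts)
  case (reps_Node v x y a V b W X)
  have "x \<in> V" "y \<in> W"
    using reps_basic(1)[OF \<open>reps N x a V\<close>] reps_basic(1)[OF \<open>reps N y b W\<close>] by auto
  then show ?case using reps_Node.IH reps_Node.prems \<open>X = _\<close> \<open>out N v = {x, y}\<close> by auto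
next
  case (reps_Gall v x y c r p V d q W s t U X)
  have "x \<in> insert r V" "y \<in> insert r W" "s \<in> U"
    using reps_basic(2)[OF \<open>chn N v x c r p V\<close>] reps_basic(2)[OF \<open>chn N v y d r q W\<close>]
     reps_basic(1)[OF \<open>reps N s t U\<close>] by auto
  then show ?case using reps_Gall.IH reps_Gall.prems \<open>X = _\<close> \<open>out N v = {x, y}\<close> \<open>out N r = {s}\<close> by auto
next
  case (chn_Chn u x y w a V c r p W X)
  have "x \<in> V" "y \<in> insert r W"
    using reps_basic(1)[OF \<open>reps N x a V\<close>] reps_basic(2)[OF \<open>chn N u y c r p W\<close>] by auto
  then show ?case using chn_Chn.IH chn_Chn.prems \<open>X = _\<close> \<open>out N u = {x, y}\<close> by auto
qed auto

lemma reps_par: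
  shows "reps N v t V \<Longrightarrow> z \<in> V \<Longrightarrow> z \<noteq> v \<Longrightarrow> par N z \<subseteq> V"
    and "chn N w u c r p V \<Longrightarrow> z \<in> V \<Longrightarrow> par N z \<subseteq> insert w V"
proof (induction rule: reps_chn.inducts)
  case (reps_Node v x y a V b W X)
  then show ?case
    using reps_Node.IH reps_Node.prems \<open>X = _\<close> \<open>par N x = _\<close> \<open>par N y = _\<close>
    by (cases "z = x"; cases "z = y") auto
next
  case (reps_Gall v x y c r p V d q W s t U X)
  have "p \<in> insert v V" "q \<in> insert v W" 
    using reps_basic(2)[OF \<open>chn N v x c r p V\<close>] reps_basic(2)[OF \<open>chn N v y d r q W\<close>] by auto
  then show ?case 
    using reps_Gall.IH reps_Gall.prems \<open>X = _\<close> \<open>par N r = _\<close> \<open>par N s = _\<close>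
    by (cases "z = r"; cases "z = s") auto
next
  case (chn_Chn u x y w a V c r p W X)
  show ?case
    using chn_Chn.IH chn_Chn.prems \<open>X = _\<close> \<open>par N u = _\<close> \<open>par N x = _\<close>
    by (cases "z = x"; cases "z = u") auto
qed auto

lemma reps_outdeg:
  "reps N v t V \<Longrightarrow> card (out N v) = 0 \<or> card (out N v) = 2"
  by (erule reps.cases) auto

lemma reps_types:
  shows "reps N v t V \<Longrightarrow> z \<in> V \<Longrightarrow> (card (out N z) = 0 \<or> card (out N z) = 2) \<and> (z \<noteq> v \<longrightarrow> card (par N z) = 1)
       \<or> z \<noteq> v \<and> (card (out N z) = 1 \<and> card (par N z) = 2)"
    and "chn N w u c r p V \<Longrightarrow> z \<in> V \<Longrightarrow> (card (out N z) = 0 \<or> card (out N z) = 2) \<and> card (par N z) = 1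
       \<or> (card (out N z) = 1 \<and> card (par N z) = 2)"
proof (induction rule: reps_chn.inducts)
  case (reps_Node v x y a V b W X)
  have "card (out N v) = 2" "card (par N x) = 1" "card (par N y) = 1"
    using \<open>out N v = _\<close> \<open>par N x = _\<close> \<open>par N y = _\<close> \<open>x \<noteq> y\<close> by simp_all
  moreover have "z = v \<or> z \<in> V \<or> z \<in> W" using \<open>z \<in> X\<close> \<open>X = _\<close> by simp
  ultimately show ?case using reps_Node.IH \<open>v \<notin> V\<close> \<open>v \<notin> W\<close> by metis
next
  case (reps_Gall v x y c r p V d q W s t U X)
  have "card (out N v) = 2" "card (out N r) = 1" "card (par N r) = 2" "card (par N s) = 1"
    using \<open>out N v = _\<close> \<open>out N r = _\<close> \<open>par N r = _\<close> \<open>par N s = _\<close> \<open>x \<noteq> y\<close> \<open>p \<noteq> q\<close> by simp_all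
  moreover have "z = v \<or> z = r \<or> z \<in> V \<or> z \<in> W \<or> z \<in> U" using \<open>z \<in> X\<close> \<open>X = _\<close> by auto
  ultimately show ?case using reps_Gall.IH \<open>v \<notin> V\<close> \<open>v \<notin> W\<close> \<open>v \<notin> U\<close> \<open>v \<noteq> r\<close> by metis
next
  case (chn_Chn u x y w a V c r p W X)
  have "card (out N u) = 2" "card (par N u) = 1" "card (par N x) = 1"
    using \<open>out N u = _\<close> \<open>par N u = _\<close> \<open>par N x = _\<close> \<open>x \<noteq> y\<close> by simp_all
  moreover have "z = u \<or> z \<in> V \<or> z \<in> W" using \<open>z \<in> X\<close> \<open>X = _\<close> by simp
  ultimately show ?case using chn_Chn.IH by metis
qed auto

lemma accI_out: "\<forall>w\<in>out N v. w \<in> termi (arcs N) \<Longrightarrow> v \<in> termi (arcs N)"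
  by (rule accI) (auto simp: out_def)

lemma reps_acc:
  shows "reps N v t V \<Longrightarrow> V \<subseteq> termi (arcs N)"
    and "chn N w u c r p V \<Longrightarrow> r \<in> termi (arcs N) \<Longrightarrow> V \<subseteq> termi (arcs N)"
proof (induction rule: reps_chn.inducts)
  case (reps_Leaf v l)
  then show ?case using accI_out by auto
next
  case (reps_Node v x y a V b W X)
  have "x \<in> V" "y \<in> W"
    using reps_basic(1)[OF \<open>reps N x a V\<close>] reps_basic(1)[OF \<open>reps N y b W\<close>] by auto
  then have "v \<in> termi (arcs N)" by (intro accI_out) (use reps_Node.IH \<open>out N v = _\<close> in auto)
  then show ?case using reps_Node.IH \<open>X = _\<close> by simp
next
  case (reps_Gall v x y c r p V d q W s t U X)
  have i: "x \<in> insert r V" "y \<in> insert r W" "s \<in> U"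
    using reps_basic(2)[OF \<open>chn N v x c r p V\<close>] reps_basic(2)[OF \<open>chn N v y d r q W\<close>]
     reps_basic(1)[OF \<open>reps N s t U\<close>] by auto
  have s: "s \<in> termi (arcs N)" using i \<open>U \<subseteq> termi (arcs N)\<close> by auto
  have r: "r \<in> termi (arcs N)" by (intro accI_out) (use s \<open>out N r = _\<close> in auto)
  have vw: "V \<subseteq> termi (arcs N)" "W \<subseteq> termi (arcs N)" using r reps_Gall.IH by auto
  have "v \<in> termi (arcs N)" by (intro accI_out) (use r vw i \<open>out N v = _\<close> in auto)
  then show ?case using \<open>U \<subseteq> termi (arcs N)\<close> r vw \<open>X = _\<close> by simp
next
  case (chn_Chn u x y w a V c r p W X)
  have i: "x \<in> V" "y \<in> insert r W"
    using reps_basic(1)[OF \<open>reps N x a V\<close>] reps_basic(2)[OF \<open>chn N u y c r p W\<close>] by auto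
  have "u \<in> termi (arcs N)" by (intro accI_out) (use i chn_Chn.IH chn_Chn.prems \<open>out N u = _\<close> in auto)
  then show ?case using chn_Chn.IH chn_Chn.prems \<open>X = _\<close> by simp
qed auto

lemma reps_reach:
  shows "reps N v t V \<Longrightarrow> \<forall>z\<in>V. (v, z) \<in> (arcs N)\<^sup>*"
    and "chn N w u c r p V \<Longrightarrow> \<forall>z\<in>insert r V. (u, z) \<in> (arcs N)\<^sup>*"
proof (induction rule: reps_chn.inducts)
  case (reps_Node v x y a V b W X)
  have "(v, x) \<in> arcs N" "(v, y) \<in> arcs N" using \<open>out N v = {x, y}\<close> by (auto simp: out_def)
  then have "\<forall>z\<in>V. (v, z) \<in> (arcs N)\<^sup>*" "\<forall>z\<in>W. (v, z) \<in> (arcs N)\<^sup>*"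
    using reps_Node.IH by (meson converse_rtrancl_into_rtrancl)+
  then show ?case using \<open>X = _\<close> by blast
next
  case (reps_Gall v x y c r p V d q W s t U X)
  have 1: "(v, x) \<in> arcs N" "(v, y) \<in> arcs N" "(r, s) \<in> arcs N"
    using \<open>out N v = {x, y}\<close> \<open>out N r = {s}\<close> by (auto simp: out_def)
  have 2: "\<forall>z\<in>insert r V. (v, z) \<in> (arcs N)\<^sup>*" "\<forall>z\<in>insert r W. (v, z) \<in> (arcs N)\<^sup>*"
    using 1 reps_Gall.IH by (meson converse_rtrancl_into_rtrancl)+
  then have "(v, s) \<in> (arcs N)\<^sup>*" using 1 by (meson insertI1 rtrancl_into_rtrancl)
  then have "\<forall>z\<in>U. (v, z) \<in> (arcs N)\<^sup>*"
    using reps_Gall.IH by (meson rtrancl_trans)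
  then show ?case using 2 \<open>X = _\<close> by blast
next
  case (chn_Chn u x y w a V c r p W X)
  have "(u, x) \<in> arcs N" "(u, y) \<in> arcs N" using \<open>out N u = {x, y}\<close> by (auto simp: out_def)
  then have "\<forall>z\<in>V. (u, z) \<in> (arcs N)\<^sup>*" "\<forall>z\<in>insert r W. (u, z) \<in> (arcs N)\<^sup>*"
    using chn_Chn.IH by (meson converse_rtrancl_into_rtrancl)+
  then show ?case using \<open>X = _\<close> by blast
qed auto

section \<open>Tree-cycles as arc sets\<close>

lemma indeg_par: "indeg N v = card (par N v)" and outdeg_out: "outdeg N v = card (out N v)"
  by (simp_all add: indeg_def outdeg_def par_def out_def)

lemma path_edges_simps [simp]:
  "path_edges [] = {}" "path_edges [x] = {}"
  "path_edges (x # y # ys) = insert (x, y) (path_edges (y # ys))"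
  by (auto simp: path_edges_def)

lemma fst_path_edges: "fst ` path_edges xs = set (butlast xs)"
  by (induction xs rule: induct_list012) auto

lemma snd_path_edges: "snd ` path_edges xs = set (tl xs)"
  by (induction xs rule: induct_list012) (auto simp: image_iff)

lemma path_edges_reach:
  "path_edges (x # xs) \<subseteq> A \<Longrightarrow> z \<in> set xs \<Longrightarrow> (x, z) \<in> A\<^sup>+"
proof (induction xs arbitrary: x)
  case (Cons y ys)
  then show ?case by (cases "z = y") (auto intro: trancl_into_trancl2)
qed simp

lemma path_edges_distinct:
  "acyclic A \<Longrightarrow> path_edges xs \<subseteq> A \<Longrightarrow> distinct xs"
proof (induction xs)
  case (Cons x xs)
  have "path_edges xs \<subseteq> A" using Cons(3) by (cases xs) auto
  moreover have "x \<notin> set xs" using path_edges_reach[OF Cons(3), of x] Cons(2) by (auto simp: acyclic_def)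
  ultimately show ?case using Cons by simp
qed simp

lemma path_edges_functional:
  "distinct xs \<Longrightarrow> (z, b) \<in> path_edges xs \<Longrightarrow> (z, b') \<in> path_edges xs \<Longrightarrow> b = b'"
proof (induction xs rule: induct_list012)
  case (3 x y zs)
  have "x \<notin> fst ` path_edges (y # zs)" using 3(3) fst_path_edges[of "y # zs"] in_set_butlastD by fastforce
  then show ?case using 3 by (force simp: image_iff)
qed auto

text \<open>A tree-cycle with top \<open>v\<close> and reticulation \<open>r\<close>, described by its arc set alone.\<close>
definition gall :: "net \<Rightarrow> (nat \<times> nat) set \<Rightarrow> nat \<Rightarrow> nat \<Rightarrow> bool" where
  "gall N K v r \<longleftrightarrow> K \<subseteq> arcs N \<and> v \<notin> snd ` K \<and> r \<in> snd ` K \<and> r \<notin> fst ` K \<and> v \<in> fst ` K \<and>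
     card (par N r) = 2 \<and> card (out N v) = 2 \<and>
     (\<forall>w z. z \<in> snd ` K \<longrightarrow> (w, z) \<in> arcs N \<longrightarrow> (w, z) \<in> K) \<and>
     (\<forall>b. (v, b) \<in> arcs N \<longrightarrow> (v, b) \<in> K) \<and>
     fst ` K \<subseteq> insert v (snd ` K) \<and> snd ` K \<subseteq> insert r (fst ` K) \<and>
     (\<forall>z \<in> snd ` K - {r}. card (par N z) = 1 \<and> card (out N z) = 2 \<and> (\<exists>!b. (z, b) \<in> K))"

lemma card_2_insert: "card S = 2 \<Longrightarrow> a \<in> S \<Longrightarrow> b \<in> S \<Longrightarrow> a \<noteq> b \<Longrightarrow> S = {a, b}"
  by (metis card_2_iff doubleton_eq_iff insertE singletonD)

lemma path_edges_into: "z \<in> set (tl xs) \<Longrightarrow> \<exists>a. (a, z) \<in> path_edges xs"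
  using snd_path_edges[of xs] by force
lemma path_edges_from: "z \<in> set (butlast xs) \<Longrightarrow> \<exists>a. (z, a) \<in> path_edges xs"
  using fst_path_edges[of xs] by force

lemma gall_of_tree_cycle:
  assumes "phylo_network N" "tree_cycle N K"
  shows "\<exists>v r. gall N K v r \<and> is_retic N r"
proof -
  obtain p q where pq: "dpath N p" "dpath N q" "hd p = hd q" "last p = last q"
     "is_tree_node N (hd p) \<or> is_root N (hd p)" "is_retic N (last p)"
     "path_edges p \<inter> path_edges q = {}"
     "\<forall>w \<in> set (butlast (tl p)) \<union> set (butlast (tl q)). is_tree_node N w"
     "K = path_edges p \<union> path_edges q"
    using assms(2) unfolding tree_cycle_def by blast
  define v where "v = hd p"
  define r where "r = last p"
  have vr: "v \<noteq> r" using pq(5,6) by (auto simp: v_def r_def is_tree_node_def is_root_def is_retic_def)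
  have ex: "\<exists>ps. xs = v # ps @ [r]" if xs: "dpath N xs" "hd xs = v" "last xs = r" for xs
  proof -
    obtain ys where ys: "xs = v # ys" using xs by (cases xs) (auto simp: dpath_def)
    then have "ys \<noteq> []" "last ys = r" using xs vr by auto
    then show ?thesis using ys by (metis append_butlast_last_id)
  qed
  obtain ps where ps: "p = v # ps @ [r]" using ex pq by (metis v_def r_def)
  obtain qs where qs: "q = v # qs @ [r]" using ex pq by (metis v_def r_def)
  have ac: "acyclic (arcs N)" using assms(1) by (simp add: phylo_network_def)
  have sub: "path_edges p \<subseteq> arcs N" "path_edges q \<subseteq> arcs N" using pq(1,2) by (auto simp: dpath_def path_edges_def)
  have d: "distinct p" "distinct q" using path_edges_distinct[OF ac] sub by auto
  have f: "fst ` path_edges p = insert v (set ps)" "fst ` path_edges q = insert v (set qs)"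
    by (simp_all add: fst_path_edges ps qs butlast_append)
  have s: "snd ` path_edges p = insert r (set ps)" "snd ` path_edges q = insert r (set qs)"
    by (simp_all add: snd_path_edges ps qs)
  have fK: "fst ` K = insert v (set ps \<union> set qs)" using f pq(9) by (auto simp: image_Un)
  have sK: "snd ` K = insert r (set ps \<union> set qs)" using s pq(9) by (auto simp: image_Un)
  have tn: "is_tree_node N z" if "z \<in> set ps \<union> set qs" for z using pq(8) that by (simp add: ps qs butlast_append)
  have rt: "is_retic N r" using pq(6) r_def by simp
  have one: "card (par N z) = 1 \<and> card (out N z) = 2" if "z \<in> set ps \<union> set qs" for z
    using tn[OF that] by (simp add: is_tree_node_def indeg_par outdeg_out)
  have rn: "r \<notin> set ps \<union> set qs" using tn rt by (auto simp: is_tree_node_def is_retic_def)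
  have cr: "card (par N r) = 2" using rt by (simp add: is_retic_def indeg_par)
  have cv: "card (out N v) = 2" using pq(5) by (auto simp: v_def is_tree_node_def is_root_def outdeg_out)
  have KA: "K \<subseteq> arcs N" using sub pq(9) by auto
  have par1: "w = w'" if "z \<in> set ps \<union> set qs" "(w, z) \<in> arcs N" "(w', z) \<in> arcs N" for z w w'
  proof -
    have "w \<in> par N z" "w' \<in> par N z" using that by (auto simp: par_def)
    then show ?thesis using one[OF that(1)] by (metis card_1_singletonE singletonD)
  qed
  have inK: "(w, z) \<in> K" if z: "z \<in> snd ` K" and wz: "(w, z) \<in> arcs N" for w z
  proof (cases "z = r")
    case False
    then have z': "z \<in> set ps \<union> set qs" using z sK by auto
    obtain a where "(a, z) \<in> K" using z by auto
    then show ?thesis using par1[OF z' wz] KA by blast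
  next
    case True
    obtain a where a: "(a, r) \<in> path_edges p" using path_edges_into[of r p] by (auto simp: ps)
    obtain b where b: "(b, r) \<in> path_edges q" using path_edges_into[of r q] by (auto simp: qs)
    have "a \<noteq> b" using a b pq(7) by blast
    then have "par N r = {a, b}" using cr a b sub by (intro card_2_insert) (auto simp: par_def)
    then show ?thesis using wz True a b pq(9) by (auto simp: par_def)
  qed
  have outv: "(v, b) \<in> K" if "(v, b) \<in> arcs N" for b
  proof -
    obtain a where a: "(v, a) \<in> path_edges p" using path_edges_from[of v p] by (auto simp: ps butlast_append)
    obtain b' where b: "(v, b') \<in> path_edges q" using path_edges_from[of v q] by (auto simp: qs butlast_append)
    have "a \<noteq> b'" using a b pq(7) by blast
    then have "out N v = {a, b'}" using cv a b sub by (intro card_2_insert) (auto simp: out_def)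
    then show ?thesis using that a b pq(9) by (auto simp: out_def)
  qed
  have uniq: "\<exists>!b. (z, b) \<in> K" if z: "z \<in> set ps \<union> set qs" for z
  proof (rule ex_ex1I)
    have "z \<in> fst ` K" using z fK by auto
    then show "\<exists>b. (z, b) \<in> K" by auto
    have nz: "\<not> (z \<in> set ps \<and> z \<in> set qs)"
    proof
      assume zz: "z \<in> set ps \<and> z \<in> set qs"
      obtain a where a: "(a, z) \<in> path_edges p" using path_edges_into[of z p] zz by (auto simp: ps)
      obtain b where b: "(b, z) \<in> path_edges q" using path_edges_into[of z q] zz by (auto simp: qs)
      have "a = b" using par1[OF z] a b sub by blast
      then show False using a b pq(7) by blast
    qed
    have zv: "z \<noteq> v" using z d ps qs by auto
    fix b b' assume bb: "(z, b) \<in> K" "(z, b') \<in> K"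
    have *: "(z, c) \<in> path_edges p \<Longrightarrow> z \<in> set ps" "(z, c) \<in> path_edges q \<Longrightarrow> z \<in> set qs" for c
      using f zv by (metis fst_conv image_eqI insertE)+
    show "b = b'" using bb pq(9) * nz path_edges_functional[OF d(1)] path_edges_functional[OF d(2)] by blast
  qed
  have "v \<notin> snd ` K" using sK vr d ps qs by auto
  then have "gall N K v r" unfolding gall_def
    using KA vr rn cr cv inK outv uniq one by (simp add: fK sK) blast
  then show ?thesis using rt by blast
qed

lemma gallD:
  assumes "gall N K v r"
  shows "K \<subseteq> arcs N" "v \<notin> snd ` K" "r \<in> snd ` K" "r \<notin> fst ` K" "v \<in> fst ` K"
    "card (par N r) = 2" "card (out N v) = 2"
    "z \<in> snd ` K \<Longrightarrow> (w, z) \<in> arcs N \<Longrightarrow> (w, z) \<in> K"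
    "(v, b) \<in> arcs N \<Longrightarrow> (v, b) \<in> K"
    "z \<in> fst ` K \<Longrightarrow> z \<noteq> v \<Longrightarrow> z \<in> snd ` K"
    "z \<in> snd ` K \<Longrightarrow> z \<noteq> r \<Longrightarrow> \<exists>b. (z, b) \<in> K"
    "z \<in> snd ` K \<Longrightarrow> z \<noteq> r \<Longrightarrow> card (par N z) = 1 \<and> card (out N z) = 2"
    "z \<in> snd ` K \<Longrightarrow> (z, b) \<in> K \<Longrightarrow> (z, b') \<in> K \<Longrightarrow> b = b'"
proof -
  note g = assms[unfolded gall_def]
  show "K \<subseteq> arcs N" "v \<notin> snd ` K" "r \<in> snd ` K" and r: "r \<notin> fst ` K" and "v \<in> fst ` K"
    "card (par N r) = 2" "card (out N v) = 2" using g by - (elim conjE, assumption)+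
  have 1: "\<forall>w z. z \<in> snd ` K \<longrightarrow> (w, z) \<in> arcs N \<longrightarrow> (w, z) \<in> K" using g by (elim conjE)
  then show "z \<in> snd ` K \<Longrightarrow> (w, z) \<in> arcs N \<Longrightarrow> (w, z) \<in> K" by simp
  have 2: "\<forall>b. (v, b) \<in> arcs N \<longrightarrow> (v, b) \<in> K" using g by (elim conjE)
  then show "(v, b) \<in> arcs N \<Longrightarrow> (v, b) \<in> K" by simp
  have 3: "fst ` K \<subseteq> insert v (snd ` K)" using g by (elim conjE)
  then show "z \<in> fst ` K \<Longrightarrow> z \<noteq> v \<Longrightarrow> z \<in> snd ` K" by (meson insertE subsetD)
  have 4: "snd ` K \<subseteq> insert r (fst ` K)" using g by (elim conjE)
  have 5: "\<forall>z \<in> snd ` K - {r}. card (par N z) = 1 \<and> card (out N z) = 2 \<and> (\<exists>!b. (z, b) \<in> K)"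
    using g by (elim conjE)
  show "z \<in> snd ` K \<Longrightarrow> z \<noteq> r \<Longrightarrow> \<exists>b. (z, b) \<in> K"
    "z \<in> snd ` K \<Longrightarrow> z \<noteq> r \<Longrightarrow> card (par N z) = 1 \<and> card (out N z) = 2" using 5 by auto
  assume *: "z \<in> snd ` K" "(z, b) \<in> K" "(z, b') \<in> K"
  have "z \<in> fst ` K" using * by force
  then have "z \<noteq> r" using r by metis
  then have "\<exists>!b. (z, b) \<in> K" using 5 * by simp
  then show "b = b'" using * by blast
qed

lemma gall_reach_retic:
  assumes "gall N K v r" "wf ((arcs N)\<inverse>)" "z \<in> snd ` K"
  shows "(z, r) \<in> K\<^sup>*"
  using assms(2,3)
proof (induction z rule: wf_induct_rule)
  case (less z)
  show ?case
  proof (cases "z = r")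
    case False
    obtain b where b: "(z, b) \<in> K" using gallD(11)[OF assms(1) less(2) False] by blast
    have "b \<in> snd ` K" using b by force
    then show ?thesis using less(1)[of b] b gallD(1)[OF assms(1)] by (auto intro: converse_rtrancl_into_rtrancl)
  qed simp
qed

lemma gall_reach_top:
  assumes "gall N K v r" "wf (arcs N)" "z \<in> cycle_nodes K"
  shows "(v, z) \<in> K\<^sup>*"
  using assms(2,3)
proof (induction z rule: wf_induct_rule)
  case (less z)
  show ?case
  proof (cases "z = v")
    case False
    then have "z \<in> snd ` K" using gallD(10)[OF assms(1) _ False] less(2) by (auto simp: cycle_nodes_def)
    then obtain a where a: "(a, z) \<in> K" by auto
    have "a \<in> cycle_nodes K" using a by (force simp: cycle_nodes_def)
    then show ?thesis using less(1)[of a] a gallD(1)[OF assms(1)] by (auto intro: rtrancl_into_rtrancl)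
  qed simp
qed

lemma gall_subset_aux:
  assumes g1: "gall N K1 v1 r" and g2: "gall N K2 v2 r" and wf: "wf ((arcs N)\<inverse>)" and "v2 \<notin> snd ` K1"
  shows "snd ` K1 \<subseteq> snd ` K2"
proof
  fix z assume z: "z \<in> snd ` K1"
  have "(z, r) \<in> K1\<^sup>*" by (rule gall_reach_retic[OF g1 wf z])
  then show "z \<in> snd ` K2" using z
  proof (induction rule: converse_rtrancl_induct)
    case base
    then show ?case using gallD(3)[OF g2] by simp
  next
    case (step y z)
    then have "z \<in> snd ` K1" by force
    with step have "z \<in> snd ` K2" by blast
    then have "(y, z) \<in> K2" using gallD(8)[OF g2] gallD(1)[OF g1] step by blast
    moreover have "y \<noteq> v2" using step assms(4) by blast
    ultimately show ?case using gallD(10)[OF g2] by force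
  qed
qed

lemma gall_top_notin:
  assumes g1: "gall N K1 v1 r" and g2: "gall N K2 v2 r" and ac: "acyclic (arcs N)" and wf: "wf ((arcs N)\<inverse>)" "wf (arcs N)"
  shows "v2 \<notin> snd ` K1"
proof
  assume v2: "v2 \<in> snd ` K1"
  have "v1 \<noteq> v2" using v2 gallD(2)[OF g1] by blast
  have "(v1, v2) \<in> K1\<^sup>*" using gall_reach_top[OF g1 wf(2)] v2 by (simp add: cycle_nodes_def)
  then have 1: "(v1, v2) \<in> (arcs N)\<^sup>+" using \<open>v1 \<noteq> v2\<close> gallD(1)[OF g1]
    by (metis rtranclD trancl_mono)
  have "v1 \<notin> snd ` K2"
  proof
    assume "v1 \<in> snd ` K2"
    then have "(v2, v1) \<in> K2\<^sup>*" using gall_reach_top[OF g2 wf(2)] by (simp add: cycle_nodes_def)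
    then have "(v2, v1) \<in> (arcs N)\<^sup>+" using \<open>v1 \<noteq> v2\<close> gallD(1)[OF g2] by (metis rtranclD trancl_mono)
    then show False using 1 ac by (meson acyclic_def trancl_trans)
  qed
  then have sub: "snd ` K2 \<subseteq> snd ` K1" using gall_subset_aux[OF g2 g1 wf(1)] by simp
  obtain x y where xy: "out N v2 = {x, y}" "x \<noteq> y" using gallD(7)[OF g2] by (meson card_2_iff)
  have "(v2, x) \<in> K2" "(v2, y) \<in> K2" using xy gallD(9)[OF g2] by (auto simp: out_def)
  then have "x \<in> snd ` K1" "y \<in> snd ` K1" using sub by force+
  then have "(v2, x) \<in> K1" "(v2, y) \<in> K1" using gallD(8)[OF g1] xy by (auto simp: out_def)
  then show False using gallD(13)[OF g1 v2] xy by blast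
qed

lemma gall_same_retic:
  assumes g1: "gall N K1 v1 r" and g2: "gall N K2 v2 r" and ac: "acyclic (arcs N)" and wf: "wf ((arcs N)\<inverse>)" "wf (arcs N)"
  shows "K1 = K2"
proof -
  have "snd ` K1 = snd ` K2"
    using gall_subset_aux[OF g1 g2 wf(1)] gall_subset_aux[OF g2 g1 wf(1)] gall_top_notin[OF g1 g2 ac wf] gall_top_notin[OF g2 g1 ac wf] by blast
  moreover have "K1 = {(a, b) \<in> arcs N. b \<in> snd ` K1}" using gallD(1,8)[OF g1] by force
  moreover have "K2 = {(a, b) \<in> arcs N. b \<in> snd ` K2}" using gallD(1,8)[OF g2] by force
  ultimately show ?thesis by metis
qed

section \<open>Networks described by terms are galled trees\<close>

lemma chn_path:
  shows "reps N v t V \<Longrightarrow> True"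
    and "chn N w u c r p V \<Longrightarrow> (w, u) \<in> arcs N \<Longrightarrow>
     \<exists>ys. set ys \<subseteq> V \<and> path_edges (w # ys @ [r]) \<subseteq> arcs N \<and> hd (ys @ [r]) = u \<and>
       (\<forall>z \<in> set ys. card (par N z) = 1 \<and> card (out N z) = 2)"
proof (induction rule: reps_chn.inducts)
  case (chn_End w r)
  then show ?case by (intro exI[of _ "[]"]) auto
next
  case (chn_Chn u x y w a V c r p W X)
  have "(u, y) \<in> arcs N" using \<open>out N u = _\<close> by (auto simp: out_def)
  then obtain ys where ys: "set ys \<subseteq> W" "path_edges (u # ys @ [r]) \<subseteq> arcs N" "hd (ys @ [r]) = y"
       "\<forall>z \<in> set ys. card (par N z) = 1 \<and> card (out N z) = 2"
    using chn_Chn.IH by blast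
  have "card (par N u) = 1" "card (out N u) = 2" using \<open>out N u = _\<close> \<open>par N u = _\<close> \<open>x \<noteq> y\<close> by auto
  then show ?case using ys \<open>X = _\<close> \<open>(w, u) \<in> arcs N\<close>
    by (intro exI[of _ "u # ys"]) auto
qed auto

lemma tree_cycle_of_chains:
  assumes "out N v = {x, y}" "x \<noteq> y" "chn N v x c r p V" "chn N v y d r q W" "card (par N r) = 2" "card (out N r) = 1"
    and "V \<inter> W = {}" "v \<notin> V" "v \<notin> W" "v \<noteq> r"
    and nd: "insert v (insert r (V \<union> W)) \<subseteq> nodes N" and pv: "card (par N v) \<le> 1"
  shows "\<exists>K. tree_cycle N K \<and> r \<in> cycle_nodes K"
proof -
  have a: "(v, x) \<in> arcs N" "(v, y) \<in> arcs N" using assms(1) by (auto simp: out_def)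
  obtain ys where ys: "set ys \<subseteq> V" "path_edges (v # ys @ [r]) \<subseteq> arcs N" "hd (ys @ [r]) = x"
       "\<forall>z \<in> set ys. card (par N z) = 1 \<and> card (out N z) = 2"
    using chn_path(2)[OF assms(3) a(1)] by blast
  obtain zs where zs: "set zs \<subseteq> W" "path_edges (v # zs @ [r]) \<subseteq> arcs N" "hd (zs @ [r]) = y"
       "\<forall>z \<in> set zs. card (par N z) = 1 \<and> card (out N z) = 2"
    using chn_path(2)[OF assms(4) a(2)] by blast
  define P where "P = v # ys @ [r]"
  define Q where "Q = v # zs @ [r]"
  have rV: "r \<notin> V" "r \<notin> W" using reps_basic(2)[OF assms(3)] reps_basic(2)[OF assms(4)] by auto
  have disj: "path_edges P \<inter> path_edges Q = {}"
  proof (rule ccontr)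
    assume "path_edges P \<inter> path_edges Q \<noteq> {}"
    then obtain e f where ef: "(e, f) \<in> path_edges P" "(e, f) \<in> path_edges Q" by auto
    have "e \<in> fst ` path_edges P" "e \<in> fst ` path_edges Q" using ef by force+
    then have "e \<in> insert v (set ys)" "e \<in> insert v (set zs)" by (simp_all add: fst_path_edges P_def Q_def butlast_append)
    then have e: "e = v" using ys(1) zs(1) assms(7) by auto
    have *: "(v, f) \<in> path_edges (v # us @ [r]) \<Longrightarrow> v \<notin> set us \<Longrightarrow> f = hd (us @ [r])" for us
    proof -
      assume 1: "(v, f) \<in> path_edges (v # us @ [r])" "v \<notin> set us"
      have "v \<notin> fst ` path_edges (us @ [r])" using 1(2) by (simp add: fst_path_edges)
      then show "f = hd (us @ [r])" using 1 by (cases us) (auto simp: image_iff)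
    qed
    have "f = x" "f = y" using *[of ys] *[of zs] ef e ys(1,3) zs(1,3) assms(8,9) by (auto simp: P_def Q_def)
    then show False using assms(2) by simp
  qed
  have "tree_cycle N (path_edges P \<union> path_edges Q)"
    unfolding tree_cycle_def
  proof (rule exI[of _ P], rule exI[of _ Q], intro conjI)
    show "dpath N P" "dpath N Q" using nd ys(1,2) zs(1,2) by (auto simp: dpath_def P_def Q_def path_edges_def)
    have "card (par N v) = 0 \<or> card (par N v) = 1" using pv by linarith
    then show "is_tree_node N (hd P) \<or> is_root N (hd P)" using nd assms(1,2)
      by (auto simp: P_def is_tree_node_def is_root_def indeg_par outdeg_out)
    show "is_retic N (last P)" using nd assms(5,6) by (auto simp: P_def is_retic_def indeg_par outdeg_out)
    show "\<forall>w\<in>set (butlast (tl P)) \<union> set (butlast (tl Q)). is_tree_node N w"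
      using ys(1,4) zs(1,4) nd by (auto simp: P_def Q_def butlast_append is_tree_node_def indeg_par outdeg_out)
  qed (use disj in \<open>auto simp: P_def Q_def\<close>)
  moreover have "r \<in> cycle_nodes (path_edges P \<union> path_edges Q)"
    by (simp add: cycle_nodes_def image_Un snd_path_edges P_def)
  ultimately show ?thesis by blast
qed

lemma reps_retic_in_cycle:
  shows "reps N v t V \<Longrightarrow> V \<subseteq> nodes N \<Longrightarrow> card (par N v) \<le> 1 \<Longrightarrow>
      \<forall>z\<in>V. card (par N z) = 2 \<longrightarrow> (\<exists>K. tree_cycle N K \<and> z \<in> cycle_nodes K)"
    and "chn N w u c r p V \<Longrightarrow> V \<subseteq> nodes N \<Longrightarrow>
      \<forall>z\<in>V. card (par N z) = 2 \<longrightarrow> (\<exists>K. tree_cycle N K \<and> z \<in> cycle_nodes K)"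
proof (induction rule: reps_chn.inducts)
  case (reps_Node v x y a V b W X)
  have "card (par N x) \<le> 1" "card (par N y) \<le> 1" using \<open>par N x = _\<close> \<open>par N y = _\<close> by simp_all
  then show ?case using reps_Node.IH reps_Node.prems \<open>X = _\<close> by auto
next
  case (reps_Gall v x y c r p V d q W s t U X)
  have "card (par N r) = 2" "card (out N r) = 1" and s: "card (par N s) \<le> 1"
    using \<open>par N r = _\<close> \<open>out N r = _\<close> \<open>p \<noteq> q\<close> \<open>par N s = _\<close> by simp_all
  moreover have "insert v (insert r (V \<union> W)) \<subseteq> nodes N" using reps_Gall.prems \<open>X = _\<close> by auto
  ultimately have "\<exists>K. tree_cycle N K \<and> r \<in> cycle_nodes K"
    using tree_cycle_of_chains[OF \<open>out N v = _\<close> \<open>x \<noteq> y\<close> \<open>chn N v x c r p V\<close> \<open>chn N v y d r q W\<close>]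
      \<open>V \<inter> W = {}\<close> \<open>v \<notin> V\<close> \<open>v \<notin> W\<close> \<open>v \<noteq> r\<close> \<open>card (par N v) \<le> 1\<close> by blast
  then show ?case using s reps_Gall.IH reps_Gall.prems \<open>X = _\<close> by auto
next
  case (chn_Chn u x y w a V c r p W X)
  have "card (par N x) \<le> 1" "card (par N u) = 1" using \<open>par N x = _\<close> \<open>par N u = _\<close> by simp_all
  then show ?case using chn_Chn.IH chn_Chn.prems \<open>X = _\<close> by auto
qed auto

lemma reps_reach_closed:
  assumes "reps N v t V" "(a, b) \<in> (arcs N)\<^sup>*" "a \<in> V" shows "b \<in> V"
  using assms(2,3)
proof (induction rule: rtrancl_induct)
  case (step y z)
  then show ?case using reps_out(1)[OF assms(1), of y] by (auto simp: out_def)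
qed simp

text \<open>Both sides of a gall would have to enter the closed region \<open>V\<close> through \<open>v\<close>.\<close>
lemma reps_not_in_gall:
  assumes re: "reps N v t V" and pv: "card (par N v) \<le> 1" and g: "gall N K w r"
    and ac: "acyclic (arcs N)" and wf: "wf ((arcs N)\<inverse>)" "wf (arcs N)"
  shows "v \<notin> snd ` K"
proof
  assume v: "v \<in> snd ` K"
  have KA: "K\<^sup>* \<subseteq> (arcs N)\<^sup>*" using gallD(1)[OF g] by (rule rtrancl_mono)
  have vV: "v \<in> V" using reps_basic(1)[OF re] by simp
  have rV: "r \<in> V" using reps_reach_closed[OF re _ vV] gall_reach_retic[OF g wf(1) v] KA by blast
  have wV: "w \<notin> V"
  proof
    assume "w \<in> V"
    then have 1: "(v, w) \<in> (arcs N)\<^sup>*" using reps_reach(1)[OF re] by blast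
    have "(w, v) \<in> (arcs N)\<^sup>*" using gall_reach_top[OF g wf(2)] v KA by (auto simp: cycle_nodes_def)
    moreover have "w \<noteq> v" using v gallD(2)[OF g] by blast
    ultimately show False using 1 ac by (metis acyclic_def rtranclD rtrancl_trancl_trancl)
  qed
  have rv: "r \<noteq> v" using pv gallD(6)[OF g] by auto
  obtain p q where pq: "par N r = {p, q}" "p \<noteq> q" using gallD(6)[OF g] by (meson card_2_iff)
  have pqK: "(p, r) \<in> K" "(q, r) \<in> K" using gallD(8)[OF g gallD(3)[OF g]] pq by (auto simp: par_def)
  have pqV: "p \<in> V" "q \<in> V" using reps_par(1)[OF re rV rv] pq by auto
  define L where "L = {(a, b) \<in> K. a \<in> V}"
  have reach: "z \<in> cycle_nodes K \<Longrightarrow> z \<in> V \<Longrightarrow> (v, z) \<in> L\<^sup>*" for z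
    using wf(2)
  proof (induction z rule: wf_induct_rule)
    case (less z)
    show ?case
    proof (cases "z = v")
      case False
      have "z \<noteq> w" using less wV by blast
      then have "z \<in> snd ` K" using less(2) gallD(10)[OF g] by (auto simp: cycle_nodes_def)
      then obtain a where a: "(a, z) \<in> K" by auto
      have "a \<in> V" using reps_par(1)[OF re less(3) False] a gallD(1)[OF g] by (auto simp: par_def)
      moreover have "a \<in> cycle_nodes K" using a by (force simp: cycle_nodes_def)
      ultimately have "(v, a) \<in> L\<^sup>*" using less(1) a gallD(1)[OF g] by blast
      then show ?thesis using a \<open>a \<in> V\<close> by (auto simp: L_def intro: rtrancl_into_rtrancl)
    qed simp
  qed
  have LK: "(a, b) \<in> L \<Longrightarrow> (a, b) \<in> K \<and> a \<in> snd ` K" for a b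
    using gallD(10)[OF g, of a] wV by (force simp: L_def)
  have sv: "single_valued L" using LK gallD(13)[OF g] by (meson single_valuedI)
  have pqf: "p \<in> fst ` K" "q \<in> fst ` K" using pqK by force+
  have "(v, p) \<in> L\<^sup>*" "(v, q) \<in> L\<^sup>*" using reach pqV pqf by (auto simp: cycle_nodes_def)
  then have "(p, q) \<in> L\<^sup>* \<or> (q, p) \<in> L\<^sup>*" by (rule single_valued_confluent[OF sv])
  moreover have imp: "False" if ab: "(a, b) \<in> L\<^sup>*" "a \<noteq> b" "(a, r) \<in> K" "b \<in> fst ` K" for a b
  proof -
    obtain c where c: "(a, c) \<in> L" "(c, b) \<in> L\<^sup>*" using ab(1,2) by (meson converse_rtranclE)
    have "c = r" using gallD(13)[OF g] LK[OF c(1)] ab(3) by blast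
    moreover have "b \<noteq> r" using ab(4) gallD(4)[OF g] by blast
    ultimately obtain e where "(r, e) \<in> L" using c(2) by (metis converse_rtranclE)
    then have "r \<in> fst ` K" using LK by force
    then show False using gallD(4)[OF g] by simp
  qed
  ultimately show False using pq(2) pqK pqf by metis
qed

lemma chn_gall_retic:
  shows "reps N v t V \<Longrightarrow> True"
    and "chn N w u c r p V \<Longrightarrow> gall N K w' r' \<Longrightarrow> acyclic (arcs N) \<Longrightarrow> wf ((arcs N)\<inverse>) \<Longrightarrow> wf (arcs N) \<Longrightarrow>
      card (out N r) = 1 \<Longrightarrow> u \<in> cycle_nodes K \<Longrightarrow> r' = r"
proof (induction rule: reps_chn.inducts)
  case (chn_End w r)
  note g = \<open>gall N K w' r'\<close>
  have "r \<noteq> w'" using gallD(7)[OF g] \<open>card (out N r) = 1\<close> by auto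
  then have "r \<in> snd ` K" using gallD(10)[OF g] \<open>r \<in> cycle_nodes K\<close> by (auto simp: cycle_nodes_def)
  then show ?case using gallD(12)[OF g] \<open>card (out N r) = 1\<close> by force
next
  case (chn_Chn u x y w a V c r p W X)
  note g = \<open>gall N K w' r'\<close>
  have "u \<noteq> r'" using gallD(6)[OF g] \<open>par N u = _\<close> by auto
  then have "u \<in> fst ` K" using gallD(11)[OF g, of u] \<open>u \<in> cycle_nodes K\<close> by (force simp: cycle_nodes_def)
  then obtain b where b: "(u, b) \<in> K" by auto
  have "x \<notin> snd ` K" using reps_not_in_gall[OF \<open>reps N x a V\<close> _ g] \<open>par N x = _\<close> chn_Chn.prems by simp
  then have "b \<noteq> x" using b by force
  then have "b = y" using b gallD(1)[OF g] \<open>out N u = _\<close> by (auto simp: out_def)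
  then have "y \<in> cycle_nodes K" using b by (force simp: cycle_nodes_def)
  then show ?case using chn_Chn.IH chn_Chn.prems by blast
qed auto

lemma reps_gall_retic:
  assumes ac: "acyclic (arcs N)" and wf: "wf ((arcs N)\<inverse>)" "wf (arcs N)"
  shows "reps N v t V \<Longrightarrow> card (par N v) \<le> 1 \<Longrightarrow>
      \<forall>z\<in>V. \<exists>r. \<forall>K w' r'. gall N K w' r' \<longrightarrow> z \<in> cycle_nodes K \<longrightarrow> r' = r"
    and "chn N w u c r p V \<Longrightarrow> card (out N r) = 1 \<Longrightarrow> 
      \<forall>z\<in>V. \<exists>r. \<forall>K w' r'. gall N K w' r' \<longrightarrow> z \<in> cycle_nodes K \<longrightarrow> r' = r"
proof (induction rule: reps_chn.inducts)
  case (reps_Leaf v l)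
  have "v \<notin> cycle_nodes K" if g: "gall N K w' r'" for K w' r'
  proof
    assume v: "v \<in> cycle_nodes K"
    have "v \<noteq> w'" "v \<noteq> r'" using gallD(6,7)[OF g] reps_Leaf by auto
    then have "v \<in> snd ` K" using v gallD(10)[OF g] by (auto simp: cycle_nodes_def)
    then show False using gallD(12)[OF g _ \<open>v \<noteq> r'\<close>] reps_Leaf by auto
  qed
  then show ?case by auto
next
  case (reps_Node v x y a V b W X)
  have p: "card (par N x) \<le> 1" "card (par N y) \<le> 1" using \<open>par N x = _\<close> \<open>par N y = _\<close> by simp_all
  have "v \<notin> cycle_nodes K" if g: "gall N K w' r'" for K w' r'
  proof
    assume v: "v \<in> cycle_nodes K"
    have "v \<noteq> r'" using gallD(6)[OF g] reps_Node.prems by auto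
    then have "v \<in> fst ` K" using gallD(11)[OF g, of v] v by (force simp: cycle_nodes_def)
    then obtain e where e: "(v, e) \<in> K" by auto
    then have "e = x \<or> e = y" using gallD(1)[OF g] \<open>out N v = _\<close> by (auto simp: out_def)
    moreover have "e \<in> snd ` K" using e by force
    ultimately show False
      using reps_not_in_gall[OF \<open>reps N x a V\<close> p(1) g ac wf] reps_not_in_gall[OF \<open>reps N y b W\<close> p(2) g ac wf] by blast
  qed
  then have "\<exists>r. \<forall>K w' r'. gall N K w' r' \<longrightarrow> v \<in> cycle_nodes K \<longrightarrow> r' = r" by blast
  then show ?case using reps_Node.IH p \<open>X = _\<close> by simp blast
next
  case (reps_Gall v x y c r p V d q W s t U X)
  have p: "card (par N s) \<le> 1" "card (out N r) = 1" using \<open>par N s = _\<close> \<open>out N r = _\<close> by simp_all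
  have "r' = r" if g: "gall N K w' r'" and v: "v \<in> cycle_nodes K" for K w' r'
  proof -
    have "v \<noteq> r'" using gallD(6)[OF g] reps_Gall.prems by auto
    then have "v \<in> fst ` K" using gallD(11)[OF g, of v] v by (force simp: cycle_nodes_def)
    then obtain e where e: "(v, e) \<in> K" by auto
    then have "e = x \<or> e = y" using gallD(1)[OF g] \<open>out N v = _\<close> by (auto simp: out_def)
    moreover have "e \<in> cycle_nodes K" using e by (force simp: cycle_nodes_def)
    ultimately show ?thesis
      using chn_gall_retic(2)[OF \<open>chn N v x c r p V\<close> g ac wf p(2)] chn_gall_retic(2)[OF \<open>chn N v y d r q W\<close> g ac wf p(2)] by blast
  qed
  then have 1: "\<exists>r. \<forall>K w' r'. gall N K w' r' \<longrightarrow> v \<in> cycle_nodes K \<longrightarrow> r' = r" by blast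
  have "r' = r" if g: "gall N K w' r'" and v: "r \<in> cycle_nodes K" for K w' r'
    by (rule chn_gall_retic(2)[OF chn_End g ac wf p(2) v])
  then have 2: "\<exists>r''. \<forall>K w' r'. gall N K w' r' \<longrightarrow> r \<in> cycle_nodes K \<longrightarrow> r' = r''" by blast
  note IH = \<open>card (par N s) \<le> 1 \<Longrightarrow> _\<close>[OF p(1)] reps_Gall.IH
  have "z \<in> V \<or> z \<in> W \<or> z \<in> U \<Longrightarrow> \<exists>r. \<forall>K w' r'. gall N K w' r' \<longrightarrow> z \<in> cycle_nodes K \<longrightarrow> r' = r" for z
    using IH p by blast
  then show ?case using 1 2 \<open>X = _\<close> by simp
next
  case (chn_Chn u x y w a V c r p W X)
  have p: "card (par N x) \<le> 1" using \<open>par N x = _\<close> by simp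
  have ch: "chn N w u (Chn a c) r p X"
    by (rule reps_chn.chn_Chn) (fact chn_Chn)+
  have "r' = r" if g: "gall N K w' r'" and v: "u \<in> cycle_nodes K" for K w' r'
    by (rule chn_gall_retic(2)[OF ch g ac wf chn_Chn.prems v])
  then have 2: "\<exists>r''. \<forall>K w' r'. gall N K w' r' \<longrightarrow> u \<in> cycle_nodes K \<longrightarrow> r' = r''" by blast
  have "z \<in> V \<or> z \<in> W \<Longrightarrow> \<exists>r. \<forall>K w' r'. gall N K w' r' \<longrightarrow> z \<in> cycle_nodes K \<longrightarrow> r' = r" for z
    using chn_Chn.IH chn_Chn.prems p by blast
  then show ?case using 2 \<open>X = _\<close> by simp
qed auto

theorem galled_tree_of_reps:
  assumes re: "reps N v t (nodes N)" and pv: "par N v = {}" and A: "arcs N \<subseteq> nodes N \<times> nodes N"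
    and nl: "\<And>l. t \<noteq> Leaf l"
  shows "galled_tree N"
proof -
  have fin: "finite (nodes N)" using reps_basic(1)[OF re] by simp
  have finA: "finite (arcs N)" using A fin by (meson finite_SigmaI finite_subset)
  have "wf ((arcs N)\<inverse>)"
  proof -
    have "x \<in> termi (arcs N)" for x
    proof (cases "x \<in> nodes N")
      case False
      then show ?thesis using A by (intro accI_out) (auto simp: out_def)
    qed (use reps_acc(1)[OF re] in blast)
    then show ?thesis by (simp add: wf_iff_acc)
  qed
  note wf1 = this
  have ac: "acyclic (arcs N)" using wf1 wf_acyclic by fastforce
  have wf2: "wf (arcs N)" using ac finA by (simp add: finite_acyclic_wf)
  have ty: "is_root N z \<and> z = v \<or> is_leaf N z \<or> is_tree_node N z \<or> is_retic N z" if "z \<in> nodes N" for z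
  proof (cases "z = v")
    case True
    have "card (out N v) = 2" using re nl by (cases rule: reps.cases) auto
    then show ?thesis using True that pv by (simp add: is_root_def indeg_par outdeg_out)
  next
    case False
    then show ?thesis using reps_types(1)[OF re that] that
      by (auto simp: is_leaf_def is_tree_node_def is_retic_def indeg_par outdeg_out)
  qed
  have vn: "v \<in> nodes N" using reps_basic(1)[OF re] by simp
  have "\<exists>!r. r \<in> nodes N \<and> indeg N r = 0"
  proof (rule ex1I[of _ v])
    show "v \<in> nodes N \<and> indeg N v = 0" using vn pv by (simp add: indeg_par)
    fix z assume z: "z \<in> nodes N \<and> indeg N z = 0"
    show "z = v" using ty[of z] z by (auto simp: is_leaf_def is_tree_node_def is_retic_def)
  qed
  then have ph: "phylo_network N" using fin A ac ty by (auto simp: phylo_network_def)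
  have pv1: "card (par N v) \<le> 1" using pv by simp
  have ret: "\<exists>K. tree_cycle N K \<and> z \<in> cycle_nodes K" if "is_retic N z" for z
    using reps_retic_in_cycle(1)[OF re _ pv1] that by (auto simp: is_retic_def indeg_par)
  have dis: "cycle_nodes K1 \<inter> cycle_nodes K2 = {}" if tc: "tree_cycle N K1" "tree_cycle N K2" "K1 \<noteq> K2" for K1 K2
  proof (rule ccontr)
    assume "cycle_nodes K1 \<inter> cycle_nodes K2 \<noteq> {}"
    then obtain z where z: "z \<in> cycle_nodes K1" "z \<in> cycle_nodes K2" by auto
    obtain v1 r1 where g1: "gall N K1 v1 r1" using gall_of_tree_cycle[OF ph tc(1)] by blast
    obtain v2 r2 where g2: "gall N K2 v2 r2" using gall_of_tree_cycle[OF ph tc(2)] by blast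
    have "z \<in> nodes N" using z gallD(1)[OF g1] A by (fastforce simp: cycle_nodes_def)
    then have "r1 = r2" using reps_gall_retic(1)[OF ac wf1 wf2 re pv1] z g1 g2 by metis
    then show False using gall_same_retic[OF g1 _ ac wf1 wf2] g2 tc(3) by blast
  qed
  show ?thesis using ph ret dis by (auto simp: galled_tree_def)
qed

section \<open>Galled trees are described by terms\<close>

definition desc :: "net \<Rightarrow> nat \<Rightarrow> nat set" where "desc N v = {z. (v, z) \<in> (arcs N)\<^sup>*}"
definition free :: "net \<Rightarrow> nat \<Rightarrow> bool" where "free N v \<longleftrightarrow> (\<forall>K. tree_cycle N K \<longrightarrow> v \<notin> snd ` K)"

lemma chn_last:
  shows "reps N v t V \<Longrightarrow> True"
    and "chn N w u c r p V \<Longrightarrow> u \<noteq> r \<Longrightarrow> p \<in> V"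
proof (induction rule: reps_chn.inducts)
  case (chn_Chn u x y w a V c r p W X)
  then show ?case using reps_basic(2)[OF \<open>chn N u y c r p W\<close>] by auto
qed auto

locale galled =
  fixes N :: net assumes galled: "galled_tree N"
begin

lemma ph: "phylo_network N" using galled by (simp add: galled_tree_def)
lemma fin: "finite (nodes N)" and A: "arcs N \<subseteq> nodes N \<times> nodes N" and ac: "acyclic (arcs N)"
  using ph by (simp_all add: phylo_network_def)
lemma finA: "finite (arcs N)" using A fin by (meson finite_SigmaI finite_subset)
lemma wf1: "wf ((arcs N)\<inverse>)" and wf2: "wf (arcs N)"
  using finA ac by (simp_all add: finite_acyclic_wf finite_acyclic_wf_converse)
lemma finp: "finite (par N v)" "finite (out N v)"
proof -
  have "par N v \<subseteq> fst ` arcs N" "out N v \<subseteq> snd ` arcs N" by (force simp: par_def out_def)+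
  then show "finite (par N v)" "finite (out N v)" using finA by (meson finite_imageI finite_subset)+
qed

lemma no_cycle: "(a, b) \<in> (arcs N)\<^sup>* \<Longrightarrow> (b, a) \<notin> arcs N"
  using ac by (meson acyclic_def rtrancl_into_trancl1)

lemma types: "z \<in> nodes N \<Longrightarrow> card (par N z) \<le> 1 \<and> card (out N z) = 2 \<or> card (par N z) = 1 \<and> card (out N z) = 0
    \<or> card (par N z) = 2 \<and> card (out N z) = 1"
  using ph by (auto simp: phylo_network_def is_root_def is_leaf_def is_tree_node_def is_retic_def indeg_par outdeg_out)

lemma tc_gall: "tree_cycle N K \<Longrightarrow> \<exists>v r. gall N K v r"
  using gall_of_tree_cycle[OF ph] by blast

lemma tc_eq: "tree_cycle N K \<Longrightarrow> tree_cycle N K' \<Longrightarrow> z \<in> cycle_nodes K \<Longrightarrow> z \<in> cycle_nodes K' \<Longrightarrow> K = K'"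
  using galled by (auto simp: galled_tree_def)

lemma retic_gall:
  assumes "z \<in> nodes N" "card (par N z) = 2"
  shows "\<exists>K v. tree_cycle N K \<and> gall N K v z"
proof -
  have o: "card (out N z) = 1" using types[OF assms(1)] assms(2) by auto
  then have "is_retic N z" using assms by (simp add: is_retic_def indeg_par outdeg_out)
  then obtain K where K: "tree_cycle N K" "z \<in> cycle_nodes K" using galled by (auto simp: galled_tree_def)
  obtain v r where g: "gall N K v r" using tc_gall K by blast
  have "z \<noteq> v" using o gallD(7)[OF g] by auto
  then have "z \<in> snd ` K" using K(2) gallD(10)[OF g] by (auto simp: cycle_nodes_def)
  then have "z = r" using gallD(12)[OF g, of z] o by auto
  then show ?thesis using K g by blast
qed

lemma free_card_par:
  assumes "z \<in> nodes N" "free N z" shows "card (par N z) \<le> 1"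
proof (rule ccontr)
  assume "\<not> card (par N z) \<le> 1"
  then have "card (par N z) = 2" using types[OF assms(1)] by auto
  then obtain K v where "tree_cycle N K" "gall N K v z" using retic_gall assms by blast
  then show False using assms(2) gallD(3)[of N K v z] by (auto simp: free_def)
qed

lemma free_par:
  assumes "(u, z) \<in> arcs N" "free N z" shows "par N z = {u}"
proof -
  have "z \<in> nodes N" using assms(1) A by auto
  then have c: "card (par N z) \<le> 1" using free_card_par assms(2) by blast
  have "u \<in> par N z" using assms(1) by (simp add: par_def)
  then show ?thesis using c finp by (metis One_nat_def card_le_Suc0_iff_eq is_singletonI' is_singleton_the_elem singletonD empty_iff)
qed

lemma not_free_arc:
  assumes "\<not> free N x" "(w, x) \<in> arcs N" shows "\<exists>K. tree_cycle N K \<and> (w, x) \<in> K"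
  using assms tc_gall gallD(8) unfolding free_def by metis

lemma desc_refl: "v \<in> desc N v" by (simp add: desc_def)
lemma desc_step: "(u, x) \<in> arcs N \<Longrightarrow> u \<in> desc N v \<Longrightarrow> x \<in> desc N v"
  by (auto simp: desc_def intro: rtrancl_into_rtrancl)
lemma desc_trans: "u \<in> desc N v \<Longrightarrow> x \<in> desc N u \<Longrightarrow> x \<in> desc N v"
  by (auto simp: desc_def)
lemma desc_out: "desc N v = insert v (\<Union>x\<in>out N v. desc N x)"
  by (auto simp: desc_def out_def intro: converse_rtrancl_into_rtrancl elim: converse_rtranclE)
lemma desc_acyc: "(u, x) \<in> arcs N \<Longrightarrow> u \<notin> desc N x" using no_cycle by (auto simp: desc_def)
lemma desc_parent: "z \<in> desc N v \<Longrightarrow> z \<noteq> v \<Longrightarrow> \<exists>u \<in> desc N v. (u, z) \<in> arcs N"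
  by (auto simp: desc_def elim: rtranclE)
lemma desc_par1: "z \<in> desc N v \<Longrightarrow> z \<noteq> v \<Longrightarrow> par N z = {u} \<Longrightarrow> u \<in> desc N v"
  using desc_parent[of z v] by (auto simp: par_def)

lemma gall_desc_top:
  assumes "gall N K w r" "z \<in> cycle_nodes K" shows "z \<in> desc N w"
  using gall_reach_top[OF assms(1) wf2 assms(2)] rtrancl_mono[OF gallD(1)[OF assms(1)]] by (auto simp: desc_def)

lemma gall_desc_retic:
  assumes "gall N K w r" "z \<in> snd ` K" shows "r \<in> desc N z"
  using gall_reach_retic[OF assms(1) wf1 assms(2)] rtrancl_mono[OF gallD(1)[OF assms(1)]] by (auto simp: desc_def)

lemma free_top:
  assumes f: "free N v" and K: "tree_cycle N K" "gall N K w r" and z: "z \<in> cycle_nodes K" "z \<in> desc N v"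
  shows "w \<in> desc N v"
  using wf2 z
proof (induction z rule: wf_induct_rule)
  case (less z)
  show ?case
  proof (cases "z = w")
    case False
    then have s: "z \<in> snd ` K" using less(2) gallD(10)[OF K(2)] by (auto simp: cycle_nodes_def)
    then have "z \<noteq> v" using f K by (auto simp: free_def)
    then obtain b where b: "b \<in> desc N v" "(b, z) \<in> arcs N" using desc_parent less by blast
    then have "(b, z) \<in> K" using gallD(8)[OF K(2) s] by blast
    then have "b \<in> cycle_nodes K" by (force simp: cycle_nodes_def)
    then show ?thesis using less(1)[OF b(2)] b by blast
  qed (use less in simp)
qed

lemma free_closed:
  assumes f: "free N v" and z: "z \<in> desc N v" "z \<noteq> v" and u: "(u, z) \<in> arcs N"
  shows "u \<in> desc N v"
proof -
  obtain u' where u': "u' \<in> desc N v" "(u', z) \<in> arcs N" using desc_parent z by blast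
  have zn: "z \<in> nodes N" using u A by auto
  show ?thesis
  proof (cases "card (par N z) = 2")
    case False
    then have "card (par N z) \<le> 1" using types[OF zn] by auto
    then have "u = u'" using u u'(2) finp by (metis One_nat_def card_le_Suc0_iff_eq mem_Collect_eq par_def)
    then show ?thesis using u' by simp
  next
    case True
    then obtain K w where K: "tree_cycle N K" "gall N K w z" using retic_gall zn by blast
    have "(u, z) \<in> K" "(u', z) \<in> K" using gallD(3,8)[OF K(2)] u u' by blast+
    then have c: "u \<in> cycle_nodes K" "u' \<in> cycle_nodes K" by (force simp: cycle_nodes_def)+
    have "w \<in> desc N v" by (rule free_top[OF f K c(2) u'(1)])
    then show ?thesis using gall_desc_top[OF K(2) c(1)] desc_trans by blast
  qed
qed

lemma free_disjoint:
  assumes f: "free N x" and "x \<notin> desc N y" "y \<notin> desc N x"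
  shows "desc N x \<inter> desc N y = {}"
proof (rule ccontr)
  assume "desc N x \<inter> desc N y \<noteq> {}"
  then obtain z where z: "z \<in> desc N x" "z \<in> desc N y" by auto
  have "(y, z) \<in> (arcs N)\<^sup>*" using z by (simp add: desc_def)
  then have "z \<notin> desc N x"
  proof (induction rule: rtrancl_induct)
    case (step a b)
    have "b \<in> desc N y" using step(1,2) by (auto simp: desc_def)
    then have "b \<noteq> x" using assms(2) by blast
    then show ?case using free_closed[OF f _ _ step(2)] step(3) by blast
  qed (use assms in simp)
  then show False using z by simp
qed

lemma pendant_avoids:
  assumes "free N x" "(u, x) \<in> arcs N" "u \<in> cycle_nodes K" "tree_cycle N K" "gall N K w r"
  shows "desc N x \<inter> cycle_nodes K = {}"
proof (rule ccontr)
  assume "desc N x \<inter> cycle_nodes K \<noteq> {}"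
  then obtain z where "z \<in> cycle_nodes K" "z \<in> desc N x" by auto
  then have "w \<in> desc N x" using free_top[OF assms(1,4,5)] by blast
  then have "u \<in> desc N x" using gall_desc_top[OF assms(5,3)] desc_trans by blast
  then show False using desc_acyc assms(2) by blast
qed

lemma cycle_node_out:
  assumes K: "tree_cycle N K" "gall N K w r" and u: "u \<in> snd ` K" "u \<noteq> r"
  obtains x y a where "out N u = {x, y}" "x \<noteq> y" "free N x" "(u, x) \<in> arcs N" "(u, y) \<in> K"
    "par N x = {u}" "par N u = {a}"
proof -
  obtain y where y: "(u, y) \<in> K" using gallD(11)[OF K(2) u] by blast
  have c: "card (out N u) = 2" "card (par N u) = 1" using gallD(12)[OF K(2) u] by auto
  have "y \<in> out N u" using y gallD(1)[OF K(2)] by (auto simp: out_def)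
  then obtain x where x: "out N u = {x, y}" "x \<noteq> y" using c(1)
    by (metis card_2_iff doubleton_eq_iff insertE singletonD)
  have ux: "(u, x) \<in> arcs N" using x by (auto simp: out_def)
  have "free N x"
  proof (rule ccontr)
    assume "\<not> free N x"
    then obtain K' where K': "tree_cycle N K'" "(u, x) \<in> K'" using not_free_arc ux by blast
    have "u \<in> cycle_nodes K'" using K'(2) by (force simp: cycle_nodes_def)
    moreover have "u \<in> cycle_nodes K" using u by (simp add: cycle_nodes_def)
    ultimately have "K' = K" using tc_eq K' K by blast
    then show False using gallD(13)[OF K(2) u(1) y] K' x by blast
  qed
  moreover obtain a where "par N u = {a}" using c(2) by (meson card_1_singletonE)
  ultimately show ?thesis using that x ux y free_par[OF ux] by blast
qed

lemma chain_exists: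
  assumes K: "tree_cycle N K" "gall N K w r"
    and IH: "\<And>x. free N x \<Longrightarrow> (w, x) \<in> (arcs N)\<^sup>+ \<Longrightarrow> \<exists>t. reps N x t (desc N x)"
  shows "(a, u) \<in> K \<Longrightarrow> \<exists>c p. chn N a u c r p (desc N u - desc N r) \<and> (p, r) \<in> arcs N"
  using wf1
proof (induction u arbitrary: a rule: wf_induct_rule)
  case (less u)
  show ?case
  proof (cases "u = r")
    case True
    then show ?thesis using less(2) gallD(1)[OF K(2)] chn_End[of N a r] by auto
  next
    case False
    have us: "u \<in> snd ` K" using less(2) by force
    obtain x y a' where xy: "out N u = {x, y}" "x \<noteq> y" "free N x" "(u, x) \<in> arcs N" "(u, y) \<in> K"
      "par N x = {u}" "par N u = {a'}" using cycle_node_out[OF K us False] .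
    have [simp]: "a' = a" using xy(7) less(2) gallD(1)[OF K(2)] by (auto simp: par_def)
    have uy: "(u, y) \<in> arcs N" using xy(1) by (auto simp: out_def)
    obtain c p where c: "chn N u y c r p (desc N y - desc N r)" "(p, r) \<in> arcs N"
      using less(1)[of y u] uy xy(5) by auto
    have "w \<noteq> u" using us gallD(2)[OF K(2)] by blast
    moreover have uc: "u \<in> cycle_nodes K" using us by (simp add: cycle_nodes_def)
    ultimately have "(w, u) \<in> (arcs N)\<^sup>+" using gall_desc_top[OF K(2), of u] by (metis desc_def mem_Collect_eq rtranclD)
    then obtain t where t: "reps N x t (desc N x)" using IH xy(3,4) by (meson trancl_into_trancl)
    have av: "desc N x \<inter> cycle_nodes K = {}" by (rule pendant_avoids[OF xy(3,4) uc K])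
    have yc: "y \<in> snd ` K" "y \<in> cycle_nodes K" using xy(5) by (force simp: cycle_nodes_def)+
    have rc: "r \<in> cycle_nodes K" using gallD(3)[OF K(2)] by (simp add: cycle_nodes_def)
    have "u \<notin> desc N y" using desc_acyc[OF uy] .
    then have "x \<notin> desc N y" using desc_par1[OF _ xy(2) xy(6)] by blast
    moreover have "y \<notin> desc N x" using av yc by blast
    ultimately have d: "desc N x \<inter> desc N y = {}" using free_disjoint xy(3) by blast
    have ry: "desc N r \<subseteq> desc N y" using gall_desc_retic[OF K(2) yc(1)] desc_trans by blast
    have "chn N a u (Chn t c) r p (desc N u - desc N r)"
    proof (rule chn_Chn[OF xy(1,2) _ xy(6) t c(1)])
      show "par N u = {a}" using xy by simp
      show "u \<noteq> r" by fact
      show "u \<notin> desc N x" using av uc by blast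
      show "u \<notin> desc N y - desc N r" using \<open>u \<notin> desc N y\<close> by blast
      show "r \<notin> desc N x" using av rc by blast
      show "desc N x \<inter> (desc N y - desc N r) = {}" using d by blast
      show "desc N u - desc N r = insert u (desc N x \<union> (desc N y - desc N r))"
        using desc_out[of u] xy(1) d ry \<open>u \<notin> desc N y\<close> by auto
    qed
    then show ?thesis using c by blast
  qed
qed

lemma sides_meet_below_retic:
  assumes K: "tree_cycle N K" "gall N K w r" and y: "(w, y) \<in> K"
  shows "u \<in> snd ` K \<Longrightarrow> u = r \<or> u \<notin> desc N y \<Longrightarrow> desc N u \<inter> desc N y \<subseteq> desc N r"
  using wf1
proof (induction u rule: wf_induct_rule)
  case (less u)
  show ?case
  proof (cases "u = r")
    case False
    obtain x b a' where xb: "out N u = {x, b}" "x \<noteq> b" "free N x" "(u, x) \<in> arcs N" "(u, b) \<in> K"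
      "par N x = {u}" "par N u = {a'}" using cycle_node_out[OF K less(2) False] .
    have uy: "u \<notin> desc N y" using less False by blast
    have uc: "u \<in> cycle_nodes K" using less by (simp add: cycle_nodes_def)
    have av: "desc N x \<inter> cycle_nodes K = {}" by (rule pendant_avoids[OF xb(3,4) uc K])
    have yc: "y \<in> cycle_nodes K" using y by (force simp: cycle_nodes_def)
    have "x \<noteq> y" using av yc desc_refl by blast
    then have "x \<notin> desc N y" using desc_par1[OF _ _ xb(6)] uy by blast
    then have d: "desc N x \<inter> desc N y = {}" using free_disjoint xb(3) av yc by blast
    have bs: "b \<in> snd ` K" using xb(5) by force
    have "b = r \<or> b \<notin> desc N y"
    proof (rule ccontr)
      assume n: "\<not> (b = r \<or> b \<notin> desc N y)"
      then have "card (par N b) = 1" using gallD(12)[OF K(2) bs] by blast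
      then have pb: "par N b = {u}" using xb(5) gallD(1)[OF K(2)]
        by (metis card_1_singletonE mem_Collect_eq par_def singletonD subsetD)
      have "b \<noteq> y"
      proof
        assume "b = y"
        then have "w \<in> par N b" using y gallD(1)[OF K(2)] by (auto simp: par_def)
        then have "w = u" using pb by simp
        then show False using less(2) gallD(2)[OF K(2)] by blast
      qed
      then show False using desc_par1[OF _ _ pb] n uy by blast
    qed
    moreover have "(u, b) \<in> arcs N" using xb(5) gallD(1)[OF K(2)] by blast
    ultimately have "desc N b \<inter> desc N y \<subseteq> desc N r" using less(1)[OF _ bs] by blast
    then show ?thesis using desc_out[of u] xb(1) d uy by auto
  qed simp
qed

theorem reps_exists:
  "v \<in> nodes N \<Longrightarrow> free N v \<Longrightarrow> \<exists>t. reps N v t (desc N v)"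
  using wf_trancl[OF wf1]
proof (induction v rule: wf_induct_rule)
  case (less v)
  have IH: "\<exists>t. reps N x t (desc N x)" if "free N x" "(v, x) \<in> (arcs N)\<^sup>+" for x
  proof -
    have "x \<in> nodes N" using that(2) A by (meson SigmaD2 subsetD tranclD2)
    then show ?thesis using less(1)[of x] that by (simp add: trancl_converse)
  qed
  have c1: "card (par N v) \<le> 1" using free_card_par less by blast
  have "card (out N v) = 0 \<or> card (out N v) = 2" using types[OF less(2)] c1 by auto
  then consider (l) "out N v = {}" | (n) x y where "out N v = {x, y}" "x \<noteq> y"
    using finp by (metis card_0_eq card_2_iff)
  then show ?case
  proof cases
    case l
    then have "desc N v = {v}" using desc_out[of v] by simp
    then show ?thesis using reps_Leaf[OF l refl] by auto
  next
    case n
    have vx: "(v, x) \<in> arcs N" "(v, y) \<in> arcs N" using n by (auto simp: out_def)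
    show ?thesis
    proof (cases "\<exists>K r. tree_cycle N K \<and> gall N K v r")
      case False
      have fr: "free N z" if z: "(v, z) \<in> arcs N" for z
      proof (rule ccontr)
        assume "\<not> free N z"
        then obtain K where K: "tree_cycle N K" "(v, z) \<in> K" using not_free_arc z by blast
        obtain w r where g: "gall N K w r" using tc_gall K by blast
        have "v \<in> fst ` K" using K(2) by force
        moreover have "v \<noteq> w" using g K(1) False by blast
        ultimately have "v \<in> snd ` K" using gallD(10)[OF g] by blast
        then show False using less(3) K by (auto simp: free_def)
      qed
      have f: "free N x" "free N y" using fr vx by auto
      have p: "par N x = {v}" "par N y = {v}" using free_par f vx by auto
      obtain t where t: "reps N x t (desc N x)" using IH f vx by blast
      obtain t' where t': "reps N y t' (desc N y)" using IH f vx by blast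
      have nv: "v \<notin> desc N x" "v \<notin> desc N y" using desc_acyc vx by auto
      have "x \<notin> desc N y" "y \<notin> desc N x" using nv desc_par1 p n(2) by metis+
      then have "desc N x \<inter> desc N y = {}" using free_disjoint f by blast
      then have "reps N v (Node t t') (desc N v)"
        using reps_Node[OF n p t t' nv] desc_out[of v] n(1) by simp
      then show ?thesis by blast
    next
      case True
      then obtain K r where K: "tree_cycle N K" "gall N K v r" by blast
      have xK: "(v, x) \<in> K" "(v, y) \<in> K" using gallD(9)[OF K(2)] vx by auto
      have xs: "x \<in> snd ` K" "y \<in> snd ` K" using xK by force+
      obtain c p where c: "chn N v x c r p (desc N x - desc N r)" "(p, r) \<in> arcs N"
        using chain_exists[OF K IH xK(1)] by blast
      obtain d q where d: "chn N v y d r q (desc N y - desc N r)" "(q, r) \<in> arcs N"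
        using chain_exists[OF K IH xK(2)] by blast
      have nv: "v \<notin> desc N x" "v \<notin> desc N y" using desc_acyc vx by auto
      have "x = r \<or> x \<notin> desc N y"
      proof (rule ccontr)
        assume n': "\<not> (x = r \<or> x \<notin> desc N y)"
        then have "card (par N x) = 1" using gallD(12)[OF K(2) xs(1)] by blast
        then have "par N x = {v}" using vx by (metis card_1_singletonE mem_Collect_eq par_def singletonD)
        then show False using desc_par1[OF _ n(2)] n' nv by blast
      qed
      then have VW: "desc N x \<inter> desc N y \<subseteq> desc N r" using sides_meet_below_retic[OF K xK(2) xs(1)] by blast
      have rn: "r \<in> nodes N" using c(2) A by auto
      have cr: "card (par N r) = 2" using gallD(6)[OF K(2)] .
      then have "card (out N r) = 1" using types[OF rn] by auto
      then obtain s where s: "out N r = {s}" by (meson card_1_singletonE)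
      have rs: "(r, s) \<in> arcs N" using s by (auto simp: out_def)
      have rc: "r \<in> cycle_nodes K" using gallD(3)[OF K(2)] by (simp add: cycle_nodes_def)
      have fs: "free N s"
      proof (rule ccontr)
        assume "\<not> free N s"
        then obtain K' where K': "tree_cycle N K'" "(r, s) \<in> K'" using not_free_arc rs by blast
        have "r \<in> cycle_nodes K'" using K'(2) by (force simp: cycle_nodes_def)
        then have "K' = K" using tc_eq K' K rc by blast
        then show False using gallD(4)[OF K(2)] K' by force
      qed
      have ps: "par N s = {r}" using free_par[OF rs fs] .
      have rx: "r \<in> desc N x" "r \<in> desc N y" using gall_desc_retic[OF K(2)] xs by auto
      have "(v, r) \<in> (arcs N)\<^sup>+" using rx(1) vx(1) by (auto simp: desc_def)
      then have "(v, s) \<in> (arcs N)\<^sup>+" using rs by (meson trancl_into_trancl)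
      then obtain t where t: "reps N s t (desc N s)" using IH fs by blast
      have dr: "desc N r = insert r (desc N s)" using desc_out[of r] s by simp
      have rns: "r \<notin> desc N s" using desc_acyc rs by blast
      have rsub: "desc N r \<subseteq> desc N x" "desc N r \<subseteq> desc N y" using rx desc_trans by blast+
      have vr: "v \<noteq> r" using nv rx by auto
      have pq: "p \<noteq> q"
      proof
        assume "p = q"
        have p: "p \<in> insert v (desc N x - desc N r)" "q \<in> insert v (desc N y - desc N r)"
          using reps_basic(2)[OF c(1)] reps_basic(2)[OF d(1)] by auto
        then have "p = v" using VW \<open>p = q\<close> by auto
        then have "x = r" "y = r" using chn_last(2)[OF c(1)] chn_last(2)[OF d(1)] \<open>p = q\<close> nv by auto
        then show False using n by simp
      qed
      have pr: "par N r = {p, q}" using cr c(2) d(2) pq by (intro card_2_insert) (auto simp: par_def)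
      have "reps N v (Gall c d t) (desc N v)"
      proof (rule reps_Gall[OF n c(1) d(1) pr pq s ps t])
        show "v \<notin> desc N s" using nv rsub dr by blast
        show "desc N v = insert v (insert r (desc N x - desc N r \<union> (desc N y - desc N r) \<union> desc N s))"
          using desc_out[of v] n(1) dr rsub by auto
      qed (use nv vr rns dr VW in auto)
      then show ?thesis by blast
    qed
  qed
qed

lemma root_reps:
  "\<exists>t. reps N (the_root N) t (nodes N)" "par N (the_root N) = {}" "the_root N \<in> nodes N"
proof -
  have ex: "\<exists>!r. r \<in> nodes N \<and> indeg N r = 0" using ph by (simp add: phylo_network_def)
  have r: "the_root N \<in> nodes N" "indeg N (the_root N) = 0"
    unfolding the_root_def using theI'[OF ex] by auto
  show rn: "the_root N \<in> nodes N" by fact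
  show pe: "par N (the_root N) = {}" using r finp by (simp add: indeg_par)
  have "free N (the_root N)" unfolding free_def
  proof (intro allI impI notI)
    fix K assume K: "tree_cycle N K" "the_root N \<in> snd ` K"
    then obtain a where "(a, the_root N) \<in> K" by auto
    moreover obtain w r where "gall N K w r" using tc_gall K by blast
    ultimately have "a \<in> par N (the_root N)" using gallD(1)[of N K w r] by (auto simp: par_def)
    then show False using pe by simp
  qed
  then obtain t where t: "reps N (the_root N) t (desc N (the_root N))" using reps_exists rn by blast
  have "z \<in> desc N (the_root N)" if "z \<in> nodes N" for z
    using wf2 that
  proof (induction z rule: wf_induct_rule)
    case (less z)
    show ?case
    proof (cases "par N z = {}")
      case True
      then have "indeg N z = 0" by (simp add: indeg_par)
      then have "z = the_root N" using ex r less(2) by auto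
      then show ?thesis by (simp add: desc_refl)
    next
      case False
      then obtain a where a: "(a, z) \<in> arcs N" by (auto simp: par_def)
      then show ?thesis using less(1)[OF a] A desc_step by blast
    qed
  qed
  moreover have "desc N (the_root N) \<subseteq> nodes N"
    using rn A by (auto simp: desc_def elim: rtranclE)
  ultimately have "desc N (the_root N) = nodes N" by blast
  then show "\<exists>t. reps N (the_root N) t (nodes N)" using t by auto
qed

end

section \<open>Isomorphism\<close>

primrec wft :: "'a gt \<Rightarrow> bool" and wfc :: "'a ch \<Rightarrow> bool" where
  "wft (Leaf l) = True"
| "wft (Node a b) = (wft a \<and> wft b)"
| "wft (Gall c d t) = (\<not> (c = End \<and> d = End) \<and> wfc c \<and> wfc d \<and> wft t)"
| "wfc End = True"
| "wfc (Chn a c) = (wft a \<and> wfc c)"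

lemma chn_End_iff: "chn N w u c r p V \<Longrightarrow> u = r \<longleftrightarrow> c = End"
  by (erule chn.cases) auto

lemma reps_wf:
  shows "reps N v t V \<Longrightarrow> wft t" and "chn N w u c r p V \<Longrightarrow> wfc c"
proof (induction rule: reps_chn.inducts)
  case (reps_Gall v x y c r p V d q W s t U X)
  then show ?case using chn_End_iff[OF \<open>chn N v x c r p V\<close>] chn_End_iff[OF \<open>chn N v y d r q W\<close>] by auto
qed auto

lemma ball_sub: "\<forall>x\<in>X. P x \<Longrightarrow> A \<subseteq> X \<Longrightarrow> \<forall>x\<in>A. P x"
  by blast

lemma reps_transport:
  shows "reps N v t V \<Longrightarrow> inj_on f V \<Longrightarrow>
      \<forall>z\<in>V. out M (f z) = f ` out N z \<and> (out N z = {} \<longrightarrow> lab M (f z) = lab N z) \<Longrightarrow>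
      \<forall>z\<in>V - {v}. par M (f z) = f ` par N z \<Longrightarrow> reps M (f v) t (f ` V)"
    and "chn N w u c r p V \<Longrightarrow> inj_on f (insert r V) \<Longrightarrow>
      \<forall>z\<in>V. out M (f z) = f ` out N z \<and> (out N z = {} \<longrightarrow> lab M (f z) = lab N z) \<Longrightarrow>
      \<forall>z\<in>V. par M (f z) = f ` par N z \<Longrightarrow> chn M (f w) (f u) c (f r) (f p) (f ` V)"
proof (induction rule: reps_chn.inducts)
  case (reps_Leaf v l)
  then show ?case by (auto intro: reps_chn.reps_Leaf)
next
  case (reps_Node v x y a V b W X)
  note X = \<open>X = _\<close> and inj = \<open>inj_on f X\<close>
  have xy: "x \<in> V" "y \<in> W"
    using reps_basic(1)[OF \<open>reps N x a V\<close>] reps_basic(1)[OF \<open>reps N y b W\<close>] by auto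
  have sub: "V \<subseteq> X" "W \<subseteq> X" using X by auto
  have pr: "\<forall>z\<in>V. par M (f z) = f ` par N z" "\<forall>z\<in>W. par M (f z) = f ` par N z"
    by (rule ball_sub[OF reps_Node.prems(3)]; use sub \<open>v \<notin> V\<close> \<open>v \<notin> W\<close> in blast)+
  have "reps M (f x) a (f ` V)"
    by (rule reps_Node.IH(5)[OF inj_on_subset[OF inj sub(1)] ball_sub[OF reps_Node.prems(2) sub(1)] ball_sub[OF pr(1)]]) blast
  moreover have "reps M (f y) b (f ` W)"
    by (rule reps_Node.IH(7)[OF inj_on_subset[OF inj sub(2)] ball_sub[OF reps_Node.prems(2) sub(2)] ball_sub[OF pr(2)]]) blast
  ultimately have 1: "reps M (f x) a (f ` V)" "reps M (f y) b (f ` W)" by auto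
  show ?case
  proof (rule reps_chn.reps_Node[OF _ _ _ _ 1])
    show "out M (f v) = {f x, f y}" using reps_Node.prems X \<open>out N v = _\<close> by auto
    show "f x \<noteq> f y" using inj X xy \<open>x \<noteq> y\<close> by (auto dest: inj_onD)
    show "par M (f x) = {f v}" "par M (f y) = {f v}"
      using reps_Node.prems X xy \<open>par N x = _\<close> \<open>par N y = _\<close> \<open>v \<notin> V\<close> \<open>v \<notin> W\<close> by auto
    show "f v \<notin> f ` V" "f v \<notin> f ` W" using inj X \<open>v \<notin> V\<close> \<open>v \<notin> W\<close> by (auto dest: inj_onD)
    show "f ` V \<inter> f ` W = {}" using inj X \<open>V \<inter> W = {}\<close> by (auto dest: inj_onD)
    show "f ` X = insert (f v) (f ` V \<union> f ` W)" using X by auto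
  qed
next
  case (reps_Gall v x y c r p V d q W s t U X)
  note X = \<open>X = _\<close> and inj = \<open>inj_on f X\<close>
  have xy: "x \<in> insert r V" "y \<in> insert r W" "s \<in> U" "r \<notin> V" "r \<notin> W" "p \<in> insert v V" "q \<in> insert v W"
    using reps_basic(2)[OF \<open>chn N v x c r p V\<close>] reps_basic(2)[OF \<open>chn N v y d r q W\<close>]
     reps_basic(1)[OF \<open>reps N s t U\<close>] by auto
  have sub: "insert r V \<subseteq> X" "insert r W \<subseteq> X" "U \<subseteq> X" using X by auto
  have pr: "\<forall>z\<in>V. par M (f z) = f ` par N z" "\<forall>z\<in>W. par M (f z) = f ` par N z" "\<forall>z\<in>insert r U. par M (f z) = f ` par N z"
    by (rule ball_sub[OF reps_Gall.prems(3)]; use sub \<open>v \<notin> V\<close> \<open>v \<notin> W\<close> \<open>v \<notin> U\<close> \<open>v \<noteq> r\<close> in blast)+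
  have 1: "chn M (f v) (f x) c (f r) (f p) (f ` V)" 
    by (rule reps_Gall.IH(3)[OF inj_on_subset[OF inj sub(1)] ball_sub[OF reps_Gall.prems(2)] pr(1)]) (use sub in blast)
  have 2: "chn M (f v) (f y) d (f r) (f q) (f ` W)" 
    by (rule reps_Gall.IH(5)[OF inj_on_subset[OF inj sub(2)] ball_sub[OF reps_Gall.prems(2)] pr(2)]) (use sub in blast)
  have 3: "reps M (f s) t (f ` U)" 
    by (rule reps_Gall.IH(10)[OF inj_on_subset[OF inj sub(3)] ball_sub[OF reps_Gall.prems(2) sub(3)] ball_sub[OF pr(3)]]) blast
  have ne: "f a \<noteq> f b" if "a \<in> X" "b \<in> X" "a \<noteq> b" for a b using that inj by (auto dest: inj_onD)
  have dj: "f ` A \<inter> f ` B = {}" if "A \<inter> B = {}" "A \<subseteq> X" "B \<subseteq> X" for A B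
    using that inj by (metis image_empty inj_on_image_Int)
  have ni: "f a \<notin> f ` A" if "a \<notin> A" "A \<subseteq> X" "a \<in> X" for a A using that inj by (meson inj_on_image_mem_iff)
  show ?case
  proof (rule reps_chn.reps_Gall[OF _ _ 1 2 _ _ _ _ 3])
    show "out M (f v) = {f x, f y}" "out M (f r) = {f s}"
      using reps_Gall.prems X \<open>out N v = _\<close> \<open>out N r = _\<close> by auto
    show "f x \<noteq> f y" using ne xy(1,2) X \<open>x \<noteq> y\<close> by blast
    show "par M (f r) = {f p, f q}" "par M (f s) = {f r}" using pr(3) xy(3) \<open>par N r = _\<close> \<open>par N s = _\<close> by auto
    show "f p \<noteq> f q" using ne xy(6,7) X \<open>p \<noteq> q\<close> by blast
    show "f v \<notin> f ` V" "f v \<notin> f ` W" "f v \<notin> f ` U" "f r \<notin> f ` U"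
      using ni X \<open>v \<notin> V\<close> \<open>v \<notin> W\<close> \<open>v \<notin> U\<close> \<open>r \<notin> U\<close> by auto
    show "f v \<noteq> f r" using ne X \<open>v \<noteq> r\<close> by blast
    show "f ` V \<inter> f ` W = {}" "f ` V \<inter> f ` U = {}" "f ` W \<inter> f ` U = {}"
      using dj X \<open>V \<inter> W = {}\<close> \<open>V \<inter> U = {}\<close> \<open>W \<inter> U = {}\<close> by auto
    show "f ` X = insert (f v) (insert (f r) (f ` V \<union> f ` W \<union> f ` U))" using X by auto
  qed
next
  case (chn_End w r)
  then show ?case by (simp add: reps_chn.chn_End)
next
  case (chn_Chn u x y w a V c r p W X)
  note X = \<open>X = _\<close> and inj = \<open>inj_on f (insert r X)\<close>
  have xy: "x \<in> V" "y \<in> insert r W" "r \<notin> W"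
    using reps_basic(1)[OF \<open>reps N x a V\<close>] reps_basic(2)[OF \<open>chn N u y c r p W\<close>] by auto
  have sub: "insert r W \<subseteq> insert r X" "V \<subseteq> insert r X" using X by auto
  have 1: "reps M (f x) a (f ` V)"
    by (rule chn_Chn.IH(5)[OF inj_on_subset[OF inj sub(2)] ball_sub[OF chn_Chn.prems(2)] ball_sub[OF chn_Chn.prems(3)]]) (use X in blast)+
  have 2: "chn M (f u) (f y) c (f r) (f p) (f ` W)"
    by (rule chn_Chn.IH(7)[OF inj_on_subset[OF inj sub(1)] ball_sub[OF chn_Chn.prems(2)] ball_sub[OF chn_Chn.prems(3)]]) (use X in blast)+
  have ne: "f a \<noteq> f b" if "a \<in> insert r X" "b \<in> insert r X" "a \<noteq> b" for a b using that inj_onD[OF inj] by blast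
  have ni: "f a \<notin> f ` A" if "a \<notin> A" "A \<subseteq> insert r X" "a \<in> insert r X" for a A using that inj by (meson inj_on_image_mem_iff)
  show ?case
  proof (rule reps_chn.chn_Chn[OF _ _ _ _ 1 2])
    show "out M (f u) = {f x, f y}" using chn_Chn.prems X \<open>out N u = _\<close> by auto
    show "f x \<noteq> f y" using ne xy(1,2) X \<open>x \<noteq> y\<close> by blast
    show "par M (f u) = {f w}" "par M (f x) = {f u}" using chn_Chn.prems X xy \<open>par N u = _\<close> \<open>par N x = _\<close> by auto
    show "f u \<noteq> f r" using ne X \<open>u \<noteq> r\<close> by blast
    show "f u \<notin> f ` V" "f u \<notin> f ` W" "f r \<notin> f ` V" using ni X \<open>u \<notin> V\<close> \<open>u \<notin> W\<close> \<open>r \<notin> V\<close> by auto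
    show "f ` V \<inter> f ` W = {}" using ne X \<open>V \<inter> W = {}\<close> by blast
    show "f ` X = insert (f u) (f ` V \<union> f ` W)" using X by auto
  qed
qed

definition hom_on :: "net \<Rightarrow> net \<Rightarrow> (nat \<Rightarrow> nat) \<Rightarrow> nat set \<Rightarrow> bool" where
  "hom_on N M f S \<longleftrightarrow> (\<forall>z\<in>S. out M (f z) = f ` out N z \<and> (out N z = {} \<longrightarrow> lab M (f z) = lab N z))"

lemma hom_on_cong:
  assumes "hom_on N M f S" "\<And>z. z \<in> S \<Longrightarrow> f z = h z" "\<And>z y. z \<in> S \<Longrightarrow> y \<in> out N z \<Longrightarrow> f y = h y"
  shows "hom_on N M h S"
  unfolding hom_on_def
proof
  fix z assume z: "z \<in> S"
  have "f ` out N z = h ` out N z" using assms(3)[OF z] by (meson image_cong)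
  then show "out M (h z) = h ` out N z \<and> (out N z = {} \<longrightarrow> lab M (h z) = lab N z)"
    using assms(1,2) z unfolding hom_on_def by metis
qed

lemma reps_glue:
  shows "reps N v t V \<Longrightarrow> \<forall>v' V'. reps M v' t V' \<longrightarrow> (\<exists>f. bij_betw f V V' \<and> f v = v' \<and> hom_on N M f V)"
    and "chn N w u c r p V \<Longrightarrow> \<forall>w' u' r' p' V'. chn M w' u' c r' p' V' \<longrightarrow>
       (\<exists>f. bij_betw f V V' \<and> f u = u' \<and> f r = r' \<and> hom_on N M f V)"
proof (induction rule: reps_chn.inducts)
  case (reps_Leaf v l)
  show ?case
  proof (intro allI impI)
    fix v' V' assume "reps M v' (Leaf l) V'"
    then show "\<exists>f. bij_betw f {v} V' \<and> f v = v' \<and> hom_on N M f {v}"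
      by (cases rule: reps.cases) (use reps_Leaf in \<open>auto simp: hom_on_def bij_betw_def intro!: exI[of _ "\<lambda>_. v'"]\<close>)
  qed
next
  case (reps_Node v x y a V b W X)
  show ?case
  proof (intro allI impI)
    fix v' X' assume "reps M v' (Node a b) X'"
    then show "\<exists>f. bij_betw f X X' \<and> f v = v' \<and> hom_on N M f X"
    proof (cases rule: reps.cases)
      case (reps_Node x' y' V' W')
      obtain f where f: "bij_betw f V V'" "f x = x'" "hom_on N M f V" using \<open>reps M x' a V'\<close> \<open>\<forall>v' V'. reps M v' a V' \<longrightarrow> _\<close> by blast
      obtain g where g: "bij_betw g W W'" "g y = y'" "hom_on N M g W" using \<open>reps M y' b W'\<close> \<open>\<forall>v' V'. reps M v' b V' \<longrightarrow> _\<close> by blast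
      define h where "h z = (if z = v then v' else if z \<in> V then f z else g z)" for z
      have xy: "x \<in> V" "y \<in> W" using reps_basic(1)[OF \<open>reps N x a V\<close>] reps_basic(1)[OF \<open>reps N y b W\<close>] by auto
      have hV: "h z = f z" if "z \<in> V" for z using that \<open>v \<notin> V\<close> by (auto simp: h_def)
      have hW: "h z = g z" if "z \<in> W" for z using that \<open>v \<notin> W\<close> \<open>V \<inter> W = {}\<close> by (auto simp: h_def)
      have "bij_betw h V V'" "bij_betw h W W'" using f(1) g(1) hV hW by (metis bij_betw_cong)+
      then have "bij_betw h (V \<union> W) (V' \<union> W')" using \<open>V' \<inter> W' = {}\<close> by (rule bij_betw_combine)
      moreover have "bij_betw h {v} {v'}" by (simp add: h_def bij_betw_def)
      ultimately have "bij_betw h ({v} \<union> (V \<union> W)) ({v'} \<union> (V' \<union> W'))"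
        using \<open>v' \<notin> V'\<close> \<open>v' \<notin> W'\<close> by - (rule bij_betw_combine, assumption, assumption, auto)
      then have 1: "bij_betw h X X'" using \<open>X = _\<close> \<open>X' = _\<close> by simp
      have hv: "h v = v'" by (simp add: h_def)
      have "hom_on N M h V" by (rule hom_on_cong[OF f(3)]) (use hV reps_out(1)[OF \<open>reps N x a V\<close>] in \<open>auto simp: subset_iff\<close>)
      moreover have "hom_on N M h W" by (rule hom_on_cong[OF g(3)]) (use hW reps_out(1)[OF \<open>reps N y b W\<close>] in \<open>auto simp: subset_iff\<close>)
      moreover have "hom_on N M h {v}" using \<open>out N v = _\<close> \<open>out M v' = _\<close> f(2) g(2) hV[OF xy(1)] hW[OF xy(2)] hv by (simp add: hom_on_def)
      ultimately have "hom_on N M h X" using \<open>X = _\<close> by (auto simp: hom_on_def)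
      moreover have "h v = v'" by (simp add: h_def)
      ultimately show ?thesis using 1 by blast
    qed
  qed
next
  case (reps_Gall v x y c r p V d q W s t U X)
  show ?case
  proof (intro allI impI)
    fix v' X' assume "reps M v' (Gall c d t) X'"
    then show "\<exists>f. bij_betw f X X' \<and> f v = v' \<and> hom_on N M f X"
    proof (cases rule: reps.cases)
      case (reps_Gall x' y' r' p' V' q' W' s' U')
      obtain f where f: "bij_betw f V V'" "f x = x'" "f r = r'" "hom_on N M f V" using \<open>chn M v' x' c r' p' V'\<close> \<open>\<forall>w' u' r' p' V'. chn M w' u' c r' p' V' \<longrightarrow> _\<close> by blast
      obtain g where g: "bij_betw g W W'" "g y = y'" "g r = r'" "hom_on N M g W" using \<open>chn M v' y' d r' q' W'\<close> \<open>\<forall>w' u' r' p' V'. chn M w' u' d r' p' V' \<longrightarrow> _\<close> by blast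
      obtain k where k: "bij_betw k U U'" "k s = s'" "hom_on N M k U" using \<open>reps M s' t U'\<close> \<open>\<forall>v' V'. reps M v' t V' \<longrightarrow> _\<close> by blast
      have xy: "x \<in> insert r V" "y \<in> insert r W" "s \<in> U" "r \<notin> V" "r \<notin> W"
        using reps_basic(2)[OF \<open>chn N v x c r p V\<close>] reps_basic(2)[OF \<open>chn N v y d r q W\<close>]
         reps_basic(1)[OF \<open>reps N s t U\<close>] by auto
      have xy': "r' \<notin> V'" "r' \<notin> W'"
        using reps_basic(2)[OF \<open>chn M v' x' c r' p' V'\<close>] reps_basic(2)[OF \<open>chn M v' y' d r' q' W'\<close>] by auto
      define h where "h z = (if z = v then v' else if z = r then r' else if z \<in> V then f z else if z \<in> W then g z else k z)" for z
      have hV: "h z = f z" if "z \<in> insert r V" for z using that \<open>v \<notin> V\<close> \<open>v \<noteq> r\<close> f(3) by (auto simp: h_def)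
      have hW: "h z = g z" if "z \<in> insert r W" for z using that \<open>v \<notin> W\<close> \<open>V \<inter> W = {}\<close> \<open>v \<noteq> r\<close> g(3) by (auto simp: h_def)
      have hU: "h z = k z" if "z \<in> U" for z using that \<open>v \<notin> U\<close> \<open>r \<notin> U\<close> \<open>V \<inter> U = {}\<close> \<open>W \<inter> U = {}\<close> by (auto simp: h_def)
      have hv: "h v = v'" "h r = r'" using \<open>v \<noteq> r\<close> by (auto simp: h_def)
      have "bij_betw h V V'" "bij_betw h W W'" "bij_betw h U U'" using f(1) g(1) k(1) hV hW hU by (metis bij_betw_cong insertCI)+
      then have "bij_betw h (V \<union> W \<union> U) (V' \<union> W' \<union> U')"
        using \<open>V' \<inter> W' = {}\<close> \<open>V' \<inter> U' = {}\<close> \<open>W' \<inter> U' = {}\<close> by (intro bij_betw_combine) auto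
      moreover have "bij_betw h {v, r} {v', r'}" using \<open>v \<noteq> r\<close> \<open>v' \<noteq> r'\<close> hv by (auto simp: bij_betw_def inj_on_def)
      ultimately have "bij_betw h ({v, r} \<union> (V \<union> W \<union> U)) ({v', r'} \<union> (V' \<union> W' \<union> U'))"
        using \<open>v' \<notin> V'\<close> \<open>v' \<notin> W'\<close> \<open>v' \<notin> U'\<close> xy' \<open>r' \<notin> U'\<close> by - (rule bij_betw_combine, assumption, assumption, auto)
      then have 1: "bij_betw h X X'" using \<open>X = _\<close> \<open>X' = _\<close> by (simp add: Un_assoc)
      have "hom_on N M h V" by (rule hom_on_cong[OF f(4)]) (use hV reps_out(2)[OF \<open>chn N v x c r p V\<close>] in \<open>auto simp: subset_iff\<close>)
      moreover have "hom_on N M h W" by (rule hom_on_cong[OF g(4)]) (use hW reps_out(2)[OF \<open>chn N v y d r q W\<close>] in \<open>auto simp: subset_iff\<close>)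
      moreover have "hom_on N M h U" by (rule hom_on_cong[OF k(3)]) (use hU reps_out(1)[OF \<open>reps N s t U\<close>] in \<open>auto simp: subset_iff\<close>)
      moreover have "hom_on N M h {v}" using \<open>out N v = _\<close> \<open>out M v' = _\<close> f(2) g(2) hV[OF xy(1)] hW[OF xy(2)] hv by (simp add: hom_on_def)
      moreover have "hom_on N M h {r}" using \<open>out N r = _\<close> \<open>out M r' = _\<close> k(2) hU[OF xy(3)] hv by (simp add: hom_on_def)
      ultimately have "hom_on N M h X" using \<open>X = _\<close> by (auto simp: hom_on_def)
      then show ?thesis using 1 hv by blast
    qed
  qed
next
  case (chn_End w r)
  show ?case
  proof (intro allI impI)
    fix w' u' r' p' V' assume "chn M w' u' End r' p' V'"
    then show "\<exists>f. bij_betw f {} V' \<and> f r = u' \<and> f r = r' \<and> hom_on N M f {}"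
      by (cases rule: chn.cases) (auto simp: hom_on_def bij_betw_def intro!: exI[of _ "\<lambda>_. r'"])
  qed
next
  case (chn_Chn u x y w a V c r p W X)
  show ?case
  proof (intro allI impI)
    fix w' u' r' p' X' assume "chn M w' u' (Chn a c) r' p' X'"
    then show "\<exists>f. bij_betw f X X' \<and> f u = u' \<and> f r = r' \<and> hom_on N M f X"
    proof (cases rule: chn.cases)
      case (chn_Chn x' y' V' W')
      obtain f where f: "bij_betw f V V'" "f x = x'" "hom_on N M f V" using \<open>reps M x' a V'\<close> \<open>\<forall>v' V'. reps M v' a V' \<longrightarrow> _\<close> by blast
      obtain g where g: "bij_betw g W W'" "g y = y'" "g r = r'" "hom_on N M g W" using \<open>chn M u' y' c r' p' W'\<close> \<open>\<forall>w' u' r' p' V'. chn M w' u' c r' p' V' \<longrightarrow> _\<close> by blast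
      have xy: "x \<in> V" "y \<in> insert r W" "r \<notin> W"
        using reps_basic(1)[OF \<open>reps N x a V\<close>] reps_basic(2)[OF \<open>chn N u y c r p W\<close>] by auto
      define h where "h z = (if z = u then u' else if z \<in> V then f z else g z)" for z
      have hV: "h z = f z" if "z \<in> V" for z using that \<open>u \<notin> V\<close> by (auto simp: h_def)
      have hW: "h z = g z" if "z \<in> insert r W" for z using that \<open>u \<notin> W\<close> \<open>V \<inter> W = {}\<close> \<open>u \<noteq> r\<close> \<open>r \<notin> V\<close> by (auto simp: h_def)
      have "bij_betw h V V'" "bij_betw h W W'" using f(1) g(1) hV hW by (metis bij_betw_cong insertCI)+
      then have "bij_betw h (V \<union> W) (V' \<union> W')" using \<open>V' \<inter> W' = {}\<close> by (rule bij_betw_combine)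
      moreover have "bij_betw h {u} {u'}" by (simp add: h_def bij_betw_def)
      ultimately have "bij_betw h ({u} \<union> (V \<union> W)) ({u'} \<union> (V' \<union> W'))"
        using \<open>u' \<notin> V'\<close> \<open>u' \<notin> W'\<close> by - (rule bij_betw_combine, assumption, assumption, auto)
      then have 1: "bij_betw h X X'" using \<open>X = _\<close> \<open>X' = _\<close> by simp
      have "hom_on N M h V" by (rule hom_on_cong[OF f(3)]) (use hV reps_out(1)[OF \<open>reps N x a V\<close>] in \<open>auto simp: subset_iff\<close>)
      moreover have "hom_on N M h W" by (rule hom_on_cong[OF g(4)]) (use hW reps_out(2)[OF \<open>chn N u y c r p W\<close>] in \<open>auto simp: subset_iff\<close>)
      moreover have hu: "h u = u'" by (simp add: h_def)
      moreover have "hom_on N M h {u}" using \<open>out N u = _\<close> \<open>out M u' = _\<close> f(2) g(2) hV[OF xy(1)] hW[OF xy(2)] hu by (simp add: hom_on_def)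
      ultimately have "hom_on N M h X" using \<open>X = _\<close> by (auto simp: hom_on_def)
      moreover have "h u = u'" "h r = r'" using hW[of r] g(3) by (auto simp: h_def)
      ultimately show ?thesis using 1 by blast
    qed
  qed
qed

lemma net_iso_of_reps:
  assumes "reps N v t (nodes N)" "reps M v' t (nodes M)"
  shows "net_iso N M"
proof -
  obtain f where f: "bij_betw f (nodes N) (nodes M)" "hom_on N M f (nodes N)"
    using reps_glue(1)[OF assms(1)] assms(2) by blast
  have inj: "inj_on f (nodes N)" using f(1) by (simp add: bij_betw_def)
  have "(x, y) \<in> arcs N \<longleftrightarrow> (f x, f y) \<in> arcs M" if "x \<in> nodes N" "y \<in> nodes N" for x y
  proof -
    have "out M (f x) = f ` out N x" using f(2) that by (simp add: hom_on_def)
    then have "(f x, f y) \<in> arcs M \<longleftrightarrow> f y \<in> f ` out N x" by (auto simp: out_def)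
    also have "\<dots> \<longleftrightarrow> y \<in> out N x" using reps_out(1)[OF assms(1) that(1)] inj that(2) by (meson inj_on_image_mem_iff)
    finally show ?thesis by (simp add: out_def)
  qed
  moreover have "lab M (f x) = lab N x" if "x \<in> leaves N" for x
  proof -
    have x: "x \<in> nodes N" "card (out N x) = 0" using that by (auto simp: leaves_def is_leaf_def outdeg_out)
    have "finite (out N x)" using reps_out(1)[OF assms(1) x(1)] reps_basic(1)[OF assms(1)] by (meson finite_subset)
    then show ?thesis using f(2) x by (simp add: hom_on_def)
  qed
  ultimately show ?thesis using f(1) by (auto simp: net_iso_def)
qed

lemma reps_net_iso:
  assumes "reps N v t (nodes N)" "net_iso N M" "arcs N \<subseteq> nodes N \<times> nodes N" "arcs M \<subseteq> nodes M \<times> nodes M"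
    "\<forall>z\<in>nodes N. out N z = {} \<longrightarrow> is_leaf N z" "par N v = {}"
  shows "\<exists>v'. reps M v' t (nodes M) \<and> par M v' = {}"
proof -
  obtain f where f: "bij_betw f (nodes N) (nodes M)"
     "\<forall>x \<in> nodes N. \<forall>y \<in> nodes N. (x, y) \<in> arcs N \<longleftrightarrow> (f x, f y) \<in> arcs M"
     "\<forall>x \<in> leaves N. lab M (f x) = lab N x" using assms(2) by (auto simp: net_iso_def)
  have im: "f ` nodes N = nodes M" and inj: "inj_on f (nodes N)" using f(1) by (auto simp: bij_betw_def)
  have eq: "(f x, f y) \<in> arcs M \<longleftrightarrow> (x, y) \<in> arcs N" if "x \<in> nodes N" "y \<in> nodes N" for x y
    using f(2) that by simp
  have nN: "x \<in> nodes N \<and> y \<in> nodes N" if "(x, y) \<in> arcs N" for x y using that assms(3) by blast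
  have nM: "\<exists>x'\<in>nodes N. \<exists>y'\<in>nodes N. x = f x' \<and> y = f y'" if "(x, y) \<in> arcs M" for x y
    using that assms(4) im by blast
  have o: "out M (f z) = f ` out N z" if z: "z \<in> nodes N" for z
  proof (intro equalityI subsetI)
    fix y assume "y \<in> out M (f z)"
    then have y: "(f z, y) \<in> arcs M" by (simp add: out_def)
    then obtain y' where y': "y' \<in> nodes N" "y = f y'" using nM by blast
    then have "(z, y') \<in> arcs N" using eq[OF z] y by simp
    then show "y \<in> f ` out N z" using y' by (auto simp: out_def)
  next
    fix y assume "y \<in> f ` out N z"
    then obtain y' where y': "(z, y') \<in> arcs N" "y = f y'" by (auto simp: out_def)
    then show "y \<in> out M (f z)" using eq[OF z] nN by (simp add: out_def)
  qed
  have p: "par M (f z) = f ` par N z" if z: "z \<in> nodes N" for z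
  proof (intro equalityI subsetI)
    fix y assume "y \<in> par M (f z)"
    then have y: "(y, f z) \<in> arcs M" by (simp add: par_def)
    then obtain y' where y': "y' \<in> nodes N" "y = f y'" using nM by blast
    then have "(y', z) \<in> arcs N" using eq[OF _ z] y by simp
    then show "y \<in> f ` par N z" using y' by (auto simp: par_def)
  next
    fix y assume "y \<in> f ` par N z"
    then obtain y' where y': "(y', z) \<in> arcs N" "y = f y'" by (auto simp: par_def)
    then show "y \<in> par M (f z)" using eq[OF _ z] nN by (simp add: par_def)
  qed
  have "reps M (f v) t (f ` nodes N)"
    by (rule reps_transport(1)[OF assms(1) inj]) (use o p f(3) assms(5) in \<open>auto simp: leaves_def\<close>)
  moreover have "par M (f v) = {}" using p[of v] reps_basic(1)[OF assms(1)] assms(6) by simp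
  ultimately show ?thesis using im by auto
qed

section \<open>Reordering a term\<close>

primrec orb :: "'a gt \<Rightarrow> 'a gt set" and orbc :: "'a ch \<Rightarrow> 'a ch set" where
  "orb (Leaf l) = {Leaf l}"
| "orb (Node a b) = (\<lambda>(x, y). Node x y) ` (orb a \<times> orb b) \<union> (\<lambda>(x, y). Node y x) ` (orb a \<times> orb b)"
| "orb (Gall c d t) = (\<lambda>(x, y, s). Gall x y s) ` (orbc c \<times> orbc d \<times> orb t)
     \<union> (\<lambda>(x, y, s). Gall y x s) ` (orbc c \<times> orbc d \<times> orb t)"
| "orbc End = {End}"
| "orbc (Chn a c) = (\<lambda>(x, y). Chn x y) ` (orb a \<times> orbc c)"

primrec labs :: "'a gt \<Rightarrow> 'a list" and labc :: "'a ch \<Rightarrow> 'a list" where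
  "labs (Leaf l) = [l]"
| "labs (Node a b) = labs a @ labs b"
| "labs (Gall c d t) = labc c @ labc d @ labs t"
| "labc End = []"
| "labc (Chn a c) = labs a @ labc c"

primrec kn :: "'a gt \<Rightarrow> nat" and kc :: "'a ch \<Rightarrow> nat" where
  "kn (Leaf l) = 0"
| "kn (Node a b) = Suc (kn a + kn b)"
| "kn (Gall c d t) = Suc (kc c + kc d + kn t)"
| "kc End = 0"
| "kc (Chn a c) = kn a + kc c"

lemma fixes t :: "'a gt" and c :: "'a ch"
  shows labs_nonempty: "labs t \<noteq> []" and labc_empty: "labc c = [] \<longleftrightarrow> c = End"
  by (induction t and c rule: gt.induct ch.induct) auto

lemma orb_inv:
  fixes t :: "'a gt" and c :: "'a ch"
  shows "\<forall>t'\<in>orb t. mset (labs t') = mset (labs t) \<and> kn t' = kn t"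
    and "\<forall>c'\<in>orbc c. mset (labc c') = mset (labc c) \<and> kc c' = kc c"
  by (induction t and c rule: gt.induct ch.induct) auto

lemma orb_set: "t' \<in> orb t \<Longrightarrow> set (labs t') = set (labs t)" "c' \<in> orbc c \<Longrightarrow> set (labc c') = set (labc c)"
  using orb_inv by (metis set_mset_mset)+

lemma card_orb:
  fixes t :: "'a gt" and c :: "'a ch"
  shows "wft t \<Longrightarrow> distinct (labs t) \<Longrightarrow> finite (orb t) \<and> card (orb t) = 2 ^ kn t"
    and "wfc c \<Longrightarrow> distinct (labc c) \<Longrightarrow> finite (orbc c) \<and> card (orbc c) = 2 ^ kc c"
proof (induction t and c rule: gt.induct ch.induct)
  case (Node a b)
  then have IH: "finite (orb a)" "card (orb a) = 2 ^ kn a" "finite (orb b)" "card (orb b) = 2 ^ kn b" by auto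
  let ?A = "(\<lambda>(x, y). Node x y) ` (orb a \<times> orb b)" and ?B = "(\<lambda>(x, y). Node y x) ` (orb a \<times> orb b)"
  have "x \<noteq> y" if "x \<in> orb a" "y \<in> orb b" for x y
    using orb_set(1)[OF that(1)] orb_set(1)[OF that(2)] Node.prems(2) labs_nonempty[of x] by auto
  then have d: "?A \<inter> ?B = {}" by auto
  have "card ?A = 2 ^ (kn a + kn b)" "card ?B = 2 ^ (kn a + kn b)"
    using IH by (subst card_image; auto simp: inj_on_def card_cartesian_product power_add)+
  then show ?case using IH d by (simp add: card_Un_disjoint)
next
  case (Gall c d t)
  then have IH: "finite (orbc c)" "card (orbc c) = 2 ^ kc c" "finite (orbc d)" "card (orbc d) = 2 ^ kc d"
    "finite (orb t)" "card (orb t) = 2 ^ kn t" by auto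
  let ?A = "(\<lambda>(x, y, s). Gall x y s) ` (orbc c \<times> orbc d \<times> orb t)"
  let ?B = "(\<lambda>(x, y, s). Gall y x s) ` (orbc c \<times> orbc d \<times> orb t)"
  have "x \<noteq> y" if "x \<in> orbc c" "y \<in> orbc d" for x y
    using orb_set(2)[OF that(1)] orb_set(2)[OF that(2)] Gall.prems labc_empty[of c] labc_empty[of d] by auto
  then have d: "?A \<inter> ?B = {}" by auto
  have "card ?A = 2 ^ (kc c + kc d + kn t)" "card ?B = 2 ^ (kc c + kc d + kn t)"
    using IH by (subst card_image; auto simp: inj_on_def card_cartesian_product power_add)+
  then show ?case using IH d by (simp add: card_Un_disjoint)
next
  case (Chn a c)
  then have IH: "finite (orb a)" "card (orb a) = 2 ^ kn a" "finite (orbc c)" "card (orbc c) = 2 ^ kc c" by auto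
  have "card ((\<lambda>(x, y). Chn x y) ` (orb a \<times> orbc c)) = 2 ^ (kn a + kc c)"
    using IH by (subst card_image; auto simp: inj_on_def card_cartesian_product power_add)
  then show ?case using IH by simp
qed auto

lemma orb_mem:
  "Node x y \<in> orb (Node a b) \<longleftrightarrow> x \<in> orb a \<and> y \<in> orb b \<or> x \<in> orb b \<and> y \<in> orb a"
  "Gall u v s \<in> orb (Gall c d t) \<longleftrightarrow> s \<in> orb t \<and> (u \<in> orbc c \<and> v \<in> orbc d \<or> u \<in> orbc d \<and> v \<in> orbc c)"
  "Chn x u \<in> orbc (Chn a c) \<longleftrightarrow> x \<in> orb a \<and> u \<in> orbc c"
  by (auto simp: image_iff)

lemma orb_refl:
  fixes t :: "'a gt" and c :: "'a ch"
  shows "t \<in> orb t" and "c \<in> orbc c"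
  by (induction t and c rule: gt.induct ch.induct) (simp_all add: orb_mem del: orb.simps(2,3) orbc.simps(2))

lemma reps_orb:
  shows "reps N v t V \<Longrightarrow> \<forall>t'\<in>orb t. reps N v t' V"
    and "chn N w u c r p V \<Longrightarrow> \<forall>c'\<in>orbc c. chn N w u c' r p V"
proof (induction rule: reps_chn.inducts)
  case (reps_Leaf v l)
  then show ?case by (auto intro: reps_chn.reps_Leaf)
next
  case (reps_Node v x y a V b W X)
  show ?case
  proof
    fix t' assume "t' \<in> orb (Node a b)"
    then obtain a' b' where ab: "a' \<in> orb a" "b' \<in> orb b" "t' = Node a' b' \<or> t' = Node b' a'" by auto
    have r: "reps N x a' V" "reps N y b' W" using reps_Node.IH ab by auto
    have "reps N v (Node a' b') X"
      by (rule reps_chn.reps_Node[OF \<open>out N v = _\<close> \<open>x \<noteq> y\<close> \<open>par N x = _\<close> \<open>par N y = _\<close> r]) fact+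
    moreover have "reps N v (Node b' a') X"
      by (rule reps_chn.reps_Node[OF _ _ \<open>par N y = _\<close> \<open>par N x = _\<close> r(2,1)])
        (use \<open>x \<noteq> y\<close> \<open>out N v = _\<close> \<open>v \<notin> V\<close> \<open>v \<notin> W\<close> \<open>V \<inter> W = {}\<close> \<open>X = _\<close> in auto)
    ultimately show "reps N v t' X" using ab by auto
  qed
next
  case (reps_Gall v x y c r p V d q W s t U X)
  show ?case
  proof
    fix t' assume "t' \<in> orb (Gall c d t)"
    then obtain a' b' s' where ab: "a' \<in> orbc c" "b' \<in> orbc d" "s' \<in> orb t" "t' = Gall a' b' s' \<or> t' = Gall b' a' s'" by auto
    have r: "chn N v x a' r p V" "chn N v y b' r q W" "reps N s s' U" using reps_Gall.IH ab by auto
    have "reps N v (Gall a' b' s') X"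
      by (rule reps_chn.reps_Gall[OF \<open>out N v = _\<close> \<open>x \<noteq> y\<close> r(1,2) \<open>par N r = _\<close> \<open>p \<noteq> q\<close> \<open>out N r = _\<close> \<open>par N s = _\<close> r(3)]) fact+
    moreover have "reps N v (Gall b' a' s') X"
    proof (rule reps_chn.reps_Gall[OF _ _ r(2,1) _ _ \<open>out N r = _\<close> \<open>par N s = _\<close> r(3)])
      show "out N v = {y, x}" "y \<noteq> x" "par N r = {q, p}" "q \<noteq> p" "W \<inter> V = {}" "X = insert v (insert r (W \<union> V \<union> U))"
        using \<open>out N v = _\<close> \<open>x \<noteq> y\<close> \<open>par N r = _\<close> \<open>p \<noteq> q\<close> \<open>V \<inter> W = {}\<close> \<open>X = _\<close> by auto
    qed fact+
    ultimately show "reps N v t' X" using ab by auto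
  qed
next
  case (chn_End w r)
  then show ?case by (auto intro: reps_chn.chn_End)
next
  case (chn_Chn u x y w a V c r p W X)
  show ?case
  proof
    fix t' assume "t' \<in> orbc (Chn a c)"
    then obtain a' b' where ab: "a' \<in> orb a" "b' \<in> orbc c" "t' = Chn a' b'" by auto
    have r: "reps N x a' V" "chn N u y b' r p W" using chn_Chn.IH ab by auto
    have "chn N w u (Chn a' b') r p X"
      by (rule reps_chn.chn_Chn[OF \<open>out N u = _\<close> \<open>x \<noteq> y\<close> \<open>par N u = _\<close> \<open>par N x = _\<close> r]) fact+
    then show "chn N w u t' r p X" using ab by auto
  qed
qed

lemma reps_chn_clash:
  assumes re: "reps N v t V" and c: "chn N w v c r p W" and o: "card (out N r) = 1"
    and q: "q \<in> par N r" "(v, q) \<notin> (arcs N)\<^sup>*"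
  shows False
proof (cases "v = r")
  case True
  then show False using reps_outdeg[OF re] o by auto
next
  case False
  have "(v, r) \<in> (arcs N)\<^sup>*" using reps_reach(2)[OF c] by blast
  then have "r \<in> V" using reps_reach_closed[OF re] reps_basic(1)[OF re] by blast
  then have "q \<in> V" using reps_par(1)[OF re] False q(1) by blast
  then show False using reps_reach(1)[OF re] q(2) by blast
qed

lemma gall_sides_unreachable:
  assumes "chn N v x c r p V" "chn N v y d r q W" "out N r = {s}" "reps N s t U"
    "v \<notin> V" "v \<notin> U" "v \<noteq> r" "V \<inter> W = {}" "W \<inter> U = {}"
  shows "(x, q) \<notin> (arcs N)\<^sup>*"
proof
  assume "(x, q) \<in> (arcs N)\<^sup>*"
  then have "q \<in> V \<union> {r} \<union> U"
  proof (induction rule: rtrancl_induct)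
    case base
    then show ?case using reps_basic(2)[OF assms(1)] by auto
  next
    case (step y z)
    have z: "z \<in> out N y" using step by (simp add: out_def)
    then show ?case using step(3) reps_out(2)[OF assms(1), of y] reps_out(1)[OF assms(4), of y] assms(3)
      reps_basic(1)[OF assms(4)] by auto
  qed
  then show False using reps_basic(2)[OF assms(2)] assms by auto
qed

lemma reps_determ:
  shows "reps N v t V \<Longrightarrow> \<forall>t' V'. reps N v t' V' \<longrightarrow> t' \<in> orb t"
    and "chn N w u c r p V \<Longrightarrow> card (out N r) = 1 \<longrightarrow> (\<exists>q\<in>par N r. (u, q) \<notin> (arcs N)\<^sup>*) \<longrightarrow>
      (\<forall>c' r' p' V'. chn N w u c' r' p' V' \<longrightarrow> card (out N r') = 1 \<longrightarrow> (\<exists>q\<in>par N r'. (u, q) \<notin> (arcs N)\<^sup>*) \<longrightarrow>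
         c' \<in> orbc c \<and> r' = r)"
proof (induction rule: reps_chn.inducts)
  case (reps_Leaf v l)
  show ?case
  proof (intro allI impI)
    fix t' V' assume "reps N v t' V'"
    then show "t' \<in> orb (Leaf l)" by (cases rule: reps.cases) (use reps_Leaf in auto)
  qed
next
  case (reps_Node v x y a V b W X)
  note o = \<open>out N v = {x, y}\<close>
  note IH1 = reps_Node.IH(5) and IH2 = reps_Node.IH(7)
  note rx = \<open>reps N x a V\<close> and ry = \<open>reps N y b W\<close> and ne = \<open>x \<noteq> y\<close>
  show ?case
  proof (intro allI impI)
    fix t' V' assume "reps N v t' V'"
    then show "t' \<in> orb (Node a b)"
    proof (cases rule: reps.cases)
      case (reps_Leaf l)
      then show ?thesis using o by simp
    next
      case (reps_Node x' y' a' V1 b' W1)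
      have "x' = x \<and> y' = y \<or> x' = y \<and> y' = x" using o \<open>out N v = {x', y'}\<close> by (auto simp: doubleton_eq_iff)
      then show ?thesis
      proof
        assume "x' = x \<and> y' = y"
        then have "a' \<in> orb a" "b' \<in> orb b" using IH1 IH2 \<open>reps N x' a' V1\<close> \<open>reps N y' b' W1\<close> by auto
        then show ?thesis using \<open>t' = _\<close> by (simp add: orb_mem del: orb.simps)
      next
        assume "x' = y \<and> y' = x"
        then have "a' \<in> orb b" "b' \<in> orb a" using IH1 IH2 \<open>reps N x' a' V1\<close> \<open>reps N y' b' W1\<close> by auto
        then show ?thesis using \<open>t' = _\<close> by (simp add: orb_mem del: orb.simps)
      qed
    next
      case (reps_Gall x' y' c' r' p' V1 d' q' W1 s' t'' U1)
      have "x' = x \<or> x' = y" using o \<open>out N v = {x', y'}\<close> by (auto simp: doubleton_eq_iff)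
      moreover have "(x', q') \<notin> (arcs N)\<^sup>*"
        by (rule gall_sides_unreachable[OF \<open>chn N v x' c' r' p' V1\<close> \<open>chn N v y' d' r' q' W1\<close> \<open>out N r' = _\<close> \<open>reps N s' t'' U1\<close>]) fact+
      moreover have "card (out N r') = 1" "q' \<in> par N r'" using \<open>out N r' = _\<close> \<open>par N r' = _\<close> by auto
      ultimately have False
        using reps_chn_clash[OF rx _ \<open>card (out N r') = 1\<close> \<open>q' \<in> par N r'\<close>] reps_chn_clash[OF ry _ \<open>card (out N r') = 1\<close> \<open>q' \<in> par N r'\<close>]
         \<open>chn N v x' c' r' p' V1\<close> by blast
      then show ?thesis ..
    qed
  qed
next
  case (reps_Gall v x y c r p V d q W s t U X)
  note o = \<open>out N v = {x, y}\<close>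
  note cx = \<open>chn N v x c r p V\<close> and cy = \<open>chn N v y d r q W\<close>
  have or: "card (out N r) = 1" "p \<in> par N r" "q \<in> par N r" using \<open>out N r = _\<close> \<open>par N r = _\<close> by auto
  have u1: "(x, q) \<notin> (arcs N)\<^sup>*"
    by (rule gall_sides_unreachable[OF cx cy \<open>out N r = _\<close> \<open>reps N s t U\<close>]) fact+
  have u2: "(y, p) \<notin> (arcs N)\<^sup>*"
    by (rule gall_sides_unreachable[OF cy cx \<open>out N r = _\<close> \<open>reps N s t U\<close>]) (fact | (use \<open>V \<inter> W = {}\<close> in blast))+
  have IH1: "c' \<in> orbc c \<and> r' = r" if "chn N v x c' r' p' V'" "card (out N r') = 1" "q' \<in> par N r'" "(x, q') \<notin> (arcs N)\<^sup>*" for c' r' p' V' q'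
    using reps_Gall.IH(3) or u1 that by blast
  have IH2: "c' \<in> orbc d \<and> r' = r" if "chn N v y c' r' p' V'" "card (out N r') = 1" "q' \<in> par N r'" "(y, q') \<notin> (arcs N)\<^sup>*" for c' r' p' V' q'
    using reps_Gall.IH(5) or u2 that by blast
  note IH3 = reps_Gall.IH(10)
  show ?case
  proof (intro allI impI)
    fix t' V' assume "reps N v t' V'"
    then show "t' \<in> orb (Gall c d t)"
    proof (cases rule: reps.cases)
      case (reps_Leaf l)
      then show ?thesis using o by simp
    next
      case (reps_Node x' y' a' V1 b' W1)
      have "x' = x \<or> y' = x" using o \<open>out N v = {x', y'}\<close> by (auto simp: doubleton_eq_iff)
      then have False
        using reps_chn_clash[OF _ cx or(1,3) u1] \<open>reps N x' a' V1\<close> \<open>reps N y' b' W1\<close> by blast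
      then show ?thesis ..
    next
      case (reps_Gall x' y' c' r' p' V1 d' q' W1 s' t'' U1)
      have u1': "(x', q') \<notin> (arcs N)\<^sup>*"
        by (rule gall_sides_unreachable[OF \<open>chn N v x' c' r' p' V1\<close> \<open>chn N v y' d' r' q' W1\<close> \<open>out N r' = _\<close> \<open>reps N s' t'' U1\<close>]) fact+
      have u2': "(y', p') \<notin> (arcs N)\<^sup>*"
        by (rule gall_sides_unreachable[OF \<open>chn N v y' d' r' q' W1\<close> \<open>chn N v x' c' r' p' V1\<close> \<open>out N r' = _\<close> \<open>reps N s' t'' U1\<close>]) (fact | (use \<open>V1 \<inter> W1 = {}\<close> in blast))+
      have or': "card (out N r') = 1" "p' \<in> par N r'" "q' \<in> par N r'" using \<open>out N r' = _\<close> \<open>par N r' = _\<close> by auto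
      have "x' = x \<and> y' = y \<or> x' = y \<and> y' = x" using o \<open>out N v = {x', y'}\<close> by (auto simp: doubleton_eq_iff)
      then show ?thesis
      proof
        assume e: "x' = x \<and> y' = y"
        then have 1: "c' \<in> orbc c \<and> r' = r" "d' \<in> orbc d"
          using IH1[OF _ or'(1,3)] IH2[OF _ or'(1,2)] u1' u2' \<open>chn N v x' c' r' p' V1\<close> \<open>chn N v y' d' r' q' W1\<close> by blast+
        then have "s' = s" using \<open>out N r = _\<close> \<open>out N r' = _\<close> by auto
        then have "t'' \<in> orb t" using IH3 \<open>reps N s' t'' U1\<close> by auto
        then show ?thesis using 1 \<open>t' = _\<close> by (simp add: orb_mem del: orb.simps)
      next
        assume e: "x' = y \<and> y' = x"
        then have 1: "c' \<in> orbc d \<and> r' = r" "d' \<in> orbc c"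
          using IH2[OF _ or'(1,3)] IH1[OF _ or'(1,2)] u1' u2' \<open>chn N v x' c' r' p' V1\<close> \<open>chn N v y' d' r' q' W1\<close> by blast+
        then have "s' = s" using \<open>out N r = _\<close> \<open>out N r' = _\<close> by auto
        then have "t'' \<in> orb t" using IH3 \<open>reps N s' t'' U1\<close> by auto
        then show ?thesis using 1 \<open>t' = _\<close> by (simp add: orb_mem del: orb.simps)
      qed
    qed
  qed
next
  case (chn_End w r)
  show ?case
  proof (intro allI impI)
    fix c' r' p' V'
    assume "card (out N r) = 1" "chn N w r c' r' p' V'"
    from this(2,1) show "c' \<in> orbc End \<and> r' = r" by (cases rule: chn.cases) auto
  qed
next
  case (chn_Chn u x y w a V c r p W X)
  note o = \<open>out N u = {x, y}\<close> and ne = \<open>x \<noteq> y\<close>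
  have uxy: "(u, x) \<in> arcs N" "(u, y) \<in> arcs N" using o by (auto simp: out_def)
  have un: "(x, q) \<notin> (arcs N)\<^sup>*" "(y, q) \<notin> (arcs N)\<^sup>*" if "(u, q) \<notin> (arcs N)\<^sup>*" for q
    using that uxy by (meson converse_rtrancl_into_rtrancl)+
  note IH1 = chn_Chn.IH(5) and IH2 = chn_Chn.IH(7) and rx = \<open>reps N x a V\<close>
  show ?case
  proof (intro allI impI)
    fix c' r' p' V'
    assume or: "card (out N r) = 1" and q: "\<exists>q\<in>par N r. (u, q) \<notin> (arcs N)\<^sup>*" and ch: "chn N w u c' r' p' V'"
      and or': "card (out N r') = 1" and q': "\<exists>q\<in>par N r'. (u, q) \<notin> (arcs N)\<^sup>*"
    have qy: "\<exists>q\<in>par N r. (y, q) \<notin> (arcs N)\<^sup>*" "\<exists>q\<in>par N r'. (y, q) \<notin> (arcs N)\<^sup>*" "\<exists>q\<in>par N r'. (x, q) \<notin> (arcs N)\<^sup>*"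
      using un q q' by blast+
    from ch show "c' \<in> orbc (Chn a c) \<and> r' = r"
    proof (cases rule: chn.cases)
      case chn_End
      then show ?thesis using o ne or' by auto
    next
      case (chn_Chn x' y' a' V1 c'' W1)
      have "x' = x \<and> y' = y \<or> x' = y \<and> y' = x" using o \<open>out N u = {x', y'}\<close> by (auto simp: doubleton_eq_iff)
      then show ?thesis
      proof
        assume e: "x' = x \<and> y' = y"
        then have "a' \<in> orb a" using IH1 \<open>reps N x' a' V1\<close> by auto
        moreover have "c'' \<in> orbc c \<and> r' = r" using IH2 or or' qy e \<open>chn N u y' c'' r' p' W1\<close> by blast
        ultimately show ?thesis using \<open>c' = _\<close> by (simp add: orb_mem del: orbc.simps)
      next
        assume e: "x' = y \<and> y' = x"
        then show ?thesis using reps_chn_clash[OF rx _ or'] qy(3) \<open>chn N u y' c'' r' p' W1\<close> by blast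
      qed
    qed
  qed
qed

theorem reps_orbit:
  assumes "reps N v t V" shows "{t'. reps N v t' V} = orb t"
  using reps_orb(1)[OF assms] reps_determ(1)[OF assms] by blast

section \<open>Leaf labels and leaf depths\<close>

primrec clen :: "'a ch \<Rightarrow> nat" where
  "clen End = 0"
| "clen (Chn a c) = Suc (clen c)"

text \<open>The sum of the leaf depths when the root of the term has depth \<open>k\<close>; for a chain, \<open>k\<close> is the depth of its
  first node. A reticulation node takes its depth from the longer or the shorter side, \<open>m\<close> being \<open>max\<close> or \<open>min\<close>.\<close>
primrec sk :: "(nat \<Rightarrow> nat \<Rightarrow> nat) \<Rightarrow> nat \<Rightarrow> 'a gt \<Rightarrow> nat"
  and skc :: "(nat \<Rightarrow> nat \<Rightarrow> nat) \<Rightarrow> nat \<Rightarrow> 'a ch \<Rightarrow> nat" where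
  "sk m k (Leaf l) = k"
| "sk m k (Node a b) = sk m (Suc k) a + sk m (Suc k) b"
| "sk m k (Gall c d t) = skc m (Suc k) c + skc m (Suc k) d + sk m (k + m (clen c) (clen d) + 2) t"
| "skc m k End = 0"
| "skc m k (Chn a c) = sk m (Suc k) a + skc m (Suc k) c"

definition lvs :: "net \<Rightarrow> nat set \<Rightarrow> nat set" where "lvs N V = {z\<in>V. out N z = {}}"

lemma lvs_simps: "lvs N {} = {}" "lvs N (V \<union> W) = lvs N V \<union> lvs N W"
  "out N v \<noteq> {} \<Longrightarrow> lvs N (insert v V) = lvs N V" "out N v = {} \<Longrightarrow> lvs N {v} = {v}"
  by (auto simp: lvs_def)

lemma lvs_fin: "finite V \<Longrightarrow> finite (lvs N V)" by (simp add: lvs_def)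
lemma lvs_disj: "V \<inter> W = {} \<Longrightarrow> lvs N V \<inter> lvs N W = {}" by (auto simp: lvs_def)

lemma reps_sk:
  assumes 1: "\<And>u w. par N u = {w} \<Longrightarrow> h u = Suc (h w)"
    and 2: "\<And>u p q. par N u = {p, q} \<Longrightarrow> p \<noteq> q \<Longrightarrow> h u = Suc (m (h p) (h q))"
    and m: "\<And>k i j. m (k + i) (k + j) = k + m i j"
  shows "reps N v t V \<Longrightarrow> (\<Sum>z\<in>lvs N V. h z) = sk m (h v) t"
    and "chn N w u c r p V \<Longrightarrow> h p = h w + clen c \<and> (\<Sum>z\<in>lvs N V. h z) = skc m (Suc (h w)) c"
proof (induction rule: reps_chn.inducts)
  case (reps_Leaf v l)
  then show ?case by (simp add: lvs_simps)
next
  case (reps_Node v x y a V b W X)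
  have f: "finite V" "finite W" using reps_basic(1)[OF \<open>reps N x a V\<close>] reps_basic(1)[OF \<open>reps N y b W\<close>] by auto
  have "lvs N X = lvs N V \<union> lvs N W" using \<open>X = _\<close> \<open>out N v = _\<close> by (simp add: lvs_simps)
  then show ?case using reps_Node.IH(5,7) f lvs_disj[OF \<open>V \<inter> W = {}\<close>] 1[OF \<open>par N x = _\<close>] 1[OF \<open>par N y = _\<close>]
    by (simp add: sum.union_disjoint lvs_fin)
next
  case (reps_Gall v x y c r p V d q W s t U X)
  have f: "finite V" "finite W" "finite U"
    using reps_basic(2)[OF \<open>chn N v x c r p V\<close>] reps_basic(2)[OF \<open>chn N v y d r q W\<close>] reps_basic(1)[OF \<open>reps N s t U\<close>] by auto
  have X: "lvs N X = lvs N V \<union> lvs N W \<union> lvs N U" using \<open>X = _\<close> \<open>out N v = _\<close> \<open>out N r = _\<close> by (simp add: lvs_simps)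
  have "(lvs N V \<union> lvs N W) \<inter> lvs N U = {}"
    using lvs_disj[OF \<open>V \<inter> U = {}\<close>] lvs_disj[OF \<open>W \<inter> U = {}\<close>] by blast
  then have S: "(\<Sum>z\<in>lvs N X. h z) = (\<Sum>z\<in>lvs N V. h z) + (\<Sum>z\<in>lvs N W. h z) + (\<Sum>z\<in>lvs N U. h z)"
    using X f lvs_disj[OF \<open>V \<inter> W = {}\<close>] by (simp add: sum.union_disjoint lvs_fin)
  have "h r = Suc (m (h v + clen c) (h v + clen d))" using 2[OF \<open>par N r = _\<close> \<open>p \<noteq> q\<close>] reps_Gall.IH(3,5) by simp
  then have "h s = h v + m (clen c) (clen d) + 2" using 1[OF \<open>par N s = _\<close>] by (simp add: m)
  then show ?case using S reps_Gall.IH(3,5,10) by simp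
next
  case (chn_End w r)
  then show ?case by (simp add: lvs_simps)
next
  case (chn_Chn u x y w a V c r p W X)
  have f: "finite V" "finite W" using reps_basic(1)[OF \<open>reps N x a V\<close>] reps_basic(2)[OF \<open>chn N u y c r p W\<close>] by auto
  have "lvs N X = lvs N V \<union> lvs N W" using \<open>X = _\<close> \<open>out N u = _\<close> by (simp add: lvs_simps)
  then show ?case using chn_Chn.IH(5,7) f lvs_disj[OF \<open>V \<inter> W = {}\<close>] 1[OF \<open>par N x = _\<close>] 1[OF \<open>par N u = _\<close>]
    by (simp add: sum.union_disjoint lvs_fin)
qed

lemma reps_labs:
  shows "reps N v t V \<Longrightarrow> mset (labs t) = image_mset (lab N) (mset_set (lvs N V))"
    and "chn N w u c r p V \<Longrightarrow> mset (labc c) = image_mset (lab N) (mset_set (lvs N V))"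
proof (induction rule: reps_chn.inducts)
  case (reps_Leaf v l)
  then show ?case by (simp add: lvs_simps)
next
  case (reps_Node v x y a V b W X)
  have f: "finite V" "finite W" using reps_basic(1)[OF \<open>reps N x a V\<close>] reps_basic(1)[OF \<open>reps N y b W\<close>] by auto
  have "lvs N X = lvs N V \<union> lvs N W" using \<open>X = _\<close> \<open>out N v = _\<close> by (simp add: lvs_simps)
  then show ?case using reps_Node.IH(5,7) f lvs_disj[OF \<open>V \<inter> W = {}\<close>] by (simp add: mset_set_Union lvs_fin)
next
  case (reps_Gall v x y c r p V d q W s t U X)
  have f: "finite V" "finite W" "finite U"
    using reps_basic(2)[OF \<open>chn N v x c r p V\<close>] reps_basic(2)[OF \<open>chn N v y d r q W\<close>] reps_basic(1)[OF \<open>reps N s t U\<close>] by auto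
  have X: "lvs N X = lvs N V \<union> lvs N W \<union> lvs N U" using \<open>X = _\<close> \<open>out N v = _\<close> \<open>out N r = _\<close> by (simp add: lvs_simps)
  have "(lvs N V \<union> lvs N W) \<inter> lvs N U = {}"
    using lvs_disj[OF \<open>V \<inter> U = {}\<close>] lvs_disj[OF \<open>W \<inter> U = {}\<close>] by blast
  then show ?case using reps_Gall.IH(3,5,10) X f lvs_disj[OF \<open>V \<inter> W = {}\<close>] by (simp add: mset_set_Union lvs_fin)
next
  case (chn_End w r)
  then show ?case by (simp add: lvs_simps)
next
  case (chn_Chn u x y w a V c r p W X)
  have f: "finite V" "finite W" using reps_basic(1)[OF \<open>reps N x a V\<close>] reps_basic(2)[OF \<open>chn N u y c r p W\<close>] by auto
  have "lvs N X = lvs N V \<union> lvs N W" using \<open>X = _\<close> \<open>out N u = _\<close> by (simp add: lvs_simps)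
  then show ?case using chn_Chn.IH(5,7) f lvs_disj[OF \<open>V \<inter> W = {}\<close>] by (simp add: mset_set_Union lvs_fin)
qed

definition plens :: "net \<Rightarrow> nat \<Rightarrow> nat set" where
  "plens N x = {length p - 1 | p. dpath N p \<and> hd p = the_root N \<and> last p = x}"

lemma path_edges_snoc: "xs \<noteq> [] \<Longrightarrow> path_edges (xs @ [u]) = insert (last xs, u) (path_edges xs)"
  by (induction xs rule: induct_list012) auto

lemma dpath_alt: "dpath N p \<longleftrightarrow> p \<noteq> [] \<and> set p \<subseteq> nodes N \<and> path_edges p \<subseteq> arcs N"
  by (simp add: dpath_def path_edges_def)

lemma dpath_snoc: "xs \<noteq> [] \<Longrightarrow> dpath N (xs @ [u]) \<longleftrightarrow> dpath N xs \<and> u \<in> nodes N \<and> (last xs, u) \<in> arcs N"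
  by (auto simp: dpath_alt path_edges_snoc)

context galled
begin

lemma plens_root: "plens N (the_root N) = {0}"
proof -
  have "p = [the_root N]" if p: "dpath N p" "hd p = the_root N" "last p = the_root N" for p
  proof (rule ccontr)
    assume n: "p \<noteq> [the_root N]"
    obtain xs u where xs: "p = xs @ [u]" using p(1) by (metis dpath_def rev_exhaust)
    then have u: "u = the_root N" using p by simp
    then have "xs \<noteq> []" using n xs by auto
    then have "(last xs, the_root N) \<in> arcs N" using dpath_snoc p(1) xs u by simp
    then show False using root_reps(2) by (auto simp: par_def)
  qed
  moreover have "dpath N [the_root N]" using root_reps(3) by (simp add: dpath_def)
  ultimately show ?thesis unfolding plens_def by force
qed

lemma plens_par:
  assumes "par N u \<noteq> {}" shows "plens N u = (\<Union>w\<in>par N u. Suc ` plens N w)"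
proof (intro equalityI subsetI)
  fix k assume "k \<in> plens N u"
  then obtain p where p: "dpath N p" "hd p = the_root N" "last p = u" "k = length p - 1" by (auto simp: plens_def)
  obtain xs where xs: "p = xs @ [u]" using p(1,3) by (metis dpath_def append_butlast_last_id)
  have ne: "xs \<noteq> []" using xs p(2) assms root_reps(2) by auto
  have d: "dpath N xs" "(last xs, u) \<in> arcs N" using dpath_snoc[OF ne] p(1) xs by auto
  have "length xs - 1 \<in> plens N (last xs)" using d p(2) xs ne by (auto simp: plens_def)
  moreover have "k = Suc (length xs - 1)" using p(4) xs ne by (cases xs) auto
  moreover have "last xs \<in> par N u" using d by (simp add: par_def)
  ultimately show "k \<in> (\<Union>w\<in>par N u. Suc ` plens N w)" by blast
next
  fix k assume "k \<in> (\<Union>w\<in>par N u. Suc ` plens N w)"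
  then obtain w p where w: "(w, u) \<in> arcs N" "dpath N p" "hd p = the_root N" "last p = w" "k = Suc (length p - 1)"
    by (auto simp: plens_def par_def)
  have ne: "p \<noteq> []" using w(2) by (simp add: dpath_def)
  have "dpath N (p @ [u])" using dpath_snoc[OF ne] w A by auto
  moreover have "k = length (p @ [u]) - 1" "hd (p @ [u]) = the_root N" "last (p @ [u]) = u" using w ne by (cases p; auto)+
  ultimately show "k \<in> plens N u" unfolding plens_def by blast
qed

lemma plens_fin: "u \<in> nodes N \<Longrightarrow> finite (plens N u) \<and> plens N u \<noteq> {}"
  using wf2
proof (induction u rule: wf_induct_rule)
  case (less u)
  show ?case
  proof (cases "par N u = {}")
    case True
    then have "u = the_root N" using less(2) ph theI'[of "\<lambda>r. r \<in> nodes N \<and> indeg N r = 0"]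
      unfolding the_root_def phylo_network_def by (metis (no_types, lifting) card.empty indeg_par)
    then show ?thesis using plens_root by simp
  next
    case False
    have "finite (plens N w) \<and> plens N w \<noteq> {}" if "w \<in> par N u" for w
      using less(1)[of w] that A by (auto simp: par_def)
    then show ?thesis using plens_par[OF False] False finp by auto
  qed
qed

lemma hmax_hmin_plens: "hmax N u = Max (plens N u)" "hmin N u = Min (plens N u)"
  by (simp_all add: hmax_def hmin_def plens_def)

lemma h_one:
  assumes "par N u = {w}" shows "hmax N u = Suc (hmax N w)" "hmin N u = Suc (hmin N w)"
proof -
  have "w \<in> nodes N" using assms A by (auto simp: par_def)
  then have "finite (plens N w)" "plens N w \<noteq> {}" using plens_fin by auto
  then show "hmax N u = Suc (hmax N w)" "hmin N u = Suc (hmin N w)"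
    using plens_par[of u] assms by (simp_all add: hmax_hmin_plens mono_Max_commute[symmetric] mono_Min_commute[symmetric] mono_Suc)
qed

lemma h_two:
  assumes "par N u = {p, q}" shows "hmax N u = Suc (max (hmax N p) (hmax N q))" "hmin N u = Suc (min (hmin N p) (hmin N q))"
proof -
  have "p \<in> nodes N" "q \<in> nodes N" using assms A by (auto simp: par_def)
  then have f: "finite (plens N p)" "plens N p \<noteq> {}" "finite (plens N q)" "plens N q \<noteq> {}" using plens_fin by auto
  have e: "plens N u = Suc ` (plens N p \<union> plens N q)" using plens_par[of u] assms by auto
  have "Max (Suc ` (plens N p \<union> plens N q)) = Suc (Max (plens N p \<union> plens N q))"
    using f by (intro mono_Max_commute[symmetric] mono_Suc) auto
  moreover have "Min (Suc ` (plens N p \<union> plens N q)) = Suc (Min (plens N p \<union> plens N q))"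
    using f by (intro mono_Min_commute[symmetric] mono_Suc) auto
  ultimately show "hmax N u = Suc (max (hmax N p) (hmax N q))" "hmin N u = Suc (min (hmin N p) (hmin N q))"
    using e f by (simp_all add: hmax_hmin_plens Max_Un Min_Un)
qed

lemma h_root: "hmax N (the_root N) = 0" "hmin N (the_root N) = 0"
  by (simp_all add: hmax_hmin_plens plens_root)

lemma out_empty_leaf: "z \<in> nodes N \<Longrightarrow> out N z = {} \<longleftrightarrow> is_leaf N z"
  using types[of z] finp[of z] by (auto simp: is_leaf_def indeg_par outdeg_out)

lemma leaves_lvs: "leaves N = lvs N (nodes N)"
  using out_empty_leaf by (auto simp: leaves_def lvs_def is_leaf_def)

theorem sackin_sk:
  assumes "reps N (the_root N) t (nodes N)"
  shows "sackin_max N = sk max 0 t" "sackin_min N = sk min 0 t"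
proof -
  show "sackin_max N = sk max 0 t"
    unfolding sackin_max_def leaves_lvs
    using reps_sk(1)[of N "hmax N" max, OF _ _ _ assms] h_one h_two h_root by simp
  show "sackin_min N = sk min 0 t"
    unfolding sackin_min_def leaves_lvs
    using reps_sk(1)[of N "hmin N" min, OF _ _ _ assms] h_one h_two h_root by simp
qed

theorem labeled_iff:
  assumes "reps N (the_root N) t (nodes N)"
  shows "labeled n N \<longleftrightarrow> distinct (labs t) \<and> set (labs t) = {1..n}"
proof -
  have f: "finite (leaves N)" unfolding leaves_lvs by (rule lvs_fin[OF fin])
  have m: "mset (labs t) = image_mset (lab N) (mset_set (leaves N))"
    unfolding leaves_lvs by (rule reps_labs(1)[OF assms])
  have s: "set (labs t) = lab N ` leaves N" using arg_cong[OF m, of set_mset] f by simp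
  have l: "length (labs t) = card (leaves N)" using arg_cong[OF m, of size] by simp
  have "distinct (labs t) \<longleftrightarrow> inj_on (lab N) (leaves N)"
    using s l f by (metis card_distinct distinct_card eq_card_imp_inj_on card_image)
  then show ?thesis using s by (auto simp: labeled_def bij_betw_def)
qed

end

section \<open>Every term describes a network\<close>

lemma reps_cong:
  assumes "reps N v t V" "\<forall>z\<in>V. out M z = out N z \<and> lab M z = lab N z" "\<forall>z\<in>V - {v}. par M z = par N z"
  shows "reps M v t V"
  using reps_transport(1)[OF assms(1), of id M] assms(2,3) by simp

lemma chn_cong:
  assumes "chn N w u c r p V" "\<forall>z\<in>V. out M z = out N z \<and> lab M z = lab N z" "\<forall>z\<in>V. par M z = par N z"
  shows "chn M w u c r p V"
  using reps_transport(2)[OF assms(1), of id M] assms(2,3) by simp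

lemma net_simps [simp]:
  "out (V, E, L) z = {w. (z, w) \<in> E}" "par (V, E, L) z = {w. (w, z) \<in> E}" "lab (V, E, L) = L"
  by (simp_all add: out_def par_def arcs_def lab_def)

lemma fresh: "finite A \<Longrightarrow> \<exists>v::nat. v \<notin> A"
  by (meson ex_new_if_finite infinite_UNIV_nat)

lemma realize:
  fixes t :: "nat gt" and c :: "nat ch"
  shows "wft t \<Longrightarrow> \<forall>A. finite A \<longrightarrow> (\<exists>E L v V. V \<inter> A = {} \<and> E \<subseteq> V \<times> V \<and> (\<forall>a. (a, v) \<notin> E) \<and> reps (V, E, L) v t V)"
    and "wfc c \<Longrightarrow> \<forall>A w r. finite A \<longrightarrow> w \<in> A \<longrightarrow> r \<in> A \<longrightarrow> w \<noteq> r \<longrightarrow> (\<exists>E L u p V. V \<inter> A = {} \<and>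
          E \<subseteq> insert w V \<times> insert r V \<and> {z. (w, z) \<in> E} = {u} \<and> {z. (z, r) \<in> E} = {p} \<and> chn (V, E, L) w u c r p V)"
proof (induction t and c rule: gt.induct ch.induct)
  case (Leaf l)
  show ?case
  proof (intro allI impI)
    fix A :: "nat set" assume "finite A"
    then obtain v where "v \<notin> A" using fresh by blast
    then show "\<exists>E L v V. V \<inter> A = {} \<and> E \<subseteq> V \<times> V \<and> (\<forall>a. (a, v) \<notin> E) \<and> reps (V, E, L) v (Leaf l) V"
      by (intro exI[of _ "{}"] exI[of _ "\<lambda>_. l"] exI[of _ v] exI[of _ "{v}"]) (auto intro!: reps_Leaf)
  qed
next
  case (Node a b)
  show ?case
  proof (intro allI impI)
    fix A :: "nat set" assume fA: "finite A"
    obtain E1 L1 x V1 where 1: "V1 \<inter> A = {}" "E1 \<subseteq> V1 \<times> V1" "\<forall>a. (a, x) \<notin> E1" "reps (V1, E1, L1) x a V1"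
      using Node fA by (metis wft.simps(2))
    have f1: "finite V1" "x \<in> V1" using reps_basic(1)[OF 1(4)] by auto
    then have "finite (A \<union> V1)" using fA by simp
    then obtain E2 L2 y V2 where 2: "V2 \<inter> (A \<union> V1) = {}" "E2 \<subseteq> V2 \<times> V2" "\<forall>a. (a, y) \<notin> E2" "reps (V2, E2, L2) y b V2"
      using Node by (metis wft.simps(2))
    have f2: "finite V2" "y \<in> V2" using reps_basic(1)[OF 2(4)] by auto
    obtain v where v: "v \<notin> A \<union> V1 \<union> V2" using fresh[of "A \<union> V1 \<union> V2"] f1 f2 fA by blast
    define E where "E = {(v, x), (v, y)} \<union> E1 \<union> E2"
    define V where "V = insert v (V1 \<union> V2)"
    define L where "L z = (if z \<in> V1 then L1 z else L2 z)" for z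
    have r1: "reps (V, E, L) x a V1"
      by (rule reps_cong[OF 1(4)]) (use 1(2,3) 2(1,2) v f1 f2 in \<open>auto simp: E_def L_def\<close>)
    have r2: "reps (V, E, L) y b V2"
      by (rule reps_cong[OF 2(4)]) (use 1(2,3) 2(1,2,3) v f1 f2 in \<open>auto simp: E_def L_def\<close>)
    have "reps (V, E, L) v (Node a b) V"
      by (rule reps_Node[OF _ _ _ _ r1 r2]) (use 1(2,3) 2(1,2,3) v f1 f2 in \<open>auto simp: E_def V_def\<close>)
    moreover have "V \<inter> A = {}" "E \<subseteq> V \<times> V" "\<forall>a. (a, v) \<notin> E"
      using 1(1,2) 2(1,2) v f1 f2 by (auto simp: V_def E_def)
    ultimately show "\<exists>E L v V. V \<inter> A = {} \<and> E \<subseteq> V \<times> V \<and> (\<forall>a. (a, v) \<notin> E) \<and> reps (V, E, L) v (Node a b) V"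
      by blast
  qed
next
  case (Gall c d t)
  show ?case
  proof (intro allI impI)
    fix A :: "nat set" assume fA: "finite A"
    obtain v where v: "v \<notin> A" using fresh fA by blast
    obtain r where r: "r \<notin> insert v A" using fresh[of "insert v A"] fA by blast
    define B where "B = insert v (insert r A)"
    have B: "finite B" "v \<in> B" "r \<in> B" "v \<noteq> r" using fA r by (auto simp: B_def)
    have wf: "wfc c" "wfc d" "wft t" "\<not> (c = End \<and> d = End)" using Gall.prems by auto
    obtain E1 L1 x p V1 where 1: "V1 \<inter> B = {}" "E1 \<subseteq> insert v V1 \<times> insert r V1" "{z. (v, z) \<in> E1} = {x}" "{z. (z, r) \<in> E1} = {p}" "chn (V1, E1, L1) v x c r p V1"
      using Gall.IH(1)[OF wf(1)] B by metis
    have f1: "finite V1" "x \<in> insert r V1" "p \<in> insert v V1" using reps_basic(2)[OF 1(5)] by auto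
    have "finite (B \<union> V1)" "v \<in> B \<union> V1" "r \<in> B \<union> V1" using B f1 by auto
    then obtain E2 L2 y q V2 where 2: "V2 \<inter> (B \<union> V1) = {}" "E2 \<subseteq> insert v V2 \<times> insert r V2" "{z. (v, z) \<in> E2} = {y}" "{z. (z, r) \<in> E2} = {q}" "chn (V2, E2, L2) v y d r q V2"
      using Gall.IH(2)[OF wf(2)] B(4) by metis
    have f2: "finite V2" "y \<in> insert r V2" "q \<in> insert v V2" using reps_basic(2)[OF 2(5)] by auto
    have "finite (B \<union> V1 \<union> V2)" using B f1 f2 by auto
    then obtain E3 L3 s V3 where 3: "V3 \<inter> (B \<union> V1 \<union> V2) = {}" "E3 \<subseteq> V3 \<times> V3" "\<forall>a. (a, s) \<notin> E3" "reps (V3, E3, L3) s t V3"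
      using Gall.IH(3)[OF wf(3)] by metis
    have f3: "finite V3" "s \<in> V3" using reps_basic(1)[OF 3(4)] by auto
    have vr: "v \<notin> V1" "v \<notin> V2" "v \<notin> V3" "r \<notin> V1" "r \<notin> V2" "r \<notin> V3" using 1(1) 2(1) 3(1) B by auto
    have dj: "V1 \<inter> V2 = {}" "V1 \<inter> V3 = {}" "V2 \<inter> V3 = {}" using 2(1) 3(1) by auto
    have xr: "x = r \<longleftrightarrow> c = End" "y = r \<longleftrightarrow> d = End" using chn_End_iff[OF 1(5)] chn_End_iff[OF 2(5)] by auto
    have xy: "x \<noteq> y" using xr wf(4) f1(2) f2(2) dj vr by auto
    have pq: "p \<noteq> q" using chn_last(2)[OF 1(5)] chn_last(2)[OF 2(5)] f1(3) f2(3) dj vr xy by auto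
    define E where "E = E1 \<union> E2 \<union> E3 \<union> {(r, s)}"
    define V where "V = insert v (insert r (V1 \<union> V2 \<union> V3))"
    define L where "L z = (if z \<in> V1 then L1 z else if z \<in> V2 then L2 z else L3 z)" for z
    have c1: "chn (V, E, L) v x c r p V1"
    proof (rule chn_cong[OF 1(5)])
      show "\<forall>z\<in>V1. out (V, E, L) z = out (V1, E1, L1) z \<and> lab (V, E, L) z = lab (V1, E1, L1) z"
        using 2(2) 3(2) vr dj by (auto simp: E_def L_def)
      show "\<forall>z\<in>V1. par (V, E, L) z = par (V1, E1, L1) z"
        using 2(2) 3(2) vr dj f3 by (auto simp: E_def)
    qed
    have c2: "chn (V, E, L) v y d r q V2"
    proof (rule chn_cong[OF 2(5)])
      show "\<forall>z\<in>V2. out (V, E, L) z = out (V2, E2, L2) z \<and> lab (V, E, L) z = lab (V2, E2, L2) z"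
        using 1(2) 3(2) vr dj by (auto simp: E_def L_def)
      show "\<forall>z\<in>V2. par (V, E, L) z = par (V2, E2, L2) z"
        using 1(2) 3(2) vr dj f3 by (auto simp: E_def)
    qed
    have c3: "reps (V, E, L) s t V3"
    proof (rule reps_cong[OF 3(4)])
      show "\<forall>z\<in>V3. out (V, E, L) z = out (V3, E3, L3) z \<and> lab (V, E, L) z = lab (V3, E3, L3) z"
        using 1(2) 2(2) vr dj by (auto simp: E_def L_def)
      show "\<forall>z\<in>V3 - {s}. par (V, E, L) z = par (V3, E3, L3) z"
        using 1(2) 2(2) vr dj f3 by (auto simp: E_def)
    qed
    have "(v, z) \<in> E \<longleftrightarrow> z = x \<or> z = y" for z
      using 1(3) 2(3) 3(2) vr B(4) by (auto simp: E_def)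
    then have o: "out (V, E, L) v = {x, y}" by auto
    have "(z, r) \<in> E \<longleftrightarrow> z = p \<or> z = q" for z
      using 1(4) 2(4) 3(2) vr f3 by (auto simp: E_def)
    then have pr: "par (V, E, L) r = {p, q}" by auto
    have or: "out (V, E, L) r = {s}" using 1(2) 2(2) 3(2) vr B(4) by (auto simp: E_def)
    have ps: "par (V, E, L) s = {r}" using 1(2) 2(2) 3(2,3) vr dj f3 by (auto simp: E_def)
    have "reps (V, E, L) v (Gall c d t) V"
      by (rule reps_Gall[OF o xy c1 c2 pr pq or ps c3]) (use vr dj B(4) V_def in auto)
    moreover have "V \<inter> A = {}" using 1(1) 2(1) 3(1) v r by (auto simp: V_def B_def)
    moreover have "E \<subseteq> V \<times> V" using 1(2) 2(2) 3(2) f3 unfolding V_def E_def by blast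
    moreover have "\<forall>a. (a, v) \<notin> E" using 1(2) 2(2) 3(2) vr B(4) f3 by (auto simp: E_def)
    ultimately show "\<exists>E L v V. V \<inter> A = {} \<and> E \<subseteq> V \<times> V \<and> (\<forall>a. (a, v) \<notin> E) \<and> reps (V, E, L) v (Gall c d t) V"
      by blast
  qed
next
  case End
  show ?case
  proof (intro allI impI)
    fix A :: "nat set" and w r :: nat assume "w \<noteq> r"
    then show "\<exists>E L u p V. V \<inter> A = {} \<and> E \<subseteq> insert w V \<times> insert r V \<and> {z. (w, z) \<in> E} = {u} \<and> {z. (z, r) \<in> E} = {p} \<and> chn (V, E, L) w u End r p V"
      by (intro exI[of _ "{(w, r)}"] exI[of _ "\<lambda>_. 0"] exI[of _ r] exI[of _ w] exI[of _ "{}"]) (auto intro!: chn_End)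
  qed
next
  case (Chn a c)
  show ?case
  proof (intro allI impI)
    fix A :: "nat set" and w r :: nat assume A: "finite A" "w \<in> A" "r \<in> A" "w \<noteq> r"
    have wf: "wft a" "wfc c" using Chn.prems by auto
    obtain u where u: "u \<notin> A" using fresh A by blast
    have B: "finite (insert u A)" "u \<in> insert u A" "r \<in> insert u A" "u \<noteq> r" using A u by auto
    obtain E1 L1 y p V1 where 1: "V1 \<inter> insert u A = {}" "E1 \<subseteq> insert u V1 \<times> insert r V1" "{z. (u, z) \<in> E1} = {y}" "{z. (z, r) \<in> E1} = {p}" "chn (V1, E1, L1) u y c r p V1"
      using Chn.IH(2)[OF wf(2)] B by metis
    have f1: "finite V1" "y \<in> insert r V1" "p \<in> insert u V1" using reps_basic(2)[OF 1(5)] by auto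
    have "finite (insert u A \<union> V1)" using B f1 by auto
    then obtain E2 L2 x V2 where 2: "V2 \<inter> (insert u A \<union> V1) = {}" "E2 \<subseteq> V2 \<times> V2" "\<forall>a. (a, x) \<notin> E2" "reps (V2, E2, L2) x a V2"
      using Chn.IH(1)[OF wf(1)] by metis
    have f2: "finite V2" "x \<in> V2" using reps_basic(1)[OF 2(4)] by auto
    have ni: "u \<notin> V1" "u \<notin> V2" "r \<notin> V1" "r \<notin> V2" "w \<notin> V1" "w \<notin> V2" "u \<noteq> w" "V1 \<inter> V2 = {}" using 1(1) 2(1) A u by auto
    define E where "E = E1 \<union> E2 \<union> {(w, u), (u, x)}"
    define V where "V = insert u (V2 \<union> V1)"
    define L where "L z = (if z \<in> V1 then L1 z else L2 z)" for z
    have c1: "chn (V, E, L) u y c r p V1"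
    proof (rule chn_cong[OF 1(5)])
      show "\<forall>z\<in>V1. out (V, E, L) z = out (V1, E1, L1) z \<and> lab (V, E, L) z = lab (V1, E1, L1) z"
        using 2(2) ni by (auto simp: E_def L_def)
      show "\<forall>z\<in>V1. par (V, E, L) z = par (V1, E1, L1) z"
        using 2(2) ni f2 by (auto simp: E_def)
    qed
    have c2: "reps (V, E, L) x a V2"
    proof (rule reps_cong[OF 2(4)])
      show "\<forall>z\<in>V2. out (V, E, L) z = out (V2, E2, L2) z \<and> lab (V, E, L) z = lab (V2, E2, L2) z"
        using 1(2) ni by (auto simp: E_def L_def)
      show "\<forall>z\<in>V2 - {x}. par (V, E, L) z = par (V2, E2, L2) z"
        using 1(2) ni f2 by (auto simp: E_def)
    qed
    have "(u, z) \<in> E \<longleftrightarrow> z = x \<or> z = y" for z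
      using 1(3) 2(2) ni by (auto simp: E_def)
    then have o: "out (V, E, L) u = {x, y}" by auto
    have pu: "par (V, E, L) u = {w}" using 1(2) 2(2) ni f2 B(4) by (auto simp: E_def)
    have px: "par (V, E, L) x = {u}" using 1(2) 2(2,3) ni f2 B(4) by (auto simp: E_def)
    have xy: "x \<noteq> y" using f1(2) f2(2) ni by auto
    have "chn (V, E, L) w u (Chn a c) r p V"
      by (rule chn_Chn[OF o xy pu px c2 c1]) (use ni B(4) V_def in auto)
    moreover have "V \<inter> A = {}" using 1(1) 2(1) u by (auto simp: V_def)
    moreover have "E \<subseteq> insert w V \<times> insert r V" using 1(2) 2(2) f2 unfolding V_def E_def by blast
    moreover have "{z. (w, z) \<in> E} = {u}" using 1(2) 2(2) ni by (auto simp: E_def)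
    moreover have "{z. (z, r) \<in> E} = {p}"
    proof -
      have "(z, r) \<in> E \<longleftrightarrow> (z, r) \<in> E1" for z using 2(2) ni f2 B(4) by (auto simp: E_def)
      then show ?thesis using 1(4) by simp
    qed
    ultimately show "\<exists>E L u p V. V \<inter> A = {} \<and> E \<subseteq> insert w V \<times> insert r V \<and> {z. (w, z) \<in> E} = {u} \<and> {z. (z, r) \<in> E} = {p} \<and> chn (V, E, L) w u (Chn a c) r p V"
      by blast
  qed
qed

corollary realize_galled:
  assumes "wft t" "\<And>l. t \<noteq> Leaf l"
  obtains N v where "galled_tree N" "reps N v t (nodes N)" "par N v = {}"
proof -
  obtain E L v V where 1: "E \<subseteq> V \<times> V" "\<forall>a. (a, v) \<notin> E" "reps (V, E, L) v t V"
    using realize(1)[OF assms(1)] by (metis finite.emptyI)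
  have 2: "reps (V, E, L) v t (nodes (V, E, L))" "arcs (V, E, L) \<subseteq> nodes (V, E, L) \<times> nodes (V, E, L)" "par (V, E, L) v = {}"
    using 1 by (auto simp: nodes_def arcs_def)
  have "galled_tree (V, E, L)" by (rule galled_tree_of_reps[OF 2(1,3,2) assms(2)])
  then show ?thesis using that 2 by blast
qed

section \<open>Counting isomorphism classes\<close>

definition terms :: "nat \<Rightarrow> nat gt set" where
  "terms n = {t. wft t \<and> distinct (labs t) \<and> set (labs t) = {1..n}}"

definition root_terms :: "net \<Rightarrow> nat gt set" where
  "root_terms N = {t. reps N (the_root N) t (nodes N)}"

lemma (in galled) the_root_eqI:
  assumes "v \<in> nodes N" "par N v = {}" shows "v = the_root N"
  using assms ph theI'[of "\<lambda>r. r \<in> nodes N \<and> indeg N r = 0"]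
  unfolding the_root_def phylo_network_def by (metis (no_types, lifting) card.empty indeg_par)

lemma LGT_galled: "N \<in> LGT n \<Longrightarrow> galled N" by (simp add: LGT_def galled_def)

lemma root_terms_LGT:
  assumes "N \<in> LGT n"
  shows "root_terms N \<noteq> {}" "root_terms N \<subseteq> terms n" "t \<in> root_terms N \<Longrightarrow> root_terms N = orb t"
proof -
  interpret galled N by (rule LGT_galled[OF assms])
  show "root_terms N \<noteq> {}" using root_reps(1) by (auto simp: root_terms_def)
  show "root_terms N \<subseteq> terms n"
  proof
    fix t assume "t \<in> root_terms N"
    then have t: "reps N (the_root N) t (nodes N)" by (simp add: root_terms_def)
    show "t \<in> terms n" using labeled_iff[OF t, of n] assms reps_wf(1)[OF t] by (simp add: terms_def LGT_def)
  qed
  show "root_terms N = orb t" if "t \<in> root_terms N"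
    using reps_orbit that by (auto simp: root_terms_def)
qed

lemma net_iso_iff:
  assumes N: "N \<in> LGT n" and M: "M \<in> LGT n"
  shows "net_iso N M \<longleftrightarrow> root_terms N = root_terms M"
proof
  assume iso: "net_iso N M"
  interpret N: galled N by (rule LGT_galled[OF N])
  interpret M: galled M by (rule LGT_galled[OF M])
  obtain t where t: "reps N (the_root N) t (nodes N)" using N.root_reps(1) by blast
  obtain v where v: "reps M v t (nodes M)" "par M v = {}"
    using reps_net_iso[OF t iso N.A M.A _ N.root_reps(2)] N.out_empty_leaf by blast
  have "v = the_root M" using M.the_root_eqI[OF _ v(2)] reps_basic(1)[OF v(1)] by blast
  then have "t \<in> root_terms N" "t \<in> root_terms M" using t v by (auto simp: root_terms_def)
  then show "root_terms N = root_terms M" using root_terms_LGT(3)[OF N] root_terms_LGT(3)[OF M] by blast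
next
  assume "root_terms N = root_terms M"
  then obtain t where "t \<in> root_terms N" "t \<in> root_terms M" using root_terms_LGT(1)[OF N] by blast
  then show "net_iso N M" using net_iso_of_reps by (auto simp: root_terms_def)
qed

lemma terms_realized:
  assumes "t \<in> terms n" "n \<noteq> 1"
  shows "\<exists>N\<in>LGT n. t \<in> root_terms N"
proof -
  have "t \<noteq> Leaf l" for l
  proof
    assume "t = Leaf l"
    then have "{l} = {1..n}" using assms by (simp add: terms_def)
    then have "card {1..n} = 1" by (metis card.empty card.insert empty_iff finite.emptyI One_nat_def)
    then show False using assms(2) by simp
  qed
  moreover have "wft t" using assms by (simp add: terms_def)
  ultimately obtain N v where N: "galled_tree N" "reps N v t (nodes N)" "par N v = {}"
    using realize_galled[of t] by metis
  interpret galled N using N by unfold_locales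
  have v: "v = the_root N" using the_root_eqI N reps_basic(1) by blast
  then have "labeled n N" using labeled_iff N assms by (simp add: terms_def)
  then have "N \<in> LGT n" "t \<in> root_terms N" using N v by (simp_all add: LGT_def root_terms_def)
  then show ?thesis by blast
qed

definition class_of :: "nat \<Rightarrow> nat gt \<Rightarrow> net set" where
  "class_of n t = {M \<in> LGT n. t \<in> root_terms M}"

lemma LGT_classes_eq:
  assumes "n \<noteq> 1" shows "LGT_classes n = class_of n ` terms n"
proof -
  let ?R = "{(N1, N2). N1 \<in> LGT n \<and> N2 \<in> LGT n \<and> net_iso N1 N2}"
  have cl: "?R `` {N} = class_of n t" if N: "N \<in> LGT n" and t: "t \<in> root_terms N" for N t
  proof (intro equalityI subsetI)
    fix M assume "M \<in> ?R `` {N}"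
    then have M: "M \<in> LGT n" "net_iso N M" by auto
    then show "M \<in> class_of n t" using net_iso_iff[OF N M(1)] t by (auto simp: class_of_def)
  next
    fix M assume "M \<in> class_of n t"
    then have M: "M \<in> LGT n" "t \<in> root_terms M" by (auto simp: class_of_def)
    then have "root_terms N = root_terms M" using root_terms_LGT(3)[OF N t] root_terms_LGT(3)[OF M] by simp
    then show "M \<in> ?R `` {N}" using net_iso_iff[OF N M(1)] M N by simp
  qed
  show ?thesis
  proof (intro equalityI subsetI)
    fix C assume "C \<in> LGT_classes n"
    then obtain N where N: "N \<in> LGT n" "C = ?R `` {N}" by (auto simp: LGT_classes_def quotient_def)
    obtain t where t: "t \<in> root_terms N" using root_terms_LGT(1)[OF N(1)] by blast
    then show "C \<in> class_of n ` terms n" using cl[OF N(1) t] N root_terms_LGT(2)[OF N(1)] by blast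
  next
    fix C assume "C \<in> class_of n ` terms n"
    then obtain t where t: "t \<in> terms n" "C = class_of n t" by auto
    then obtain N where N: "N \<in> LGT n" "t \<in> root_terms N" using terms_realized assms by blast
    show "C \<in> LGT_classes n" unfolding LGT_classes_def t(2) cl[OF N, symmetric] by (rule quotientI[OF N(1)])
  qed
qed

lemma class_of_fibre:
  assumes "n \<noteq> 1" "t0 \<in> terms n"
  shows "{t \<in> terms n. class_of n t = class_of n t0} = orb t0"
proof -
  obtain N where N: "N \<in> LGT n" "t0 \<in> root_terms N" using terms_realized assms by blast
  have o: "root_terms N = orb t0" using root_terms_LGT(3)[OF N] .
  show ?thesis
  proof (intro equalityI subsetI)
    fix t assume "t \<in> {t \<in> terms n. class_of n t = class_of n t0}"
    then have "N \<in> class_of n t" using N by (auto simp: class_of_def)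
    then show "t \<in> orb t0" using o by (simp add: class_of_def)
  next
    fix t assume t: "t \<in> orb t0"
    then have "t \<in> root_terms N" using o by simp
    then have 1: "t \<in> terms n" "orb t = orb t0" using root_terms_LGT(2,3)[OF N(1)] o by auto
    have "t \<in> root_terms M \<longleftrightarrow> t0 \<in> root_terms M" if "M \<in> LGT n" for M
      using root_terms_LGT(3)[OF that, of t] root_terms_LGT(3)[OF that, of t0] 1 orb_refl by metis
    then show "t \<in> {t \<in> terms n. class_of n t = class_of n t0}" using 1 by (auto simp: class_of_def)
  qed
qed

lemma sum_LGT_classes:
  fixes f :: "net \<Rightarrow> nat" and g :: "nat gt \<Rightarrow> nat"
  assumes "n \<noteq> 1" "finite (terms n)" and fg: "\<And>N t. N \<in> LGT n \<Longrightarrow> t \<in> root_terms N \<Longrightarrow> f N = g t"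
  shows "(\<Sum>C\<in>LGT_classes n. real (the_elem (f ` C))) = (\<Sum>t\<in>terms n. real (g t) / 2 ^ kn t)"
proof -
  have "(\<Sum>t\<in>terms n. real (g t) / 2 ^ kn t) =
      (\<Sum>C\<in>class_of n ` terms n. \<Sum>t\<in>{t \<in> terms n. class_of n t = C}. real (g t) / 2 ^ kn t)"
    by (rule sum.image_gen[OF assms(2)])
  also have "\<dots> = (\<Sum>C\<in>class_of n ` terms n. real (the_elem (f ` C)))"
  proof (rule sum.cong[OF refl])
    fix C assume "C \<in> class_of n ` terms n"
    then obtain t0 where t0: "t0 \<in> terms n" "C = class_of n t0" by auto
    obtain N where N: "N \<in> LGT n" "t0 \<in> root_terms N" using terms_realized assms(1) t0(1) by blast
    have fM: "f M = g t0" if "M \<in> C" for M using that t0 fg by (simp add: class_of_def)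
    have NC: "N \<in> C" using N t0 by (simp add: class_of_def)
    have "f ` C \<subseteq> {g t0}" using fM by blast
    moreover have "g t0 \<in> f ` C" using NC fM[OF NC] by (metis imageI)
    ultimately have "f ` C = {g t0}" by blast
    then have el: "the_elem (f ` C) = g t0" by simp
    have o: "root_terms N = orb t0" using root_terms_LGT(3)[OF N] .
    have "g t = g t0" if "t \<in> orb t0" for t using fg[OF N(1)] that o N(2) by metis
    then have "(\<Sum>t\<in>orb t0. real (g t) / 2 ^ kn t) = (\<Sum>t\<in>orb t0. real (g t0) / 2 ^ kn t0)"
      using orb_inv(1) by (intro sum.cong) auto
    also have "\<dots> = real (g t0)" using card_orb(1)[of t0] t0(1) by (simp add: terms_def)
    finally show "(\<Sum>t\<in>{t \<in> terms n. class_of n t = C}. real (g t) / 2 ^ kn t) = real (the_elem (f ` C))"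
      using class_of_fibre[OF assms(1) t0(1)] t0(2) el by simp
  qed
  finally show ?thesis using LGT_classes_eq[OF assms(1)] by simp
qed

lemma card_LGT_classes:
  assumes "n \<noteq> 1" "finite (terms n)"
  shows "real (card (LGT_classes n)) = (\<Sum>t\<in>terms n. 1 / 2 ^ kn t)"
proof -
  have "(\<Sum>C\<in>LGT_classes n. real (the_elem ((\<lambda>_. 1::nat) ` C))) = (\<Sum>t\<in>terms n. real 1 / 2 ^ kn t)"
    by (rule sum_LGT_classes[OF assms]) simp
  moreover have "(\<Sum>C\<in>LGT_classes n. real (the_elem ((\<lambda>_. 1::nat) ` C))) = (\<Sum>C\<in>LGT_classes n. 1)"
  proof (rule sum.cong[OF refl])
    fix C assume "C \<in> LGT_classes n"
    then obtain t0 where t0: "t0 \<in> terms n" "C = class_of n t0" using LGT_classes_eq[OF assms(1)] by auto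
    obtain N where N: "N \<in> LGT n" "t0 \<in> root_terms N" using terms_realized assms(1) t0(1) by blast
    then have "N \<in> C" using t0 by (simp add: class_of_def)
    then have "C \<noteq> {}" by blast
    then show "real (the_elem ((\<lambda>_. 1::nat) ` C)) = 1" by (simp add: image_constant_conv)
  qed
  ultimately show ?thesis by simp
qed

abbreviation shape :: "'a gt \<Rightarrow> unit gt" where "shape \<equiv> map_gt (\<lambda>_. ())"
abbreviation shapec :: "'a ch \<Rightarrow> unit ch" where "shapec \<equiv> map_ch (\<lambda>_. ())"

abbreviation gsize :: "'a gt \<Rightarrow> nat" where "gsize t \<equiv> length (labs t)"
abbreviation csize :: "'a ch \<Rightarrow> nat" where "csize c \<equiv> length (labc c)"

definition shapes :: "nat \<Rightarrow> unit gt set" where "shapes n = {s. wft s \<and> gsize s = n}"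
definition cshapes :: "nat \<Rightarrow> unit ch set" where "cshapes n = {c. wfc c \<and> csize c = n}"

lemma gsize_pos: "gsize t > 0" using labs_nonempty by blast

lemma finite_shapes: "finite (shapes n) \<and> finite (cshapes n)"
proof (induction n rule: less_induct)
  case (less n)
  define A where "A = (\<Union>m<n. shapes m)"
  define B where "B = (\<Union>m<n. cshapes m)"
  have f: "finite A" "finite B" using less by (auto simp: A_def B_def)
  have "shapes n \<subseteq> {Leaf ()} \<union> (\<lambda>(a, b). Node a b) ` (A \<times> A) \<union> (\<lambda>(c, d, t). Gall c d t) ` (B \<times> B \<times> A)"
  proof
    fix s assume s: "s \<in> shapes n"
    show "s \<in> {Leaf ()} \<union> (\<lambda>(a, b). Node a b) ` (A \<times> A) \<union> (\<lambda>(c, d, t). Gall c d t) ` (B \<times> B \<times> A)"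
    proof (cases s)
      case (Node a b)
      then have "a \<in> A" "b \<in> A" using s gsize_pos[of a] gsize_pos[of b] by (auto simp: A_def shapes_def)
      then show ?thesis using Node by auto
    next
      case (Gall c d t)
      have "csize c > 0 \<or> csize d > 0" using s Gall labc_empty[of c] labc_empty[of d] by (auto simp: shapes_def)
      then have "c \<in> B" "d \<in> B" "t \<in> A" using s Gall gsize_pos[of t] by (auto simp: A_def B_def shapes_def cshapes_def)
      then show ?thesis using Gall by (auto simp: image_iff)
    qed auto
  qed
  moreover have "finite ({Leaf ()} \<union> (\<lambda>(a, b). Node a b) ` (A \<times> A) \<union> (\<lambda>(c, d, t). Gall c d t) ` (B \<times> B \<times> A))"
    using f by simp
  ultimately have 1: "finite (shapes n)" by (rule finite_subset)
  have "cshapes n \<subseteq> {End} \<union> (\<lambda>(a, c). Chn a c) ` ((A \<union> shapes n) \<times> B)"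
  proof
    fix s assume s: "s \<in> cshapes n"
    show "s \<in> {End} \<union> (\<lambda>(a, c). Chn a c) ` ((A \<union> shapes n) \<times> B)"
    proof (cases s)
      case (Chn a c)
      then have "a \<in> A \<union> shapes n" "c \<in> B" using s gsize_pos[of a] by (auto simp: A_def B_def shapes_def cshapes_def)
      then show ?thesis using Chn by auto
    qed auto
  qed
  moreover have "finite ({End} \<union> (\<lambda>(a, c). Chn a c) ` ((A \<union> shapes n) \<times> B))" using f 1 by simp
  ultimately have "finite (cshapes n)" by (rule finite_subset)
  then show ?case using 1 by simp
qed

lemma map_inv:
  fixes t :: "'a gt" and c :: "'a ch"
  shows "labs (map_gt f t) = map f (labs t) \<and> wft (map_gt f t) = wft t \<and> kn (map_gt f t) = kn t \<and> (\<forall>k. sk m k (map_gt f t) = sk m k t)"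
    and "labc (map_ch f c) = map f (labc c) \<and> wfc (map_ch f c) = wfc c \<and> kc (map_ch f c) = kc c \<and> (\<forall>k. skc m k (map_ch f c) = skc m k c)
      \<and> clen (map_ch f c) = clen c \<and> (map_ch f c = End \<longleftrightarrow> c = End)"
  by (induction t and c rule: gt.induct ch.induct) auto

lemma gsize_shape: "gsize (shape t) = gsize t" "csize (shapec c) = csize c"
  by (simp_all add: map_inv)

lemma shape_labs_inj:
  fixes t :: "'a gt" and c :: "'a ch"
  shows "\<forall>t'. shape t = shape t' \<longrightarrow> labs t = labs t' \<longrightarrow> t = t'"
    and "\<forall>c'. shapec c = shapec c' \<longrightarrow> labc c = labc c' \<longrightarrow> c = c'"
proof (induction t and c rule: gt.induct ch.induct)
  case (Leaf l)
  show ?case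
  proof (intro allI impI)
    fix t' :: "'a gt" assume "shape (Leaf l) = shape t'" "labs (Leaf l) = labs t'"
    then show "Leaf l = t'" by (cases t') auto
  qed
next
  case (Node a b)
  show ?case
  proof (intro allI impI)
    fix t' assume *: "shape (Node a b) = shape t'" "labs (Node a b) = labs t'"
    then obtain a' b' where t': "t' = Node a' b'" "shape a = shape a'" "shape b = shape b'" by (cases t') auto
    then have "gsize a = gsize a'" using gsize_shape(1) by metis
    then show "Node a b = t'" using * t' Node by auto
  qed
next
  case (Gall c d t)
  show ?case
  proof (intro allI impI)
    fix t' assume *: "shape (Gall c d t) = shape t'" "labs (Gall c d t) = labs t'"
    then obtain c' d' s' where t': "t' = Gall c' d' s'" "shapec c = shapec c'" "shapec d = shapec d'" "shape t = shape s'" by (cases t') auto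
    then have "csize c = csize c'" "csize d = csize d'" using gsize_shape(2) by metis+
    then show "Gall c d t = t'" using * t' Gall by auto
  qed
next
  case End
  show ?case
  proof (intro allI impI)
    fix c' :: "'a ch" assume "shapec End = shapec c'"
    then show "End = c'" by (cases c') auto
  qed
next
  case (Chn a c)
  show ?case
  proof (intro allI impI)
    fix c' assume *: "shapec (Chn a c) = shapec c'" "labc (Chn a c) = labc c'"
    then obtain a' b' where t': "c' = Chn a' b'" "shape a = shape a'" "shapec c = shapec b'" by (cases c') auto
    then have "gsize a = gsize a'" using gsize_shape(1) by metis
    then show "Chn a c = c'" using * t' Chn by auto
  qed
qed

lemma shape_labs_surj:
  fixes s :: "unit gt" and c :: "unit ch"
  shows "\<forall>xs. length xs = gsize s \<longrightarrow> (\<exists>t. shape t = s \<and> labs t = (xs :: 'a list))"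
    and "\<forall>xs. length xs = csize c \<longrightarrow> (\<exists>t. shapec t = c \<and> labc t = (xs :: 'a list))"
proof (induction s and c rule: gt.induct ch.induct)
  case (Leaf l)
  show ?case
  proof (intro allI impI)
    fix xs :: "'a list" assume "length xs = gsize (Leaf l)"
    then obtain x where "xs = [x]" by (auto simp: length_Suc_conv)
    then show "\<exists>t. shape t = Leaf l \<and> labs t = xs" by (intro exI[of _ "Leaf x"]) auto
  qed
next
  case (Node a b)
  show ?case
  proof (intro allI impI)
    fix xs :: "'a list" assume l: "length xs = gsize (Node a b)"
    obtain a' where a': "shape a' = a" "labs a' = take (gsize a) xs" using Node(1) l by (metis gt.map_comp length_take labs.simps(2) length_append le_add1 min_absorb2)
    obtain b' where b': "shape b' = b" "labs b' = drop (gsize a) xs" using Node(2) l by (metis length_drop labs.simps(2) length_append add_diff_cancel_left')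
    show "\<exists>t. shape t = Node a b \<and> labs t = xs" using a' b' by (intro exI[of _ "Node a' b'"]) auto
  qed
next
  case (Gall c d s)
  show ?case
  proof (intro allI impI)
    fix xs :: "'a list" assume l: "length xs = gsize (Gall c d s)"
    have "length (take (csize c) xs) = csize c" "length (take (csize d) (drop (csize c) xs)) = csize d"
      "length (drop (csize d) (drop (csize c) xs)) = gsize s" using l by auto
    then obtain c' d' s' where "shapec c' = c" "labc c' = take (csize c) xs" "shapec d' = d" "labc d' = take (csize d) (drop (csize c) xs)"
      "shape s' = s" "labs s' = drop (csize d) (drop (csize c) xs)" using Gall by metis
    then show "\<exists>t. shape t = Gall c d s \<and> labs t = xs"
      by (intro exI[of _ "Gall c' d' s'"]) (simp del: drop_drop)
  qed
next
  case End
  show ?case by (auto intro: exI[of _ End])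
next
  case (Chn a c)
  show ?case
  proof (intro allI impI)
    fix xs :: "'a list" assume l: "length xs = csize (Chn a c)"
    have "length (take (gsize a) xs) = gsize a" "length (drop (gsize a) xs) = csize c" using l by auto
    then obtain a' c' where "shape a' = a" "labs a' = take (gsize a) xs" "shapec c' = c" "labc c' = drop (gsize a) xs" using Chn by metis
    then show "\<exists>t. shapec t = Chn a c \<and> labc t = xs" by (intro exI[of _ "Chn a' c'"]) auto
  qed
qed

lemma terms_bij:
  "bij_betw (\<lambda>t. (shape t, labs t)) (terms n) (shapes n \<times> permutations_of_set {1..n})"
  unfolding bij_betw_def
proof
  show "inj_on (\<lambda>t. (shape t, labs t)) (terms n)" using shape_labs_inj(1) by (auto simp: inj_on_def)
  show "(\<lambda>t. (shape t, labs t)) ` terms n = shapes n \<times> permutations_of_set {1..n}"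
  proof (intro equalityI subsetI)
    fix p assume "p \<in> (\<lambda>t. (shape t, labs t)) ` terms n"
    then obtain t where t: "t \<in> terms n" "p = (shape t, labs t)" by auto
    then have "gsize t = n" by (auto simp: terms_def dest: distinct_card)
    then show "p \<in> shapes n \<times> permutations_of_set {1..n}" using t by (auto simp: shapes_def terms_def map_inv permutations_of_set_def)
  next
    fix p assume "p \<in> shapes n \<times> permutations_of_set {1..n}"
    then obtain s xs where p: "p = (s, xs)" "wft s" "gsize s = n" "set xs = {1..n}" "distinct xs"
      by (auto simp: shapes_def permutations_of_set_def)
    then have "length xs = gsize s" using distinct_card[of xs] by simp
    then obtain t where t: "shape t = s" "labs t = xs" using shape_labs_surj(1) by blast
    have "wft t" using p(2) t(1) map_inv(1) by metis
    then have "t \<in> terms n" using t p by (simp add: terms_def)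
    then show "p \<in> (\<lambda>t. (shape t, labs t)) ` terms n" using t p by force
  qed
qed

lemma finite_terms: "finite (terms n)"
  using bij_betw_finite[OF terms_bij, of n] finite_shapes[of n] by simp

lemma sum_terms:
  fixes F :: "unit gt \<Rightarrow> real"
  shows "(\<Sum>t\<in>terms n. F (shape t)) = fact n * (\<Sum>s\<in>shapes n. F s)"
proof -
  have "(\<Sum>t\<in>terms n. F (shape t)) = (\<Sum>p\<in>shapes n \<times> permutations_of_set {1..n}. F (fst p))"
    using sum.reindex_bij_betw[OF terms_bij, of "\<lambda>p. F (fst p)" n] by simp
  also have "\<dots> = (\<Sum>s\<in>shapes n. \<Sum>p\<in>permutations_of_set {1..n}. F s)"
    unfolding sum.cartesian_product by (rule sum.cong) auto
  also have "\<dots> = fact n * (\<Sum>s\<in>shapes n. F s)" by (simp add: sum_distrib_left)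
  finally show ?thesis .
qed

theorem uniform_LGT_expectation_shapes:
  assumes "n \<noteq> 1" and f: "f = sackin_max \<and> m = max \<or> f = sackin_min \<and> m = min"
  shows "uniform_LGT_expectation f n =
    (\<Sum>s\<in>shapes n. real (sk m 0 s) / 2 ^ kn s) / (\<Sum>s\<in>shapes n. 1 / 2 ^ kn s)"
proof -
  have "f N = sk m 0 t" if "N \<in> LGT n" "t \<in> root_terms N" for N t
    using galled.sackin_sk[OF LGT_galled[OF that(1)]] that(2) f by (auto simp: root_terms_def)
  then have "(\<Sum>C\<in>LGT_classes n. real (the_elem (f ` C))) = (\<Sum>t\<in>terms n. real (sk m 0 t) / 2 ^ kn t)"
    by (rule sum_LGT_classes[OF assms(1) finite_terms])
  also have "\<dots> = fact n * (\<Sum>s\<in>shapes n. real (sk m 0 s) / 2 ^ kn s)"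
    using sum_terms[of "\<lambda>s. real (sk m 0 s) / 2 ^ kn s" n] by (simp add: map_inv)
  finally have 1: "(\<Sum>C\<in>LGT_classes n. real (the_elem (f ` C))) = fact n * (\<Sum>s\<in>shapes n. real (sk m 0 s) / 2 ^ kn s)" .
  have "real (card (LGT_classes n)) = fact n * (\<Sum>s\<in>shapes n. 1 / 2 ^ kn s)"
    using card_LGT_classes[OF assms(1) finite_terms] sum_terms[of "\<lambda>s. 1 / 2 ^ kn s" n] by (simp add: map_inv)
  then show ?thesis using 1 by (simp add: uniform_LGT_expectation_def)
qed

section \<open>Generating functions\<close>

unbundle fps_syntax
unbundle no vec_syntax

definition fib :: "'b set \<Rightarrow> ('b \<Rightarrow> nat) \<Rightarrow> bool" where
  "fib S sz \<longleftrightarrow> (\<forall>n. finite {x\<in>S. sz x = n})"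

definition gf :: "'b set \<Rightarrow> ('b \<Rightarrow> nat) \<Rightarrow> ('b \<Rightarrow> real) \<Rightarrow> real fps" where
  "gf S sz w = Abs_fps (\<lambda>n. \<Sum>x\<in>{x\<in>S. sz x = n}. w x)"

lemma gf_nth: "gf S sz w $ n = (\<Sum>x\<in>{x\<in>S. sz x = n}. w x)" by (simp add: gf_def)

lemma gf_cong: "(\<And>x. x \<in> S \<Longrightarrow> w x = w' x) \<Longrightarrow> gf S sz w = gf S sz w'"
  by (rule fps_ext) (auto simp: gf_nth intro: sum.cong)

lemma gf_add: "gf S sz (\<lambda>x. w x + w' x) = gf S sz w + gf S sz w'"
  by (rule fps_ext) (simp add: gf_nth sum.distrib)

lemma gf_cmult: "gf S sz (\<lambda>x. c * w x) = fps_const c * gf S sz w"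
  by (rule fps_ext) (simp add: gf_nth sum_distrib_left)

lemma gf_size: "gf S sz (\<lambda>x. w x * real (sz x)) = fps_X * fps_deriv (gf S sz w)"
proof (rule fps_ext)
  fix n
  have "gf S sz (\<lambda>x. w x * real (sz x)) $ n = real n * gf S sz w $ n"
    unfolding gf_nth sum_distrib_left by (rule sum.cong) auto
  also have "\<dots> = (fps_X * fps_deriv (gf S sz w)) $ n" by (cases n) auto
  finally show "gf S sz (\<lambda>x. w x * real (sz x)) $ n = (fps_X * fps_deriv (gf S sz w)) $ n" .
qed

lemma gf_Un:
  assumes "fib S sz" "fib T sz" "S \<inter> T = {}"
  shows "gf (S \<union> T) sz w = gf S sz w + gf T sz w"
proof (rule fps_ext)
  fix n
  have "{x\<in>S \<union> T. sz x = n} = {x\<in>S. sz x = n} \<union> {x\<in>T. sz x = n}" by auto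
  then show "gf (S \<union> T) sz w $ n = (gf S sz w + gf T sz w) $ n"
    using assms by (simp add: gf_nth fib_def) (rule sum.union_disjoint, auto)
qed

lemma gf_image:
  assumes "inj_on f S" "\<And>x. x \<in> S \<Longrightarrow> sz' (f x) = sz x"
  shows "gf (f ` S) sz' w = gf S sz (\<lambda>x. w (f x))"
proof (rule fps_ext)
  fix n
  have "{y\<in>f ` S. sz' y = n} = f ` {x\<in>S. sz x = n}" using assms(2) by auto
  moreover have "inj_on f {x\<in>S. sz x = n}" using assms(1) by (rule inj_on_subset) auto
  ultimately show "gf (f ` S) sz' w $ n = gf S sz (\<lambda>x. w (f x)) $ n" by (simp add: gf_nth sum.reindex)
qed

lemma fib_image: "fib S sz \<Longrightarrow> (\<And>x. x \<in> S \<Longrightarrow> sz' (f x) = sz x) \<Longrightarrow> fib (f ` S) sz'"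
proof -
  assume *: "fib S sz" "\<And>x. x \<in> S \<Longrightarrow> sz' (f x) = sz x"
  have "{y\<in>f ` S. sz' y = n} = f ` {x\<in>S. sz x = n}" for n using *(2) by auto
  then show ?thesis using *(1) by (simp add: fib_def)
qed

abbreviation psz :: "('b \<Rightarrow> nat) \<Rightarrow> ('c \<Rightarrow> nat) \<Rightarrow> 'b \<times> 'c \<Rightarrow> nat" where
  "psz f g \<equiv> (\<lambda>p. f (fst p) + g (snd p))"

lemma prod_fibre:
  "{p\<in>S \<times> T. psz f g p = n} = (\<Union>i\<in>{0..n}. {x\<in>S. f x = i} \<times> {y\<in>T. g y = n - i})"
  by auto

lemma fib_prod: "fib S f \<Longrightarrow> fib T g \<Longrightarrow> fib (S \<times> T) (psz f g)"
  unfolding fib_def prod_fibre by auto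

lemma gf_prod:
  assumes "fib S f" "fib T g"
  shows "gf (S \<times> T) (psz f g) (\<lambda>p. w (fst p) * w' (snd p)) = gf S f w * gf T g w'"
proof (rule fps_ext)
  fix n
  have "gf (S \<times> T) (psz f g) (\<lambda>p. w (fst p) * w' (snd p)) $ n =
     (\<Sum>i\<in>{0..n}. \<Sum>p\<in>{x\<in>S. f x = i} \<times> {y\<in>T. g y = n - i}. w (fst p) * w' (snd p))"
    unfolding gf_nth prod_fibre using assms by (intro sum.UNION_disjoint) (auto simp: fib_def)
  also have "\<dots> = (\<Sum>i\<in>{0..n}. (\<Sum>x\<in>{x\<in>S. f x = i}. w x) * (\<Sum>y\<in>{y\<in>T. g y = n - i}. w' y))"
    by (simp add: sum_product sum.cartesian_product split_beta)
  also have "\<dots> = (gf S f w * gf T g w') $ n" by (simp add: fps_mult_nth gf_nth)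
  finally show "gf (S \<times> T) (psz f g) (\<lambda>p. w (fst p) * w' (snd p)) $ n = (gf S f w * gf T g w') $ n" .
qed

lemma gf_single0: "sz a = 0 \<Longrightarrow> gf {a} sz w = fps_const (w a)"
  by (rule fps_ext) (auto simp: gf_nth intro!: sum.neutral simp: Collect_conv_if)

lemma gf_single1: "sz a = 1 \<Longrightarrow> gf {a} sz w = fps_const (w a) * fps_X"
  by (rule fps_ext) (auto simp: gf_nth fps_X_def Collect_conv_if)

lemma fib_finite: "finite S \<Longrightarrow> fib S sz" by (simp add: fib_def)
lemma fib_subset: "fib S sz \<Longrightarrow> T \<subseteq> S \<Longrightarrow> fib T sz"
proof -
  assume *: "fib S sz" "T \<subseteq> S"
  have "{x\<in>T. sz x = n} \<subseteq> {x\<in>S. sz x = n}" for n using *(2) by auto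
  then show ?thesis using *(1) unfolding fib_def using finite_subset by blast
qed

definition WT :: "unit gt set" where "WT = Collect wft"
definition WC :: "unit ch set" where "WC = Collect wfc"

lemma fib_WT: "fib WT gsize" and fib_WC: "fib WC csize"
  using finite_shapes by (auto simp: fib_def WT_def WC_def shapes_def cshapes_def)

definition wt :: "unit gt \<Rightarrow> real" where "wt s = 1 / 2 ^ kn s"
definition wc :: "unit ch \<Rightarrow> real" where "wc c = 1 / 2 ^ kc c"

definition Tg :: "real fps" where "Tg = gf WT gsize wt"
definition Cg :: "real fps" where "Cg = gf WC csize wc"
definition Hg :: "(nat \<Rightarrow> nat \<Rightarrow> nat) \<Rightarrow> real fps" where "Hg m = gf WT gsize (\<lambda>s. wt s * real (sk m 0 s))"
definition Sg :: "(nat \<Rightarrow> nat \<Rightarrow> nat) \<Rightarrow> real fps" where "Sg m = gf WC csize (\<lambda>c. wc c * real (skc m 0 c))"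
definition Lg :: "real fps" where "Lg = gf WC csize (\<lambda>c. wc c * real (clen c))"
definition Mg :: "(nat \<Rightarrow> nat \<Rightarrow> nat) \<Rightarrow> real fps" where
  "Mg m = gf (WC \<times> WC) (psz csize csize) (\<lambda>p. wc (fst p) * wc (snd p) * real (m (clen (fst p)) (clen (snd p))))"

lemma sk_shift:
  fixes t :: "'a gt" and c :: "'a ch"
  shows "\<forall>k. sk m k t = sk m 0 t + k * gsize t" and "\<forall>k. skc m k c = skc m 0 c + k * csize c"
proof (induction t and c rule: gt.induct ch.induct)
  case (Node a b)
  have "sk m (Suc k) a = sk m 0 a + Suc k * gsize a" "sk m (Suc k) b = sk m 0 b + Suc k * gsize b" for k
    using Node by blast+
  then show ?case by (simp add: algebra_simps)
next
  case (Gall c d t)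
  have "skc m (Suc k) c = skc m 0 c + Suc k * csize c" "skc m (Suc k) d = skc m 0 d + Suc k * csize d"
    "sk m (k + m (clen c) (clen d) + 2) t = sk m 0 t + (k + m (clen c) (clen d) + 2) * gsize t" for k
    using Gall by blast+
  note e = this
  show ?case
  proof
    fix k
    show "sk m k (Gall c d t) = sk m 0 (Gall c d t) + k * gsize (Gall c d t)"
      by (simp only: sk.simps e labs.simps length_append) (simp add: algebra_simps)
  qed
next
  case (Chn a c)
  have "sk m (Suc k) a = sk m 0 a + Suc k * gsize a" "skc m (Suc k) c = skc m 0 c + Suc k * csize c" for k
    using Chn by blast+
  then show ?case by (simp add: algebra_simps)
qed auto

lemma sk_Node: "sk m 0 (Node a b) = sk m 0 a + gsize a + (sk m 0 b + gsize b)"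
proof -
  have "sk m (Suc 0) a = sk m 0 a + Suc 0 * gsize a" "sk m (Suc 0) b = sk m 0 b + Suc 0 * gsize b"
    using sk_shift by blast+
  then show ?thesis by simp
qed

lemma sk_Gall: "sk m 0 (Gall c d t) = (skc m 0 c + csize c) + (skc m 0 d + csize d) + sk m 0 t + (m (clen c) (clen d) + 2) * gsize t"
proof -
  have "sk m (0 + m (clen c) (clen d) + 2) t = sk m 0 t + (0 + m (clen c) (clen d) + 2) * gsize t"
    "skc m (Suc 0) c = skc m 0 c + Suc 0 * csize c" "skc m (Suc 0) d = skc m 0 d + Suc 0 * csize d"
    using sk_shift by blast+
  then show ?thesis by (simp only: sk.simps) simp
qed

lemma skc_Chn: "skc m 0 (Chn a c) = sk m 0 a + gsize a + (skc m 0 c + csize c)"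
proof -
  have "sk m (Suc 0) a = sk m 0 a + Suc 0 * gsize a" "skc m (Suc 0) c = skc m 0 c + Suc 0 * csize c"
    using sk_shift by blast+
  then show ?thesis by simp
qed

lemma WC_decomp: "WC = {End} \<union> (\<lambda>p. Chn (fst p) (snd p)) ` (WT \<times> WC)"
proof (intro equalityI subsetI)
  fix c :: "unit ch" assume "c \<in> WC"
  then show "c \<in> {End} \<union> (\<lambda>p. Chn (fst p) (snd p)) ` (WT \<times> WC)"
    by (cases c) (auto simp: WC_def WT_def image_iff)
qed (auto simp: WC_def WT_def)

lemma WT_decomp: "WT = {Leaf ()} \<union> (\<lambda>p. Node (fst p) (snd p)) ` (WT \<times> WT)
   \<union> (\<lambda>p. Gall (fst (fst p)) (snd (fst p)) (snd p)) ` ((WC \<times> WC - {(End, End)}) \<times> WT)"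
proof (intro equalityI subsetI)
  fix t :: "unit gt" assume "t \<in> WT"
  then show "t \<in> {Leaf ()} \<union> (\<lambda>p. Node (fst p) (snd p)) ` (WT \<times> WT)
   \<union> (\<lambda>p. Gall (fst (fst p)) (snd (fst p)) (snd p)) ` ((WC \<times> WC - {(End, End)}) \<times> WT)"
  proof (cases t)
    case (Gall c d s)
    then have "((c, d), s) \<in> (WC \<times> WC - {(End, End)}) \<times> WT" using \<open>t \<in> WT\<close> by (auto simp: WC_def WT_def)
    then show ?thesis using Gall by (intro UnI2 image_eqI[of _ _ "((c, d), s)"]) auto
  qed (auto simp: WT_def image_iff)
qed (auto simp: WC_def WT_def)

lemma gf_WC:
  "gf WC csize w = fps_const (w End) + gf (WT \<times> WC) (psz gsize csize) (\<lambda>p. w (Chn (fst p) (snd p)))"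
proof -
  have i: "inj_on (\<lambda>p. Chn (fst p) (snd p)) (WT \<times> WC)" by (auto simp: inj_on_def)
  have "gf WC csize w = gf {End} csize w + gf ((\<lambda>p. Chn (fst p) (snd p)) ` (WT \<times> WC)) csize w"
    by (subst (1) WC_decomp, rule gf_Un) (auto intro!: fib_finite fib_image[OF fib_prod[OF fib_WT fib_WC]])
  also have "gf ((\<lambda>p. Chn (fst p) (snd p)) ` (WT \<times> WC)) csize w = gf (WT \<times> WC) (psz gsize csize) (\<lambda>p. w (Chn (fst p) (snd p)))"
    by (rule gf_image[OF i]) auto
  also have "gf {End} csize w = fps_const (w End)" by (rule gf_single0) simp
  finally show ?thesis .
qed

lemma fib_pairs: "fib (WC \<times> WC - {(End, End)}) (psz csize csize)"
  by (rule fib_subset[OF fib_prod[OF fib_WC fib_WC]]) auto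

lemma gf_WT:
  "gf WT gsize w = fps_const (w (Leaf ())) * fps_X + gf (WT \<times> WT) (psz gsize gsize) (\<lambda>p. w (Node (fst p) (snd p)))
    + gf ((WC \<times> WC - {(End, End)}) \<times> WT) (psz (psz csize csize) gsize) (\<lambda>p. w (Gall (fst (fst p)) (snd (fst p)) (snd p)))"
proof -
  let ?A = "(\<lambda>p. Node (fst p) (snd p)) ` (WT \<times> WT)"
  let ?B = "(\<lambda>p. Gall (fst (fst p)) (snd (fst p)) (snd p)) ` ((WC \<times> WC - {(End, End)}) \<times> WT)"
  have fA: "fib ?A gsize" by (rule fib_image[OF fib_prod[OF fib_WT fib_WT]]) auto
  have fB: "fib ?B gsize" by (rule fib_image[OF fib_prod[OF fib_pairs fib_WT]]) auto
  have fL: "fib {Leaf ()} gsize" by (simp add: fib_finite)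
  have fLA: "fib ({Leaf ()} \<union> ?A) gsize" using fL fA by (auto simp: fib_def Collect_disj_eq conj_disj_distribR)
  have "gf WT gsize w = gf ({Leaf ()} \<union> ?A) gsize w + gf ?B gsize w"
    by (subst (1) WT_decomp, rule gf_Un[OF fLA fB]) auto
  also have "gf ({Leaf ()} \<union> ?A) gsize w = gf {Leaf ()} gsize w + gf ?A gsize w"
    by (rule gf_Un[OF fL fA]) auto
  also have "gf {Leaf ()} gsize w = fps_const (w (Leaf ())) * fps_X" by (rule gf_single1) simp
  also have "gf ?A gsize w = gf (WT \<times> WT) (psz gsize gsize) (\<lambda>p. w (Node (fst p) (snd p)))"
    by (rule gf_image) (auto simp: inj_on_def)
  also have "gf ?B gsize w = gf ((WC \<times> WC - {(End, End)}) \<times> WT) (psz (psz csize csize) gsize) (\<lambda>p. w (Gall (fst (fst p)) (snd (fst p)) (snd p)))"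
    by (rule gf_image) (auto simp: inj_on_def)
  finally show ?thesis .
qed

lemma gf_pairs_minus:
  "gf (WC \<times> WC - {(End, End)}) (psz csize csize) w = gf (WC \<times> WC) (psz csize csize) w - fps_const (w (End, End))"
proof -
  have e: "WC \<times> WC = {(End, End)} \<union> (WC \<times> WC - {(End, End)})" by (auto simp: WC_def)
  have "gf (WC \<times> WC) (psz csize csize) w = gf {(End, End)} (psz csize csize) w + gf (WC \<times> WC - {(End, End)}) (psz csize csize) w"
    by (subst (1) e, rule gf_Un) (auto intro: fib_finite fib_pairs)
  also have "gf {(End, End)} (psz csize csize) w = fps_const (w (End, End))" by (rule gf_single0) simp
  finally show ?thesis by simp
qed

lemma Cg_eq: "Cg = 1 + Tg * Cg"
proof -
  have "gf (WT \<times> WC) (psz gsize csize) (\<lambda>p. wc (Chn (fst p) (snd p))) = gf (WT \<times> WC) (psz gsize csize) (\<lambda>p. wt (fst p) * wc (snd p))"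
    by (rule gf_cong) (simp add: wc_def wt_def power_add)
  also have "\<dots> = Tg * Cg" unfolding Tg_def Cg_def by (rule gf_prod[OF fib_WT fib_WC])
  finally show ?thesis using gf_WC[of wc] by (simp add: Cg_def wc_def)
qed

lemma Lg_eq: "Lg = Tg * (Cg + Lg)"
proof -
  have "gf (WT \<times> WC) (psz gsize csize) (\<lambda>p. wc (Chn (fst p) (snd p)) * real (clen (Chn (fst p) (snd p))))
     = gf (WT \<times> WC) (psz gsize csize) (\<lambda>p. wt (fst p) * wc (snd p) + wt (fst p) * (wc (snd p) * real (clen (snd p))))"
    by (rule gf_cong) (simp add: wc_def wt_def power_add field_simps)
  also have "\<dots> = Tg * Cg + Tg * Lg" unfolding gf_add gf_prod[OF fib_WT fib_WC, of wt wc]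
      gf_prod[OF fib_WT fib_WC, of wt "\<lambda>x. wc x * real (clen x)"] Tg_def Cg_def Lg_def ..
  finally show ?thesis using gf_WC[of "\<lambda>c. wc c * real (clen c)"] by (simp add: Lg_def algebra_simps)
qed

lemma size_gf: "gf WT gsize (\<lambda>s. wt s * real (gsize s)) = fps_X * fps_deriv Tg"
   "gf WC csize (\<lambda>s. wc s * real (csize s)) = fps_X * fps_deriv Cg"
  by (simp_all add: gf_size Tg_def Cg_def)

lemma Sg_eq: "Sg m = (Hg m + fps_X * fps_deriv Tg) * Cg + Tg * (Sg m + fps_X * fps_deriv Cg)"
proof -
  have "gf (WT \<times> WC) (psz gsize csize) (\<lambda>p. wc (Chn (fst p) (snd p)) * real (skc m 0 (Chn (fst p) (snd p))))
     = gf (WT \<times> WC) (psz gsize csize) (\<lambda>p. (wt (fst p) * real (sk m 0 (fst p))) * wc (snd p)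
        + (wt (fst p) * real (gsize (fst p))) * wc (snd p)
        + wt (fst p) * (wc (snd p) * real (skc m 0 (snd p)))
        + wt (fst p) * (wc (snd p) * real (csize (snd p))))"
    by (rule gf_cong) (simp add: skc_Chn del: skc.simps, simp add: wc_def wt_def power_add field_simps)
  also have "\<dots> = Hg m * Cg + (fps_X * fps_deriv Tg) * Cg + Tg * Sg m + Tg * (fps_X * fps_deriv Cg)"
    unfolding gf_add gf_prod[OF fib_WT fib_WC, of "\<lambda>x. wt x * real (sk m 0 x)" wc]
      gf_prod[OF fib_WT fib_WC, of "\<lambda>x. wt x * real (gsize x)" wc]
      gf_prod[OF fib_WT fib_WC, of wt "\<lambda>x. wc x * real (skc m 0 x)"]
      gf_prod[OF fib_WT fib_WC, of wt "\<lambda>x. wc x * real (csize x)"] size_gf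
    by (simp add: Tg_def Cg_def Hg_def Sg_def)
  finally show ?thesis using gf_WC[of "\<lambda>c. wc c * real (skc m 0 c)"]
    by (simp add: Sg_def[symmetric] algebra_simps del: skc.simps(2))
qed

abbreviation half :: "real fps" where "half \<equiv> fps_const (1/2)"

lemma wt_Node: "wt (Node a b) = 1/2 * (wt a * wt b)" by (simp add: wt_def power_add)
lemma wt_Gall: "wt (Gall c d t) = 1/2 * (wc c * wc d * wt t)" by (simp add: wt_def wc_def power_add)

lemma Tg_eq: "Tg = fps_X + half * Tg ^ 2 + half * ((Cg ^ 2 - 1) * Tg)"
proof -
  have "gf (WT \<times> WT) (psz gsize gsize) (\<lambda>p. wt (Node (fst p) (snd p))) = half * (Tg * Tg)"
    unfolding wt_Node gf_cmult Tg_def gf_prod[OF fib_WT fib_WT] ..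
  moreover have "gf ((WC \<times> WC - {(End, End)}) \<times> WT) (psz (psz csize csize) gsize) (\<lambda>p. wt (Gall (fst (fst p)) (snd (fst p)) (snd p)))
     = half * ((Cg * Cg - 1) * Tg)"
    unfolding wt_Gall gf_cmult gf_prod[OF fib_pairs fib_WT, of "\<lambda>q. wc (fst q) * wc (snd q)" wt]
      gf_pairs_minus gf_prod[OF fib_WC fib_WC] Tg_def Cg_def by (simp add: wc_def)
  ultimately show ?thesis using gf_WT[of wt] by (simp add: Tg_def[symmetric] power2_eq_square wt_def)
qed

lemma Hg_eq:
  assumes m0: "m 0 0 = 0"
  shows "Hg m = (Hg m + fps_X * fps_deriv Tg) * Tg + (Sg m + fps_X * fps_deriv Cg) * Cg * Tg
    + half * ((Cg ^ 2 - 1) * Hg m) + half * (Mg m * (fps_X * fps_deriv Tg)) + (Cg ^ 2 - 1) * (fps_X * fps_deriv Tg)"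
proof -
  let ?D = "fps_X * fps_deriv Tg" and ?E = "fps_X * fps_deriv Cg"
  have "gf (WT \<times> WT) (psz gsize gsize) (\<lambda>p. wt (Node (fst p) (snd p)) * real (sk m 0 (Node (fst p) (snd p))))
    = gf (WT \<times> WT) (psz gsize gsize) (\<lambda>p. 1/2 * ((wt (fst p) * real (sk m 0 (fst p))) * wt (snd p)
       + (wt (fst p) * real (gsize (fst p))) * wt (snd p)
       + wt (fst p) * (wt (snd p) * real (sk m 0 (snd p))) + wt (fst p) * (wt (snd p) * real (gsize (snd p)))))"
    by (rule gf_cong) (simp add: sk_Node wt_Node field_simps del: sk.simps)
  also have "\<dots> = half * (Hg m * Tg + ?D * Tg + Tg * Hg m + Tg * ?D)"
    unfolding gf_cmult gf_add gf_prod[OF fib_WT fib_WT, of "\<lambda>x. wt x * real (sk m 0 x)" wt]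
      gf_prod[OF fib_WT fib_WT, of "\<lambda>x. wt x * real (gsize x)" wt]
      gf_prod[OF fib_WT fib_WT, of wt "\<lambda>x. wt x * real (sk m 0 x)"]
      gf_prod[OF fib_WT fib_WT, of wt "\<lambda>x. wt x * real (gsize x)"] size_gf
    by (simp add: Tg_def Hg_def)
  finally have N: "gf (WT \<times> WT) (psz gsize gsize) (\<lambda>p. wt (Node (fst p) (snd p)) * real (sk m 0 (Node (fst p) (snd p))))
    = half * (Hg m * Tg + ?D * Tg + Tg * Hg m + Tg * ?D)" .
  let ?P = "WC \<times> WC - {(End, End)}"
  let ?f1 = "\<lambda>q. (wc (fst q) * real (skc m 0 (fst q))) * wc (snd q)"
  let ?f2 = "\<lambda>q. (wc (fst q) * real (csize (fst q))) * wc (snd q)"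
  let ?f3 = "\<lambda>q. wc (fst q) * (wc (snd q) * real (skc m 0 (snd q)))"
  let ?f4 = "\<lambda>q. wc (fst q) * (wc (snd q) * real (csize (snd q)))"
  let ?f5 = "\<lambda>q. wc (fst q) * wc (snd q)"
  let ?f6 = "\<lambda>q. wc (fst q) * wc (snd q) * real (m (clen (fst q)) (clen (snd q)))"
  have "gf (?P \<times> WT) (psz (psz csize csize) gsize) (\<lambda>p. wt (Gall (fst (fst p)) (snd (fst p)) (snd p)) * real (sk m 0 (Gall (fst (fst p)) (snd (fst p)) (snd p))))
    = gf (?P \<times> WT) (psz (psz csize csize) gsize) (\<lambda>p. 1/2 * (
        ?f1 (fst p) * wt (snd p) + ?f2 (fst p) * wt (snd p) + ?f3 (fst p) * wt (snd p) + ?f4 (fst p) * wt (snd p)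
       + ?f5 (fst p) * (wt (snd p) * real (sk m 0 (snd p))) + ?f6 (fst p) * (wt (snd p) * real (gsize (snd p)))
       + 2 * (?f5 (fst p) * (wt (snd p) * real (gsize (snd p))))))"
    by (rule gf_cong) (simp add: sk_Gall wt_Gall field_simps del: sk.simps)
  also have "\<dots> = half * (gf ?P (psz csize csize) ?f1 * Tg + gf ?P (psz csize csize) ?f2 * Tg + gf ?P (psz csize csize) ?f3 * Tg
      + gf ?P (psz csize csize) ?f4 * Tg + gf ?P (psz csize csize) ?f5 * Hg m + gf ?P (psz csize csize) ?f6 * ?D + fps_const 2 * (gf ?P (psz csize csize) ?f5 * ?D))"
    unfolding gf_cmult gf_add gf_prod[OF fib_pairs fib_WT, of ?f1 wt] gf_prod[OF fib_pairs fib_WT, of ?f2 wt]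
      gf_prod[OF fib_pairs fib_WT, of ?f3 wt] gf_prod[OF fib_pairs fib_WT, of ?f4 wt]
      gf_prod[OF fib_pairs fib_WT, of ?f5 "\<lambda>x. wt x * real (sk m 0 x)"]
      gf_prod[OF fib_pairs fib_WT, of ?f6 "\<lambda>x. wt x * real (gsize x)"]
      gf_prod[OF fib_pairs fib_WT, of ?f5 "\<lambda>x. wt x * real (gsize x)"] size_gf
    by (simp only: Tg_def Hg_def)
  also have "gf ?P (psz csize csize) ?f1 = Sg m * Cg"
    unfolding gf_pairs_minus gf_prod[OF fib_WC fib_WC, of "\<lambda>x. wc x * real (skc m 0 x)" wc] by (simp add: Sg_def Cg_def)
  also have "gf ?P (psz csize csize) ?f2 = ?E * Cg"
    unfolding gf_pairs_minus gf_prod[OF fib_WC fib_WC, of "\<lambda>x. wc x * real (csize x)" wc] size_gf by (simp add: Cg_def)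
  also have "gf ?P (psz csize csize) ?f3 = Cg * Sg m"
    unfolding gf_pairs_minus gf_prod[OF fib_WC fib_WC, of wc "\<lambda>x. wc x * real (skc m 0 x)"] by (simp add: Sg_def Cg_def)
  also have "gf ?P (psz csize csize) ?f4 = Cg * ?E"
    unfolding gf_pairs_minus gf_prod[OF fib_WC fib_WC, of wc "\<lambda>x. wc x * real (csize x)"] size_gf by (simp add: Cg_def)
  also have "gf ?P (psz csize csize) ?f5 = Cg ^ 2 - 1"
    unfolding gf_pairs_minus gf_prod[OF fib_WC fib_WC] by (simp add: Cg_def wc_def power2_eq_square)
  also have "gf ?P (psz csize csize) ?f6 = Mg m"
    unfolding gf_pairs_minus by (simp add: Mg_def m0)
  finally have G: "gf (?P \<times> WT) (psz (psz csize csize) gsize) (\<lambda>p. wt (Gall (fst (fst p)) (snd (fst p)) (snd p)) * real (sk m 0 (Gall (fst (fst p)) (snd (fst p)) (snd p))))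
    = half * (Sg m * Cg * Tg + ?E * Cg * Tg + Cg * Sg m * Tg + Cg * ?E * Tg + (Cg ^ 2 - 1) * Hg m + Mg m * ?D + fps_const 2 * ((Cg ^ 2 - 1) * ?D))" .
  have h1: "half * (a + a) = a" for a :: "real fps"
    by (rule fps_ext) (simp only: fps_mult_left_const_nth fps_add_nth, simp)
  have h2: "half * (b + b + c + d + fps_const 2 * e) = b + half * c + half * d + e" for b c d e :: "real fps"
    by (rule fps_ext) (simp only: fps_mult_left_const_nth fps_add_nth, simp)
  have "Hg m = half * (Hg m * Tg + ?D * Tg + Tg * Hg m + Tg * ?D) +
     half * (Sg m * Cg * Tg + ?E * Cg * Tg + Cg * Sg m * Tg + Cg * ?E * Tg + (Cg ^ 2 - 1) * Hg m + Mg m * ?D + fps_const 2 * ((Cg ^ 2 - 1) * ?D))"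
    using gf_WT[of "\<lambda>s. wt s * real (sk m 0 s)"] unfolding N G by (simp only: Hg_def[symmetric] sk.simps(1)) simp
  also have "Hg m * Tg + ?D * Tg + Tg * Hg m + Tg * ?D = (Hg m + ?D) * Tg + (Hg m + ?D) * Tg" by (simp add: algebra_simps)
  also have "Sg m * Cg * Tg + ?E * Cg * Tg + Cg * Sg m * Tg + Cg * ?E * Tg + (Cg ^ 2 - 1) * Hg m + Mg m * ?D + fps_const 2 * ((Cg ^ 2 - 1) * ?D)
     = ((Sg m + ?E) * Cg * Tg + (Sg m + ?E) * Cg * Tg) + (Cg ^ 2 - 1) * Hg m + Mg m * ?D + fps_const 2 * ((Cg ^ 2 - 1) * ?D)"
    by (simp add: algebra_simps)
  finally show ?thesis unfolding h1 h2 unfolding add.assoc .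
qed

text \<open>Removing the first node of both sides lowers the minimum of their lengths by one.\<close>
lemma Mg_min: "Mg min = Tg ^ 2 * (Cg ^ 2 + Mg min)"
proof -
  let ?f = "\<lambda>p. ((Chn (fst (fst p)) (snd (fst p)), Chn (fst (snd p)) (snd (snd p))) :: unit ch \<times> unit ch)"
  let ?w = "\<lambda>p. wc (fst p) * wc (snd p) * real (min (clen (fst p)) (clen (snd p)))"
  let ?Q = "?f ` ((WT \<times> WC) \<times> (WT \<times> WC))"
  let ?R = "{p \<in> WC \<times> WC. fst p = End \<or> snd p = End}"
  have e: "WC \<times> WC = ?R \<union> ?Q"
  proof (intro equalityI subsetI)
    fix p :: "unit ch \<times> unit ch" assume p: "p \<in> WC \<times> WC"
    show "p \<in> ?R \<union> ?Q"
    proof (cases "fst p = End \<or> snd p = End")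
      case True
      then show ?thesis using p by blast
    next
      case False
      then obtain a c b d where cd: "fst p = Chn a c" "snd p = Chn b d" by (metis ch.exhaust)
      have "fst p \<in> WC" "snd p \<in> WC" using p by auto
      then have "((a, c), (b, d)) \<in> (WT \<times> WC) \<times> (WT \<times> WC)" using cd by (simp add: WC_def WT_def)
      moreover have "p = ?f ((a, c), (b, d))" using cd by (simp add: prod_eq_iff)
      ultimately show ?thesis by blast
    qed
  next
    fix p :: "unit ch \<times> unit ch" assume p: "p \<in> ?R \<union> ?Q"
    then show "p \<in> WC \<times> WC"
    proof
      assume "p \<in> ?Q"
      then obtain q where "q \<in> (WT \<times> WC) \<times> (WT \<times> WC)" "p = ?f q" by blast
      then show ?thesis by (auto simp: WC_def WT_def)
    qed simp
  qed
  have fR: "fib ?R (psz csize csize)" by (rule fib_subset[OF fib_prod[OF fib_WC fib_WC]]) auto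
  have fQ: "fib ?Q (psz csize csize)"
    by (rule fib_image[OF fib_prod[OF fib_prod[OF fib_WT fib_WC] fib_prod[OF fib_WT fib_WC]]]) auto
  have "Mg min = gf ?R (psz csize csize) ?w + gf ?Q (psz csize csize) ?w"
    unfolding Mg_def by (subst (1) e, rule gf_Un[OF fR fQ]) auto
  also have "gf ?R (psz csize csize) ?w = gf ?R (psz csize csize) (\<lambda>p. 0 * 0)"
    by (rule gf_cong) auto
  also have "\<dots> = 0" unfolding gf_cmult by simp
  also have "gf ?Q (psz csize csize) ?w = gf ((WT \<times> WC) \<times> (WT \<times> WC)) (psz (psz gsize csize) (psz gsize csize)) (\<lambda>p. ?w (?f p))"
    by (rule gf_image) (auto simp: inj_on_def)
  also have "\<dots> = gf ((WT \<times> WC) \<times> (WT \<times> WC)) (psz (psz gsize csize) (psz gsize csize))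
     (\<lambda>p. (wt (fst (fst p)) * wc (snd (fst p))) * (wt (fst (snd p)) * wc (snd (snd p)))
        + (wt (fst (fst p)) * wt (fst (snd p))) * (wc (snd (fst p)) * wc (snd (snd p)) * real (min (clen (snd (fst p))) (clen (snd (snd p))))))"
    by (rule gf_cong) (simp add: wc_def wt_def power_add field_simps)
  also have "\<dots> = (Tg * Cg) * (Tg * Cg) +
     gf ((WT \<times> WC) \<times> (WT \<times> WC)) (psz (psz gsize csize) (psz gsize csize))
       (\<lambda>p. (wt (fst (fst p)) * wt (fst (snd p))) * (wc (snd (fst p)) * wc (snd (snd p)) * real (min (clen (snd (fst p))) (clen (snd (snd p))))))"
    unfolding gf_add gf_prod[OF fib_prod[OF fib_WT fib_WC] fib_prod[OF fib_WT fib_WC], of "\<lambda>p. wt (fst p) * wc (snd p)" "\<lambda>p. wt (fst p) * wc (snd p)"]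
      gf_prod[OF fib_WT fib_WC] by (simp add: Tg_def Cg_def)
  also have "gf ((WT \<times> WC) \<times> (WT \<times> WC)) (psz (psz gsize csize) (psz gsize csize))
       (\<lambda>p. (wt (fst (fst p)) * wt (fst (snd p))) * (wc (snd (fst p)) * wc (snd (snd p)) * real (min (clen (snd (fst p))) (clen (snd (snd p))))))
     = (Tg * Tg) * Mg min"
  proof -
    let ?g = "\<lambda>p. ((fst (fst p), fst (snd p)), (snd (fst p), snd (snd p)))"
    let ?v = "\<lambda>p. (wt (fst (fst p)) * wt (snd (fst p))) * (wc (fst (snd p)) * wc (snd (snd p)) * real (min (clen (fst (snd p))) (clen (snd (snd p)))))"
    have "(WT \<times> WC) \<times> (WT \<times> WC) = ?g ` ((WT \<times> WT) \<times> (WC \<times> WC))" by (force simp: image_iff)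
    then have "gf ((WT \<times> WC) \<times> (WT \<times> WC)) (psz (psz gsize csize) (psz gsize csize)) (\<lambda>p. ?v (?g p))
       = gf (?g ` ((WT \<times> WT) \<times> (WC \<times> WC))) (psz (psz gsize csize) (psz gsize csize)) (\<lambda>p. ?v (?g p))" by simp
    also have "\<dots> = gf ((WT \<times> WT) \<times> (WC \<times> WC)) (psz (psz gsize gsize) (psz csize csize)) (\<lambda>p. ?v (?g (?g p)))"
      by (rule gf_image) (auto simp: inj_on_def)
    also have "\<dots> = (Tg * Tg) * Mg min"
      unfolding Mg_def Tg_def gf_prod[OF fib_WT fib_WT, symmetric]
       gf_prod[OF fib_prod[OF fib_WT fib_WT] fib_prod[OF fib_WC fib_WC], symmetric] by simp
    finally show ?thesis by simp
  qed
  finally have "Mg min = 0 + (Tg * Cg * (Tg * Cg) + Tg * Tg * Mg min)" .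
  also have "0 + (Tg * Cg * (Tg * Cg) + Tg * Tg * Mg min) = Tg ^ 2 * (Cg ^ 2 + Mg min)"
    by (simp add: power2_eq_square algebra_simps)
  finally show ?thesis .
qed

lemma Mg_max: "Mg max + Mg min = 2 * (Cg * Lg)"
proof -
  have "Mg max + Mg min = gf (WC \<times> WC) (psz csize csize) (\<lambda>p. (wc (fst p) * real (clen (fst p))) * wc (snd p) + wc (fst p) * (wc (snd p) * real (clen (snd p))))"
    unfolding Mg_def gf_add[symmetric] by (rule gf_cong) (auto simp: max_def min_def algebra_simps)
  also have "\<dots> = Lg * Cg + Cg * Lg"
    unfolding gf_add gf_prod[OF fib_WC fib_WC, of "\<lambda>x. wc x * real (clen x)" wc]
     gf_prod[OF fib_WC fib_WC, of wc "\<lambda>x. wc x * real (clen x)"] by (simp add: Lg_def Cg_def)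
  finally show ?thesis by (simp add: algebra_simps)
qed

lemma expectation_eq:
  assumes "n \<noteq> 1" and f: "f = sackin_max \<and> m = max \<or> f = sackin_min \<and> m = min"
  shows "uniform_LGT_expectation f n = Hg m $ n / Tg $ n"
  using uniform_LGT_expectation_shapes[OF assms]
  by (simp add: Hg_def Tg_def gf_nth WT_def shapes_def wt_def)

lemma gf_nonneg: "(\<And>x. w x \<ge> 0) \<Longrightarrow> gf S sz w $ n \<ge> 0" by (simp add: gf_nth sum_nonneg)

lemma nonneg_coeffs: "Tg $ n \<ge> 0" "Cg $ n \<ge> 0" "Mg m $ n \<ge> 0"
  by (auto simp: Tg_def Cg_def Mg_def wt_def wc_def intro!: gf_nonneg)

lemma Tg_0: "Tg $ 0 = 0"
  using gsize_pos by (auto simp: Tg_def gf_nth intro!: sum.neutral)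

lemma two_half: "2 * half = 1" by (rule fps_ext) (simp add: fps_numeral_fps_const)

lemma Cg_inv: "Cg * (1 - Tg) = 1"
proof -
  have "Cg * (1 - Tg) = Cg - Tg * Cg" by (simp add: algebra_simps)
  then show ?thesis using Cg_eq by (metis add_diff_cancel_right')
qed

lemma double_half: "2 * (half * f) = f" using two_half by (metis mult.assoc mult_1)

lemma Tg_eq2: "2 * Tg = 2 * fps_X + Tg ^ 2 + (Cg ^ 2 - 1) * Tg"
proof -
  have "2 * Tg = 2 * (fps_X + half * Tg ^ 2 + half * ((Cg ^ 2 - 1) * Tg))" using Tg_eq by simp
  also have "\<dots> = 2 * fps_X + 2 * (half * Tg ^ 2) + 2 * (half * ((Cg ^ 2 - 1) * Tg))" by (simp only: distrib_left)
  finally show ?thesis by (simp only: double_half)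
qed

lemma Tg_square: "(1 - 8 * fps_X) * (1 - Tg) ^ 2 = (2 * Tg ^ 2 - 5 * Tg + 1) ^ 2"
  using Tg_eq2 Cg_inv by algebra

lemma Cg_deriv: "fps_deriv Cg = fps_deriv Tg * Cg ^ 2"
proof -
  have "fps_deriv (Cg * (1 - Tg)) = 0" using Cg_inv by simp
  then have "fps_deriv Cg * (1 - Tg) = Cg * fps_deriv Tg" by (simp add: algebra_simps)
  then show ?thesis using Cg_inv by algebra
qed

definition Psi :: "real fps" where "Psi = 1 - Tg - Cg ^ 3 * Tg - half * (Cg ^ 2 - 1)"

lemma Tg_deriv: "fps_deriv Tg * Psi = 1"
proof -
  have "fps_deriv (2 * Tg) = fps_deriv (2 * fps_X + Tg ^ 2 + (Cg ^ 2 - 1) * Tg)" using Tg_eq2 by simp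
  then have "2 * fps_deriv Tg = 2 + 2 * (Tg * fps_deriv Tg) + (2 * (Cg * (fps_deriv Tg * Cg ^ 2)) * Tg + (Cg ^ 2 - 1) * fps_deriv Tg)"
    by (simp add: fps_deriv_power Cg_deriv fps_numeral_fps_const[symmetric] algebra_simps power2_eq_square)
  moreover have "2 * (fps_deriv Tg * Psi) = 2 * fps_deriv Tg - 2 * (Tg * fps_deriv Tg) - 2 * (Cg ^ 3 * Tg * fps_deriv Tg) - (2 * half) * ((Cg ^ 2 - 1) * fps_deriv Tg)"
    by (simp add: Psi_def algebra_simps)
  ultimately have "2 * (fps_deriv Tg * Psi) = 2" using two_half by (simp add: algebra_simps power3_eq_cube power2_eq_square)
  then show ?thesis using two_half by (metis double_half mult.commute mult.left_commute mult_1)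
qed

definition Ag :: "(nat \<Rightarrow> nat \<Rightarrow> nat) \<Rightarrow> real fps" where
  "Ag m = Tg + (Cg ^ 3 + Cg ^ 4) * Tg + half * Mg m + Cg ^ 2 - 1"

lemma Hg_formula:
  assumes "m 0 0 = 0" shows "Hg m = fps_X * fps_deriv Tg ^ 2 * Ag m"
proof -
  define D where "D = fps_X * fps_deriv Tg"
  define Y where "Y = Sg m + fps_X * fps_deriv Cg"
  have E: "fps_X * fps_deriv Cg = D * Cg ^ 2" by (simp add: D_def Cg_deriv)
  have S: "Sg m = (Hg m + D) * Cg + Tg * Y" using Sg_eq[of m] by (simp only: D_def Y_def)
  have "Y * (1 - Tg) = (Hg m + D) * Cg + D * Cg ^ 2" using S E unfolding Y_def by algebra
  then have Y: "Y = (Hg m + D) * Cg ^ 2 + D * Cg ^ 3" using Cg_inv by algebra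
  have H: "Hg m = (Hg m + D) * Tg + Y * Cg * Tg + half * ((Cg ^ 2 - 1) * Hg m) + half * (Mg m * D) + (Cg ^ 2 - 1) * D"
    using Hg_eq[of m] assms by (simp only: D_def Y_def)
  have "Hg m * Psi = D * Ag m" using H Y unfolding Psi_def Ag_def by algebra
  then have "Hg m * (fps_deriv Tg * Psi) = fps_deriv Tg * (D * Ag m)" by (simp add: algebra_simps)
  then show ?thesis unfolding Tg_deriv by (simp add: D_def power2_eq_square algebra_simps)
qed

lemma Lg_closed: "Lg = Tg * Cg ^ 2"
  using Lg_eq Cg_inv by algebra

lemma Mg_max_closed: "Mg max = 2 * (Tg * Cg ^ 3) - Mg min"
  using Mg_max Lg_closed by algebra

section \<open>Absolute convergence at 1/8 and the square-root singularity\<close>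

definition cm :: "real fps \<Rightarrow> complex fps" where "cm f = Abs_fps (\<lambda>n. complex_of_real (f $ n))"

lemma cm_nth [simp]: "cm f $ n = complex_of_real (f $ n)" by (simp add: cm_def)

lemma cm_hom:
  "cm (f + g) = cm f + cm g" "cm (f - g) = cm f - cm g" "cm (f * g) = cm f * cm g" "cm 1 = 1" "cm fps_X = fps_X"
  "cm (fps_deriv f) = fps_deriv (cm f)" "cm (fps_const c) = fps_const (of_real c)" "cm (numeral k) = numeral k"
  by (rule fps_ext; simp add: fps_mult_nth fps_X_def fps_numeral_nth)+

lemma cm_power: "cm (f ^ n) = cm f ^ n"
  by (induction n) (simp_all add: cm_hom)

text \<open>Absolute convergence to \<open>l\<close> at \<open>1/8\<close>, the singularity of the generating functions.\<close>
definition ev :: "complex fps \<Rightarrow> complex \<Rightarrow> bool" where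
  "ev f l \<longleftrightarrow> summable (\<lambda>n. norm (f $ n * (1/8) ^ n)) \<and> (\<lambda>n. f $ n * (1/8) ^ n) sums l"

lemma ev_unique: "ev f l \<Longrightarrow> ev f l' \<Longrightarrow> l = l'"
  by (auto simp: ev_def intro: sums_unique2)

lemma ev_add: "ev f l \<Longrightarrow> ev g k \<Longrightarrow> ev (f + g) (l + k)"
proof -
  assume "ev f l" "ev g k"
  then have s: "summable (\<lambda>n. norm (f $ n * (1/8) ^ n) + norm (g $ n * (1/8) ^ n))"
    and t: "(\<lambda>n. f $ n * (1/8) ^ n + g $ n * (1/8) ^ n) sums (l + k)"
    by (auto simp: ev_def intro: summable_add sums_add)
  have "summable (\<lambda>n. norm ((f + g) $ n * (1/8) ^ n))"
    by (rule summable_comparison_test'[OF s, of 0]) (simp only: real_norm_def abs_norm_cancel fps_add_nth distrib_right norm_triangle_ineq)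
  then show ?thesis using t by (simp add: ev_def distrib_right)
qed

lemma ev_cmult: "ev f l \<Longrightarrow> ev (fps_const c * f) (c * l)"
  by (auto simp: ev_def mult.assoc norm_mult intro!: summable_mult sums_mult)

lemma ev_diff: "ev f l \<Longrightarrow> ev g k \<Longrightarrow> ev (f - g) (l - k)"
  using ev_add[of f l "fps_const (-1) * g" "-1 * k"] ev_cmult[of g k "-1"]
  by (simp add: fps_const_neg[symmetric] del: fps_const_neg)

lemma ev_mult:
  assumes "ev f l" "ev g k" shows "ev (f * g) (l * k)"
proof -
  let ?a = "\<lambda>n. f $ n * (1/8) ^ n" and ?b = "\<lambda>n. g $ n * (1/8) ^ n"
  have s: "summable (\<lambda>n. norm (?a n))" "summable (\<lambda>n. norm (?b n))" using assms by (auto simp: ev_def)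
  have e: "(f * g) $ n * (1/8) ^ n = (\<Sum>i\<le>n. ?a i * ?b (n - i))" for n
  proof -
    have "(f * g) $ n * (1/8) ^ n = (\<Sum>i\<le>n. f $ i * g $ (n - i) * (1/8) ^ n)"
      by (simp add: fps_mult_nth sum_distrib_right atLeast0AtMost)
    also have "\<dots> = (\<Sum>i\<le>n. ?a i * ?b (n - i))"
    proof (rule sum.cong[OF refl])
      fix i assume "i \<in> {..n}"
      then have "(1/8 :: complex) ^ n = (1/8) ^ i * (1/8) ^ (n - i)" by (simp add: power_add[symmetric])
      then show "f $ i * g $ (n - i) * (1/8) ^ n = ?a i * ?b (n - i)" by (simp add: mult_ac)
    qed
    finally show ?thesis .
  qed
  have "(\<lambda>n. \<Sum>i\<le>n. ?a i * ?b (n - i)) sums ((\<Sum>n. ?a n) * (\<Sum>n. ?b n))"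
    by (rule Cauchy_product_sums[OF s])
  moreover have "(\<Sum>n. ?a n) = l" "(\<Sum>n. ?b n) = k" using assms by (auto simp: ev_def sums_iff)
  ultimately have 1: "(\<lambda>n. (f * g) $ n * (1/8) ^ n) sums (l * k)" using e by simp
  have "summable (\<lambda>n. \<Sum>i\<le>n. norm (?a i) * norm (?b (n - i)))"
    using summable_Cauchy_product[of "\<lambda>n. norm (?a n)" "\<lambda>n. norm (?b n)"] s by simp
  then have "summable (\<lambda>n. norm ((f * g) $ n * (1/8) ^ n))"
  proof (rule summable_comparison_test'[of _ 0])
    fix n
    show "norm (norm ((f * g) $ n * (1/8) ^ n)) \<le> (\<Sum>i\<le>n. norm (?a i) * norm (?b (n - i)))"
      unfolding e real_norm_def abs_norm_cancel by (rule order.trans[OF norm_sum]) (simp add: norm_mult)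
  qed
  then show ?thesis using 1 by (simp add: ev_def)
qed

lemma ev_const: "ev (fps_const c) c"
proof -
  have "(\<lambda>n. fps_const c $ n * (1/8) ^ n) = (\<lambda>n. if n = 0 then c else 0)" by auto
  moreover have "(\<lambda>n. norm (fps_const c $ n * (1/8) ^ n)) = (\<lambda>n. if n = 0 then norm c else 0)" by auto
  ultimately show ?thesis unfolding ev_def
    using sums_single[of 0 "\<lambda>_. c"] sums_single[of 0 "\<lambda>_. norm c"] by (auto simp: sums_iff)
qed

lemma ev_1: "ev 1 1" using ev_const[of 1] by simp
lemma ev_numeral: "ev (numeral k) (numeral k)"
  using ev_const[of "numeral k"] by (simp add: fps_numeral_fps_const)

lemma ev_X: "ev fps_X (1/8)"
proof -
  have "(\<lambda>n. fps_X $ n * (1/8 :: complex) ^ n) = (\<lambda>n. if n = 1 then 1/8 else 0)" by (auto simp: fps_X_def)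
  moreover have "(\<lambda>n. norm (fps_X $ n * (1/8 :: complex) ^ n)) = (\<lambda>n. if n = 1 then 1/8 else 0)" by (auto simp: fps_X_def)
  ultimately show ?thesis unfolding ev_def
    using sums_single[of 1 "\<lambda>_. 1/8 :: complex"] sums_single[of 1 "\<lambda>_. 1/8 :: real"] by (auto simp: sums_iff)
qed

lemma ev_power: "ev f l \<Longrightarrow> ev (f ^ n) (l ^ n)"
  by (induction n) (auto simp: ev_1 ev_mult)

lemma ev_radius:
  assumes "f has_fps_expansion F" "f holomorphic_on eball 0 1"
  shows "ev F (f (1/8))" "summable (\<lambda>n. norm (F $ n) * (1/4) ^ n)"
proof -
  have r: "fps_conv_radius F \<ge> 1" by (rule holomorphic_on_imp_fps_conv_radius_ge[OF assms])
  have s: "summable (\<lambda>n. norm (F $ n * z ^ n))" if "norm z < 1" for z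
  proof (rule abs_summable_in_conv_radius)
    have "ereal (norm z) < 1" using that by simp
    then show "ereal (norm z) < conv_radius (fps_nth F)" using r unfolding fps_conv_radius_def by (rule less_le_trans)
  qed
  show "ev F (f (1/8))" unfolding ev_def
    using s[of "1/8"] has_fps_expansion_imp_sums_complex[OF assms, of "1/8"] by simp
  show "summable (\<lambda>n. norm (F $ n) * (1/4) ^ n)" using s[of "1/4"] by (simp add: norm_mult norm_power)
qed

lemma ev_fixpoint:
  fixes f a b :: "real fps"
  assumes nn: "\<And>n. f $ n \<ge> 0" "\<And>n. a $ n \<ge> 0" "\<And>n. b $ n \<ge> 0" and eq: "f = a + b * f"
    and ea: "ev (cm a) (of_real \<alpha>)" and eb: "ev (cm b) (of_real \<beta>)" and \<beta>: "\<beta> < 1"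
  shows "ev (cm f) (of_real (\<alpha> / (1 - \<beta>)))"
proof -
  define tr where "tr g N = (\<Sum>n\<le>N. g $ n * (1/8) ^ n)" for g :: "real fps" and N
  have le: "tr g N \<le> l" if "ev (cm g) (of_real l)" "\<And>n. g $ n \<ge> 0" for g l N
  proof -
    have "(\<lambda>n. complex_of_real (g $ n * (1/8) ^ n)) sums of_real l" using that(1) by (simp add: ev_def)
    then have s: "(\<lambda>n. g $ n * (1/8) ^ n) sums l" by (simp only: sums_of_real_iff)
    then have "tr g N \<le> (\<Sum>n. g $ n * (1/8) ^ n)" unfolding tr_def
      using that(2) by (intro sum_le_suminf) (auto simp: sums_iff)
    then show ?thesis using s by (simp add: sums_iff)
  qed
  have nn_tr: "tr g N \<ge> 0" if "\<And>n. g $ n \<ge> 0" for g N unfolding tr_def using that by (intro sum_nonneg) auto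
  have bound: "tr f N \<le> \<alpha> / (1 - \<beta>)" for N
  proof -
    have "tr (b * f) N = (\<Sum>n\<le>N. \<Sum>i\<le>n. (b $ i * (1/8) ^ i) * (f $ (n - i) * (1/8) ^ (n - i)))"
      unfolding tr_def
    proof (rule sum.cong[OF refl])
      fix n
      have "(b * f) $ n * (1/8) ^ n = (\<Sum>i\<le>n. b $ i * f $ (n - i) * (1/8) ^ n)"
        by (simp add: fps_mult_nth sum_distrib_right atLeast0AtMost)
      also have "\<dots> = (\<Sum>i\<le>n. (b $ i * (1/8) ^ i) * (f $ (n - i) * (1/8) ^ (n - i)))"
      proof (rule sum.cong[OF refl])
        fix i assume "i \<in> {..n}"
        then have "(1/8 :: real) ^ n = (1/8) ^ i * (1/8) ^ (n - i)" by (simp add: power_add[symmetric])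
        then show "b $ i * f $ (n - i) * (1/8) ^ n = (b $ i * (1/8) ^ i) * (f $ (n - i) * (1/8) ^ (n - i))" by (simp add: mult_ac)
      qed
      finally show "(b * f) $ n * (1/8) ^ n = (\<Sum>i\<le>n. (b $ i * (1/8) ^ i) * (f $ (n - i) * (1/8) ^ (n - i)))" .
    qed
    also have "\<dots> = (\<Sum>(i, j)\<in>{(i, j). i + j \<le> N}. (b $ i * (1/8) ^ i) * (f $ j * (1/8) ^ j))"
    proof -
      have "(\<Sum>n\<le>N. \<Sum>i\<le>n. (b $ i * (1/8) ^ i) * (f $ (n - i) * (1/8) ^ (n - i)))
         = (\<Sum>(n, i)\<in>Sigma {..N} (\<lambda>n. {..n}). (b $ i * (1/8) ^ i) * (f $ (n - i) * (1/8) ^ (n - i)))"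
        by (subst sum.Sigma) auto
      also have "\<dots> = (\<Sum>(i, j)\<in>{(i, j). i + j \<le> N}. (b $ i * (1/8) ^ i) * (f $ j * (1/8) ^ j))"
        by (rule sum.reindex_bij_witness[of _ "\<lambda>(i, j). (i + j, i)" "\<lambda>(n, i). (i, n - i)"]) auto
      finally show ?thesis .
    qed
    also have "\<dots> \<le> (\<Sum>(i, j)\<in>{..N} \<times> {..N}. (b $ i * (1/8) ^ i) * (f $ j * (1/8) ^ j))"
      by (rule sum_mono2) (auto intro!: mult_nonneg_nonneg nn)
    also have "\<dots> = tr b N * tr f N" by (simp add: tr_def sum_product sum.cartesian_product)
    finally have "tr (b * f) N \<le> tr b N * tr f N" .
    moreover have "tr f N = tr a N + tr (b * f) N" using arg_cong[OF eq, of "\<lambda>g. tr g N"]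
      by (simp add: tr_def sum.distrib distrib_right)
    moreover have "tr b N * tr f N \<le> \<beta> * tr f N" using le[OF eb nn(3)] nn_tr[OF nn(1)] by (intro mult_right_mono) auto
    ultimately have "tr f N \<le> \<alpha> + \<beta> * tr f N" using le[OF ea nn(2), of N] by linarith
    then have "tr f N * (1 - \<beta>) \<le> \<alpha>" by (simp add: algebra_simps)
    then show ?thesis using \<beta> by (simp add: pos_le_divide_eq)
  qed
  have "summable (\<lambda>n. f $ n * (1/8) ^ n)"
  proof (rule summableI_nonneg_bounded[of _ "\<alpha> / (1 - \<beta>)"])
    fix n
    show "0 \<le> f $ n * (1/8) ^ n" using nn(1) by simp
    show "(\<Sum>i<n. f $ i * (1/8) ^ i) \<le> \<alpha> / (1 - \<beta>)"
    proof (cases n)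
      case 0
      then show ?thesis using bound[of 0] nn_tr[OF nn(1), of 0] by simp
    next
      case (Suc N)
      then show ?thesis using bound[of N] by (simp add: tr_def lessThan_Suc_atMost)
    qed
  qed
  then obtain l where l: "(\<lambda>n. f $ n * (1/8) ^ n) sums l" by (auto simp: summable_def)
  have "(\<lambda>n. complex_of_real (f $ n * (1/8) ^ n)) sums of_real l" using l by (simp only: sums_of_real_iff)
  moreover have "norm (cm f $ n * (1/8) ^ n) = f $ n * (1/8) ^ n" for n using nn(1) by (simp add: norm_mult norm_power)
  ultimately have el: "ev (cm f) (of_real l)" using l by (simp add: ev_def sums_iff)
  have "cm f = cm a + cm b * cm f" using arg_cong[OF eq, of cm] unfolding cm_hom .
  from this[symmetric] have "ev (cm f) (of_real \<alpha> + of_real \<beta> * of_real l)"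
    by (rule subst) (rule ev_add[OF ea ev_mult[OF eb el]])
  then have "complex_of_real l = of_real \<alpha> + of_real \<beta> * of_real l" by (rule ev_unique[OF el])
  then have "complex_of_real l = of_real (\<alpha> + \<beta> * l)" unfolding of_real_add of_real_mult .
  then have "l = \<alpha> + \<beta> * l" unfolding of_real_eq_iff .
  then have "l - \<beta> * l = \<alpha>" by linarith
  then have "l * (1 - \<beta>) = \<alpha>" by (simp add: algebra_simps)
  then have "l = \<alpha> / (1 - \<beta>)" using \<beta> by (simp add: eq_divide_eq)
  then show ?thesis using el by simp
qed

text \<open>The coefficients of \<open>sqrt (1 - x)\<close>.\<close>
definition sig :: "nat \<Rightarrow> real" where "sig n = (-1) ^ n * ((1/2) gchoose n)"

lemma sig_0: "sig 0 = 1" by (simp add: sig_def)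

lemma sig_Suc: "sig (Suc n) = sig n * ((real n - 1/2) / (real n + 1))"
  by (simp add: sig_def gbinomial_prod_rev field_simps)

lemma sig_neg: "sig (Suc n) < 0"
proof (induction n)
  case 0
  then show ?case by (simp add: sig_Suc sig_0)
next
  case (Suc n)
  have "(real (Suc n) - 1/2) / (real (Suc n) + 1) > 0" by (intro divide_pos_pos) auto
  then show ?case unfolding sig_Suc[of "Suc n"] by (rule mult_neg_pos[OF Suc])
qed

lemma sig_nz: "sig n \<noteq> 0" using sig_0 sig_neg[of "n - 1"] by (cases n) auto

lemma sig_asymp: "(\<lambda>n. sig n * real n powr (3/2)) \<longlonglongrightarrow> - 1 / (2 * sqrt pi)"
proof -
  have "Gamma (1 / 2 :: real) = (- 1/2) * Gamma (- 1/2)"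
    using Gamma_plus1[of "- 1/2 :: real"] by (simp add: not_in_Ints_imp_not_in_nonpos_Ints)
  then have G: "inverse (Gamma (- (1/2) :: real)) = - 1 / (2 * sqrt pi)"
    by (simp add: Gamma_one_half_real field_simps)
  have "(\<lambda>n. ((1/2 :: real) gchoose n) / ((-1) ^ n / exp ((1/2 + 1) * of_real (ln (real n))))) \<longlonglongrightarrow> inverse (Gamma (- (1/2)))"
    by (rule gbinomial_asymptotic)
  moreover have "eventually (\<lambda>n. ((1/2 :: real) gchoose n) / ((-1) ^ n / exp ((1/2 + 1) * of_real (ln (real n)))) = sig n * real n powr (3/2)) sequentially"
    using eventually_gt_at_top[of 0]
  proof eventually_elim
    case (elim n)
    then show ?case by (cases "even n") (simp_all add: sig_def powr_def)
  qed
  ultimately have "(\<lambda>n. sig n * real n powr (3/2)) \<longlonglongrightarrow> inverse (Gamma (- (1/2)))"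
    by (rule Lim_transform_eventually)
  then show ?thesis unfolding G .
qed

lemma sig_partial: "(\<Sum>k\<le>n. sig k) = (-1) ^ n * ((- 1/2) gchoose n)"
  using gbinomial_sum_lower_neg[of "1/2 :: real" n] by (simp add: sig_def mult.commute)

lemma sig_partial_lim: "(\<lambda>n. \<Sum>k\<le>n. sig k) \<longlonglongrightarrow> 0"
proof -
  have "(\<lambda>n. ((-1/2 :: real) gchoose n) / ((-1) ^ n / exp ((-1/2 + 1) * of_real (ln (real n))))) \<longlonglongrightarrow> inverse (Gamma (- (-1/2)))"
    by (rule gbinomial_asymptotic)
  moreover have "(\<lambda>n. 1 / real n powr (1/2)) \<longlonglongrightarrow> 0" by real_asymp
  ultimately have "(\<lambda>n. ((-1/2 :: real) gchoose n) / ((-1) ^ n / exp ((-1/2 + 1) * of_real (ln (real n)))) * (1 / real n powr (1/2))) \<longlonglongrightarrow> inverse (Gamma (- (-1/2))) * 0"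
    by (rule tendsto_mult)
  moreover have "eventually (\<lambda>n. ((-1/2 :: real) gchoose n) / ((-1) ^ n / exp ((-1/2 + 1) * of_real (ln (real n)))) * (1 / real n powr (1/2)) = (\<Sum>k\<le>n. sig k)) sequentially"
    using eventually_gt_at_top[of 0]
  proof eventually_elim
    case (elim n)
    then show ?case by (cases "even n") (simp_all add: sig_partial powr_def)
  qed
  ultimately have "(\<lambda>n. \<Sum>k\<le>n. sig k) \<longlonglongrightarrow> inverse (Gamma (- (-1/2))) * 0"
    by (rule Lim_transform_eventually)
  then show ?thesis by simp
qed

lemma sig_sums: "sig sums 0"
  using sig_partial_lim by (simp add: sums_def_le)

lemma sig_abs_summable: "summable (\<lambda>n. \<bar>sig n\<bar>)"
proof -
  have "summable (\<lambda>n. - sig (Suc n))" using sig_sums by (simp add: sums_iff summable_Suc_iff summable_minus_iff)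
  moreover have "(\<lambda>n. - sig (Suc n)) = (\<lambda>n. \<bar>sig (Suc n)\<bar>)" using sig_neg by (auto simp: abs_of_neg)
  ultimately have "summable (\<lambda>n. \<bar>sig (Suc n)\<bar>)" by simp
  then show ?thesis by (subst (asm) summable_Suc_iff)
qed

text \<open>The consecutive quotients are at most 2 except for the first two, which are 2 and 4; this is where the
  extra factor 2 comes from.\<close>
lemma sig_growth: "\<bar>sig m\<bar> \<le> 2 * 2 ^ k * \<bar>sig (m + k)\<bar>"
proof -
  define v where "v n = (if n \<le> 1 then 1 else 2) * \<bar>sig n\<bar>" for n
  have step: "v n \<le> 2 * v (Suc n)" for n
  proof -
    consider "n = 0" | "n = 1" | "n \<ge> 2" by linarith
    then show ?thesis
    proof cases
      case 1
      then show ?thesis by (simp add: v_def sig_0 sig_Suc)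
    next
      case 2
      have "sig 1 = - 1/2" "sig (Suc 1) = - 1/8" by (simp_all add: sig_0 sig_Suc)
      then show ?thesis using 2 by (simp add: v_def)
    next
      case 3
      then have "(real n - 1/2) / (real n + 1) \<ge> 1/2" by (simp add: field_simps)
      then have "\<bar>sig n\<bar> * (1/2) \<le> \<bar>sig n\<bar> * ((real n - 1/2) / (real n + 1))" by (intro mult_left_mono) auto
      moreover have "\<bar>sig (Suc n)\<bar> = \<bar>sig n\<bar> * ((real n - 1/2) / (real n + 1))" using 3 by (simp add: sig_Suc abs_mult)
      ultimately show ?thesis using 3 by (simp add: v_def)
    qed
  qed
  have "v m \<le> 2 ^ k * v (m + k)"
  proof (induction k)
    case (Suc k)
    have "2 ^ k * v (m + k) \<le> 2 ^ k * (2 * v (Suc (m + k)))" by (rule mult_left_mono[OF step]) simp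
    also have "\<dots> = 2 ^ Suc k * v (m + Suc k)" by simp
    finally show ?case using Suc by (rule order.trans[rotated])
  qed simp
  moreover have "\<bar>sig m\<bar> \<le> v m" by (simp add: v_def)
  moreover have "2 ^ k * v (m + k) \<le> 2 ^ k * (2 * \<bar>sig (m + k)\<bar>)" by (intro mult_left_mono) (auto simp: v_def)
  moreover have "2 ^ k * (2 * \<bar>sig (m + k)\<bar>) = 2 * 2 ^ k * \<bar>sig (m + k)\<bar>" by simp
  ultimately show ?thesis by linarith
qed

lemma sig_ratio: "(\<lambda>n. sig n / sig (n + k)) \<longlonglongrightarrow> 1"
proof (induction k)
  case 0
  then show ?case using sig_nz by simp
next
  case (Suc k)
  have "(\<lambda>n. sig (n + k) / sig (Suc (n + k))) \<longlonglongrightarrow> 1"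
  proof -
    have e: "sig (n + k) / sig (Suc (n + k)) = (real (n + k) + 1) / (real (n + k) - 1/2)" for n
    proof -
      have "real (n + k) - 1/2 \<noteq> 0"
      proof
        assume "real (n + k) - 1/2 = 0"
        then have "real (2 * (n + k)) = real 1" by simp
        then have "2 * (n + k) = 1" by (simp only: of_nat_eq_iff)
        then show False by presburger
      qed
      moreover have "s / (s * ((x - 1/2) / (x + 1))) = (x + 1) / (x - 1/2)" if "s \<noteq> 0" "x - 1/2 \<noteq> 0" for s x :: real
        using that by simp
      ultimately show ?thesis using sig_nz[of "n + k"] unfolding sig_Suc[of "n + k"] by blast
    qed
    have "(\<lambda>n. (real (n + k) + 1) / (real (n + k) - 1/2)) \<longlonglongrightarrow> 1" by real_asymp
    then show ?thesis using e by simp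
  qed
  then have "(\<lambda>n. (sig n / sig (n + k)) * (sig (n + k) / sig (Suc (n + k)))) \<longlonglongrightarrow> 1 * 1"
    using Suc by (intro tendsto_mult)
  then show ?case using sig_nz by simp
qed

lemma sig_convolution:
  fixes \<beta> :: "nat \<Rightarrow> complex"
  assumes "summable (\<lambda>k. norm (\<beta> k) * 2 ^ k)"
  shows "(\<lambda>n. (\<Sum>k\<le>n. \<beta> k * of_real (sig (n - k))) / of_real (sig n)) \<longlonglongrightarrow> suminf \<beta>"
proof -
  define a where "a k n = (if k \<le> n then \<beta> k * of_real (sig (n - k) / sig n) else 0)" for k n
  have lim: "(\<lambda>n. a k n) \<longlonglongrightarrow> \<beta> k" for k
  proof (rule LIMSEQ_offset[of _ k])
    have "(\<lambda>n. \<beta> k * of_real (sig n / sig (n + k))) \<longlonglongrightarrow> \<beta> k * of_real 1"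
      by (intro tendsto_mult tendsto_const tendsto_of_real sig_ratio)
    then show "(\<lambda>n. a k (n + k)) \<longlonglongrightarrow> \<beta> k" by (simp add: a_def)
  qed
  have bd: "norm (a k n) \<le> 2 * (norm (\<beta> k) * 2 ^ k)" for k n
  proof (cases "k \<le> n")
    case True
    have "\<bar>sig (n - k) / sig n\<bar> \<le> 2 * 2 ^ k"
      using sig_growth[of "n - k" k] True sig_nz[of n] by (simp add: abs_divide pos_divide_le_eq)
    then have "norm (\<beta> k) * \<bar>sig (n - k) / sig n\<bar> \<le> norm (\<beta> k) * (2 * 2 ^ k)" by (intro mult_left_mono) auto
    then have "norm (\<beta> k * of_real (sig (n - k) / sig n)) \<le> norm (\<beta> k) * (2 * 2 ^ k)" unfolding norm_mult norm_of_real .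
    moreover have "a k n = \<beta> k * of_real (sig (n - k) / sig n)" using True by (simp add: a_def)
    ultimately show ?thesis by (metis mult.left_commute)
  qed (simp add: a_def)
  have ev: "eventually (\<lambda>(k, n). norm (a k n) \<le> 2 * (norm (\<beta> k) * 2 ^ k)) (at_top \<times>\<^sub>F sequentially)"
    by (rule always_eventually) (use bd in auto)
  have "((\<lambda>n. suminf (\<lambda>k. a k n)) \<longlongrightarrow> suminf \<beta>) sequentially"
    using tannerys_theorem[OF lim ev summable_mult[OF assms]] by simp
  moreover have "suminf (\<lambda>k. a k n) = (\<Sum>k\<le>n. \<beta> k * of_real (sig (n - k))) / of_real (sig n)" for n
  proof -
    have "suminf (\<lambda>k. a k n) = (\<Sum>k\<in>{..n}. a k n)" by (rule suminf_finite) (auto simp: a_def)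
    also have "\<dots> = (\<Sum>k\<le>n. \<beta> k * of_real (sig (n - k)) / of_real (sig n))" by (rule sum.cong) (auto simp: a_def)
    finally show ?thesis by (simp add: sum_divide_distrib)
  qed
  ultimately show ?thesis by simp
qed

definition sF :: "complex fps" where "sF = fps_binomial (1/2) oo (fps_const (-8) * fps_X)"

lemma sF_nth: "sF $ n * (1/8) ^ n = of_real (sig n)"
proof -
  have "sF $ n * (1/8) ^ n = ((-8) ^ n * (1/8) ^ n) * ((1/2) gchoose n)"
    by (simp add: sF_def fps_compose_linear)
  also have "(-8 :: complex) ^ n * (1/8) ^ n = (-1) ^ n" by (simp only: power_mult_distrib[symmetric]) simp
  also have "((1/2 :: complex) gchoose n) = of_real ((1/2) gchoose n)"
    by (simp add: gbinomial_prod_rev)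
  finally show ?thesis by (simp add: sig_def)
qed

lemma sF_square: "sF ^ 2 = 1 - 8 * fps_X"
proof -
  have 0: "(fps_const (-8) * fps_X :: complex fps) $ 0 = 0" by simp
  have "sF ^ 2 = (fps_binomial (1/2) ^ 2) oo (fps_const (-8) * fps_X)" unfolding sF_def by (rule fps_compose_power[OF 0])
  also have "fps_binomial (1/2 :: complex) ^ 2 = fps_binomial (of_nat 1)"
    unfolding power2_eq_square fps_binomial_add_mult[symmetric] by simp
  also have "\<dots> = 1 + fps_X" by (simp only: fps_binomial_of_nat) simp
  also have "(1 + fps_X) oo (fps_const (-8) * fps_X) = 1 + fps_const (-8 :: complex) * fps_X"
    by (simp add: fps_compose_add_distrib)
  also have "fps_const (-8 :: complex) = - 8" by (simp add: fps_numeral_fps_const)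
  finally show ?thesis by simp
qed

lemma sF_0: "sF $ 0 = 1" using sF_nth[of 0] by (simp add: sig_0)

lemma ev_sF: "ev sF 0"
  unfolding ev_def sF_nth using sig_sums sig_abs_summable
  by (simp add: sums_of_real_iff[of sig 0, where 'a = complex, simplified, symmetric] del: sums_of_real_iff)

section \<open>Singular expansion and asymptotics\<close>

definition Ff :: "complex \<Rightarrow> complex" where "Ff z = csqrt (5 - 4 * z + z ^ 2)"
definition Ef :: "complex \<Rightarrow> complex" where "Ef z = csqrt (9 - 4 * z + 4 * Ff z)"
definition FF :: "complex fps" where "FF = fps_expansion Ff 0"
definition EE :: "complex fps" where "EE = fps_expansion Ef 0"
definition IE :: "complex fps" where "IE = inverse EE"

lemma pos_Re: "Re w > 0 \<Longrightarrow> w \<notin> \<real>\<^sub>\<le>\<^sub>0" by (auto elim!: nonpos_Reals_cases)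

lemma Ff_Ef_facts:
  assumes "norm z < 1"
  shows "5 - 4 * z + z ^ 2 \<notin> \<real>\<^sub>\<le>\<^sub>0" "9 - 4 * z + 4 * Ff z \<notin> \<real>\<^sub>\<le>\<^sub>0" "Ef z \<noteq> 0"
proof -
  have "norm (z ^ 2) < 1" using assms by (simp add: norm_power power_less_one_iff)
  then have 1: "\<bar>Re z\<bar> < 1" "\<bar>Re (z ^ 2)\<bar> < 1" using assms abs_Re_le_cmod by (meson le_less_trans)+
  then have "Re (5 - 4 * z + z ^ 2) > 0" by simp
  then show "5 - 4 * z + z ^ 2 \<notin> \<real>\<^sub>\<le>\<^sub>0" by (rule pos_Re)
  have "Re (Ff z) \<ge> 0" unfolding Ff_def by (rule Re_csqrt)
  then have p: "Re (9 - 4 * z + 4 * Ff z) > 0" using 1 by simp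
  then show "9 - 4 * z + 4 * Ff z \<notin> \<real>\<^sub>\<le>\<^sub>0" by (rule pos_Re)
  show "Ef z \<noteq> 0" using p unfolding Ef_def by (metis csqrt_eq_0 less_irrefl zero_complex.simps(1))
qed

lemma Ff_holo: "Ff holomorphic_on ball 0 1"
proof -
  have "(\<lambda>z. csqrt (5 - 4 * z + z ^ 2)) holomorphic_on ball 0 1"
    using Ff_Ef_facts(1) by (intro holomorphic_on_csqrt' holomorphic_intros) auto
  then show ?thesis by (simp add: Ff_def[abs_def])
qed

lemma Ef_holo: "Ef holomorphic_on ball 0 1"
proof -
  have "(\<lambda>z. csqrt (9 - 4 * z + 4 * Ff z)) holomorphic_on ball 0 1"
    using Ff_Ef_facts(2) by (intro holomorphic_on_csqrt' holomorphic_intros Ff_holo) auto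
  then show ?thesis by (simp add: Ef_def[abs_def])
qed

lemma FF_exp: "Ff has_fps_expansion FF" and EE_exp: "Ef has_fps_expansion EE"
  unfolding FF_def EE_def using Ff_holo Ef_holo
  by (auto intro!: has_fps_expansion_fps_expansion[of "ball 0 1"])

lemma FF_square: "FF ^ 2 = 5 - 4 * fps_X + fps_X ^ 2"
proof -
  have "(\<lambda>z. Ff z ^ 2) has_fps_expansion FF ^ 2" by (intro fps_expansion_intros FF_exp)
  moreover have "(\<lambda>z. Ff z ^ 2) = (\<lambda>z. 5 - 4 * z + z ^ 2)" by (simp add: Ff_def)
  moreover have "(\<lambda>z::complex. 5 - 4 * z + z ^ 2) has_fps_expansion 5 - 4 * fps_X + fps_X ^ 2"
    by (intro fps_expansion_intros)
  ultimately show ?thesis using fps_expansion_unique_complex by metis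
qed

lemma EE_square: "EE ^ 2 = 9 - 4 * fps_X + 4 * FF"
proof -
  have "(\<lambda>z. Ef z ^ 2) has_fps_expansion EE ^ 2" by (intro fps_expansion_intros EE_exp)
  moreover have "(\<lambda>z. Ef z ^ 2) = (\<lambda>z. 9 - 4 * z + 4 * Ff z)" by (simp add: Ef_def)
  moreover have "(\<lambda>z. 9 - 4 * z + 4 * Ff z) has_fps_expansion 9 - 4 * fps_X + 4 * FF"
    by (intro fps_expansion_intros FF_exp)
  ultimately show ?thesis using fps_expansion_unique_complex by metis
qed

lemma csqrt_real: "x \<ge> 0 \<Longrightarrow> csqrt (complex_of_real x) = complex_of_real (sqrt x)"
  by (simp add: csqrt_of_real_nonneg)

lemma Ef_0: "Ef 0 = complex_of_real (2 + sqrt 5)"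
proof -
  have "Ff 0 = complex_of_real (sqrt 5)" using csqrt_real[of 5] by (simp add: Ff_def)
  then have "Ef 0 = csqrt (complex_of_real (9 + 4 * sqrt 5))" by (simp add: Ef_def)
  also have "\<dots> = complex_of_real (sqrt (9 + 4 * sqrt 5))" by (rule csqrt_real) simp
  also have "sqrt (9 + 4 * sqrt 5) = 2 + sqrt 5"
    by (rule real_sqrt_unique) (simp_all add: power2_eq_square algebra_simps)
  finally show ?thesis .
qed

lemma Ef_eighth: "Ef (1/8) = complex_of_real (sqrt 17)"
proof -
  have s: "sqrt (289/64) = 17/8" by (rule real_sqrt_unique) (simp_all add: power2_eq_square)
  have "Ff (1/8) = csqrt (complex_of_real (289/64))" by (simp add: Ff_def power2_eq_square)
  also have "\<dots> = complex_of_real (sqrt (289/64))" by (rule csqrt_real) simp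
  also have "\<dots> = complex_of_real (17/8)" unfolding s ..
  finally have F: "Ff (1/8) = complex_of_real (17/8)" .
  have "Ef (1/8) = csqrt (complex_of_real 17)" unfolding Ef_def F by simp
  then show ?thesis using csqrt_real[of 17] by simp
qed

lemma EE_0: "EE $ 0 = complex_of_real (2 + sqrt 5)"
  using has_fps_expansion_imp_0_eq_fps_nth_0[OF EE_exp] Ef_0 by simp

lemma EE_nz: "EE $ 0 \<noteq> 0"
proof -
  have "2 + sqrt 5 > 0" by (simp add: add_pos_pos)
  then show ?thesis unfolding EE_0 of_real_eq_0_iff by linarith
qed

lemma EE_IE: "EE * IE = 1" unfolding IE_def using EE_nz by (simp add: inverse_mult_eq_1')

lemma IE_exp: "(\<lambda>z. inverse (Ef z)) has_fps_expansion IE"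
  unfolding IE_def using EE_nz by (intro has_fps_expansion_inverse EE_exp)

definition AA :: "complex fps" where "AA = fps_const (1/4) * (5 - EE)"
definition BB :: "complex fps" where "BB = fps_const (1/4) * (IE - 1)"

definition Af :: "complex \<Rightarrow> complex" where "Af z = 1/4 * (5 - Ef z)"
definition Bf :: "complex \<Rightarrow> complex" where "Bf z = 1/4 * (inverse (Ef z) - 1)"

lemma AA_exp: "Af has_fps_expansion AA" and BB_exp: "Bf has_fps_expansion BB"
  unfolding Af_def[abs_def] Bf_def[abs_def] AA_def BB_def
  by (intro fps_expansion_intros EE_exp IE_exp)+

lemma AB_holo: "Af holomorphic_on ball 0 1" "Bf holomorphic_on ball 0 1"
  unfolding Af_def[abs_def] Bf_def[abs_def]
  using Ff_Ef_facts(3) by (auto intro!: holomorphic_intros Ef_holo)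

lemma eball_ball: "eball (0::complex) 1 = ball 0 1"
  by (simp add: eball_def ball_def one_ereal_def)

lemma ev_AB:
  "ev AA (Af (1/8))" "summable (\<lambda>n. norm (AA $ n) * (1/4) ^ n)"
  "ev BB (Bf (1/8))" "summable (\<lambda>n. norm (BB $ n) * (1/4) ^ n)"
  "ev (fps_deriv AA) (deriv Af (1/8))" "ev (fps_deriv BB) (deriv Bf (1/8))"
proof -
  have h: "Af holomorphic_on eball 0 1" "Bf holomorphic_on eball 0 1" "deriv Af holomorphic_on eball 0 1" "deriv Bf holomorphic_on eball 0 1"
    using AB_holo by (auto simp: eball_ball intro: holomorphic_deriv)
  show "ev AA (Af (1/8))" "summable (\<lambda>n. norm (AA $ n) * (1/4) ^ n)" by (rule ev_radius[OF AA_exp h(1)])+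
  show "ev BB (Bf (1/8))" "summable (\<lambda>n. norm (BB $ n) * (1/4) ^ n)" by (rule ev_radius[OF BB_exp h(2)])+
  show "ev (fps_deriv AA) (deriv Af (1/8))" by (rule ev_radius(1)[OF has_fps_expansion_deriv[OF AA_exp] h(3)])
  show "ev (fps_deriv BB) (deriv Bf (1/8))" by (rule ev_radius(1)[OF has_fps_expansion_deriv[OF BB_exp] h(4)])
qed

lemma four_quarter: "4 * (fps_const (1/4) * f) = (f :: complex fps)"
  by (rule fps_ext) (simp add: fps_numeral_fps_const mult.assoc[symmetric])

lemma Tg_decomp: "cm Tg = AA + BB * sF"
proof -
  define T where "T = cm Tg"
  define U where "U = AA + BB * sF"
  have T0: "T $ 0 = 0" by (simp add: T_def Tg_0)
  have "cm ((1 - 8 * fps_X) * (1 - Tg) ^ 2) = cm ((2 * Tg ^ 2 - 5 * Tg + 1) ^ 2)" using Tg_square by simp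
  then have "(1 - 8 * fps_X) * (1 - T) ^ 2 = (2 * T ^ 2 - 5 * T + 1) ^ 2"
    by (simp only: cm_hom cm_power T_def)
  then have "(2 * T ^ 2 - 5 * T + 1 - sF * (1 - T)) * (2 * T ^ 2 - 5 * T + 1 + sF * (1 - T)) = 0"
    using sF_square by algebra
  moreover have "(2 * T ^ 2 - 5 * T + 1 + sF * (1 - T)) $ 0 \<noteq> 0"
    by (simp add: fps_mult_nth_0 T0 sF_0 power2_eq_square)
  then have "2 * T ^ 2 - 5 * T + 1 + sF * (1 - T) \<noteq> 0" by (metis fps_zero_nth)
  ultimately have T: "2 * T ^ 2 - 5 * T + 1 = sF * (1 - T)" by simp
  have U4: "4 * U = 5 - EE + (IE - 1) * sF"
  proof -
    have "4 * U = 4 * AA + 4 * BB * sF" by (simp add: U_def algebra_simps)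
    then show ?thesis by (simp only: AA_def BB_def four_quarter)
  qed
  have "sF ^ 2 * IE ^ 2 = 9 - 4 * fps_X - 4 * FF"
    using sF_square EE_IE EE_square FF_square by algebra
  then have "8 * (2 * U ^ 2 - 5 * U + 1 - sF * (1 - U)) = 0"
    using U4 EE_IE EE_square sF_square by algebra
  moreover have "(8 :: complex fps) \<noteq> 0" by simp
  ultimately have U: "2 * U ^ 2 - 5 * U + 1 = sF * (1 - U)" by (simp only: mult_eq_0_iff) simp
  have "4 * U $ 0 = (5 - EE + (IE - 1) * sF) $ 0" using arg_cong[OF U4, of "\<lambda>f. f $ 0"]
    by (simp add: fps_mult_nth_0)
  also have "\<dots> = 4 - EE $ 0 + inverse (EE $ 0)" by (simp add: fps_mult_nth_0 sF_0 IE_def)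
  also have "\<dots> = complex_of_real (4 - (2 + sqrt 5) + inverse (2 + sqrt 5))" by (simp add: EE_0)
  also have "inverse (2 + sqrt 5) = sqrt 5 - 2"
    by (rule inverse_unique) (simp add: algebra_simps)
  finally have U0: "U $ 0 = 0" by simp
  have "(T - U) * (2 * (T + U) - 5 + sF) = 0" using T U by algebra
  moreover have "(2 * (T + U) - 5 + sF) $ 0 \<noteq> 0" by (simp add: fps_mult_nth_0 T0 U0 sF_0)
  then have "2 * (T + U) - 5 + sF \<noteq> 0" by (metis fps_zero_nth)
  ultimately have "T = U" by simp
  then show ?thesis by (simp add: T_def U_def)
qed

abbreviation (input) r17 :: real where "r17 \<equiv> sqrt 17"

lemma Bf_eighth: "Bf (1/8) = of_real ((1 / r17 - 1) / 4)" and Af_eighth: "Af (1/8) = of_real ((5 - r17) / 4)"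
  by (simp_all add: Bf_def Af_def Ef_eighth inverse_eq_divide)

lemma ev_Tg: "ev (cm Tg) (of_real ((5 - r17) / 4))"
  using ev_add[OF ev_AB(1) ev_mult[OF ev_AB(3) ev_sF]] unfolding Tg_decomp Af_eighth by simp

lemma r17_bounds: "4 < r17" "r17 < 5"
  by (auto intro: real_less_rsqrt real_less_lsqrt)

lemma r17_sq: "r17 * r17 = 17" "r17 * (r17 * x) = 17 * x"
  by (simp_all add: mult.assoc[symmetric])

lemma ev_Cg: "ev (cm Cg) (of_real ((r17 + 1) / 4))"
proof -
  have "ev (cm Cg) (of_real (1 / (1 - (5 - r17) / 4)))"
  proof (rule ev_fixpoint[OF _ _ _ Cg_eq])
    show "ev (cm 1) (of_real 1)" by (simp add: cm_hom ev_1)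
  qed (use nonneg_coeffs ev_Tg r17_bounds in \<open>auto simp: fps_one_def\<close>)
  moreover have nz: "1 - (5 - r17) / 4 \<noteq> 0" using r17_bounds by simp
  have "1 / (1 - (5 - r17) / 4) = (r17 + 1) / 4"
    by (subst nonzero_divide_eq_eq[OF nz]) (simp add: field_simps r17_sq)
  ultimately show ?thesis by simp
qed

lemma nonneg_mult: "(\<And>n. f $ n \<ge> 0) \<Longrightarrow> (\<And>n. g $ n \<ge> 0) \<Longrightarrow> (f * g :: real fps) $ n \<ge> 0"
  by (auto simp: fps_mult_nth intro!: sum_nonneg)

lemma ev_Mg_min: "ev (cm (Mg min)) (of_real ((13 * r17 - 43) / 128))"
proof -
  let ?\<tau> = "(5 - r17) / 4" and ?c = "(r17 + 1) / 4"
  have eq: "Mg min = Tg ^ 2 * Cg ^ 2 + Tg ^ 2 * Mg min" using Mg_min by (simp only: distrib_left)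
  have t: "?\<tau> ^ 2 < 1" using r17_bounds by (simp add: power_less_one_iff abs_square_less_1)
  have "ev (cm (Mg min)) (of_real (?\<tau> ^ 2 * ?c ^ 2 / (1 - ?\<tau> ^ 2)))"
  proof (rule ev_fixpoint[OF _ _ _ eq _ _ t])
    show "ev (cm (Tg ^ 2 * Cg ^ 2)) (of_real (?\<tau> ^ 2 * ?c ^ 2))"
      unfolding cm_hom cm_power of_real_mult of_real_power by (intro ev_mult ev_power ev_Tg ev_Cg)
    show "ev (cm (Tg ^ 2)) (of_real (?\<tau> ^ 2))"
      unfolding cm_power of_real_power by (intro ev_power ev_Tg)
  qed (auto simp: power2_eq_square intro!: nonneg_mult nonneg_coeffs)
  moreover have "?\<tau> ^ 2 * ?c ^ 2 / (1 - ?\<tau> ^ 2) = (13 * r17 - 43) / 128"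
  proof -
    have "?\<tau> ^ 2 * ?c ^ 2 = (13 * r17 - 43) / 128 * (1 - ?\<tau> ^ 2)"
      by (simp add: power2_eq_square field_simps r17_sq)
    then show ?thesis using t by (simp add: divide_eq_eq)
  qed
  ultimately show ?thesis by simp
qed

lemma ev_Ag:
  assumes "ev (cm (Mg m)) (of_real \<mu>)"
  shows "ev (cm (Ag m)) (of_real ((5 - r17) / 4 + (((r17 + 1) / 4) ^ 3 + ((r17 + 1) / 4) ^ 4) * ((5 - r17) / 4) + 1/2 * \<mu> + ((r17 + 1) / 4) ^ 2 - 1))"
  unfolding Ag_def cm_hom cm_power of_real_add of_real_diff of_real_mult of_real_power of_real_1
  using assms by (intro ev_add ev_diff ev_mult ev_power ev_Tg ev_Cg ev_const ev_1)

lemma ev_Mg_max: "ev (cm (Mg max)) (of_real (2 * ((5 - r17) / 4 * ((r17 + 1) / 4) ^ 3) - (13 * r17 - 43) / 128))"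
  unfolding Mg_max_closed cm_hom cm_power of_real_diff of_real_mult of_real_power of_real_numeral
  by (intro ev_add ev_diff ev_mult ev_power ev_Tg ev_Cg ev_numeral ev_Mg_min)

lemma sF_deriv: "sF * fps_deriv sF = - 4"
proof -
  have "fps_deriv (sF ^ 2) = fps_deriv (1 - 8 * fps_X)" using sF_square by simp
  then have "2 * (sF * fps_deriv sF) = 2 * (- 4)"
    by (simp add: power2_eq_square fps_numeral_fps_const[symmetric] mult.commute[of "fps_deriv sF"])
  moreover have "(2 :: complex fps) \<noteq> 0" by simp
  ultimately show ?thesis by (metis mult_left_cancel)
qed

lemma ev_sTd: "ev (sF * fps_deriv (cm Tg)) (of_real (1 - 1 / r17))"
proof -
  have "fps_deriv (cm Tg) = fps_deriv AA + (fps_deriv BB * sF + BB * fps_deriv sF)"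
    unfolding Tg_decomp by simp
  then have e: "sF * fps_deriv (cm Tg) = fps_deriv AA * sF + (fps_deriv BB * (1 - 8 * fps_X) - 4 * BB)"
    using sF_deriv sF_square by algebra
  have "ev (sF * fps_deriv (cm Tg)) (deriv Af (1/8) * 0 + (deriv Bf (1/8) * (1 - 8 * (1/8)) - 4 * Bf (1/8)))"
    unfolding e by (intro ev_add ev_diff ev_mult ev_AB ev_sF ev_1 ev_numeral ev_X)
  then show ?thesis by (simp add: Bf_eighth diff_divide_distrib)
qed

lemma Hg_limit:
  assumes m: "m 0 0 = 0" and A: "ev (cm (Ag m)) (of_real \<alpha>)"
  shows "(\<lambda>n. Hg m $ n * (1/8) ^ n) \<longlonglongrightarrow> 1/8 * (1 - 1 / r17) ^ 2 * \<alpha>"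
proof -
  define f where "f = cm (Hg m) * (1 - 8 * fps_X)"
  have "cm (Hg m) = fps_X * fps_deriv (cm Tg) ^ 2 * cm (Ag m)"
    unfolding Hg_formula[of m, OF m] by (simp only: cm_hom cm_power)
  then have f: "f = fps_X * (sF * fps_deriv (cm Tg)) ^ 2 * cm (Ag m)"
    unfolding f_def sF_square[symmetric] by (simp add: power_mult_distrib mult_ac)
  have "ev f (1/8 * (of_real (1 - 1 / r17)) ^ 2 * of_real \<alpha>)"
    unfolding f by (intro ev_mult ev_power ev_X ev_sTd A)
  then have "(\<lambda>n. f $ n * (1/8) ^ n) sums of_real (1/8 * (1 - 1 / r17) ^ 2 * \<alpha>)" by (simp add: ev_def)
  then have lim: "(\<lambda>n. \<Sum>k\<le>n. f $ k * (1/8) ^ k) \<longlonglongrightarrow> of_real (1/8 * (1 - 1 / r17) ^ 2 * \<alpha>)"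
    by (simp only: sums_def_le)
  have f0: "f $ 0 = of_real (Hg m $ 0)" by (simp add: f_def fps_mult_nth_0)
  have fS: "f $ Suc n = of_real (Hg m $ Suc n) - 8 * of_real (Hg m $ n)" for n
  proof -
    have "f = cm (Hg m) - 8 * (fps_X * cm (Hg m))" by (simp add: f_def algebra_simps)
    then show ?thesis by (simp add: fps_numeral_fps_const)
  qed
  have "(\<Sum>k\<le>n. f $ k * (1/8) ^ k) = of_real (Hg m $ n * (1/8) ^ n)" for n
    by (induction n) (simp_all add: f0 fS algebra_simps)
  then show ?thesis using lim by (simp only: tendsto_of_real_iff)
qed

lemma Tg_limit: "(\<lambda>n. Tg $ n * (1/8) ^ n / sig n) \<longlonglongrightarrow> (1 / r17 - 1) / 4"
proof -
  define \<beta> where "\<beta> k = BB $ k * (1/8) ^ k" for k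
  have "norm (\<beta> k) * 2 ^ k = norm (BB $ k) * (1/4) ^ k" for k
  proof -
    have "(1/8 :: real) ^ k * 2 ^ k = (1/4) ^ k" by (simp only: power_mult_distrib[symmetric]) simp
    then show ?thesis by (simp add: \<beta>_def norm_mult norm_power mult.assoc)
  qed
  then have "summable (\<lambda>k. norm (\<beta> k) * 2 ^ k)" using ev_AB(4) by simp
  then have 1: "(\<lambda>n. (\<Sum>k\<le>n. \<beta> k * of_real (sig (n - k))) / of_real (sig n)) \<longlonglongrightarrow> suminf \<beta>"
    by (rule sig_convolution)
  have "suminf \<beta> = Bf (1/8)" using ev_AB(3) unfolding \<beta>_def ev_def by (simp add: sums_iff)
  have 2: "(\<lambda>n. AA $ n * (1/8) ^ n / of_real (sig n)) \<longlonglongrightarrow> 0"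
  proof (rule Lim_null_comparison)
    show "eventually (\<lambda>n. norm (AA $ n * (1/8) ^ n / of_real (sig n)) \<le> 2 * (norm (AA $ n) * (1/4) ^ n)) sequentially"
    proof (intro always_eventually allI)
      fix n
      have "1 \<le> 2 * 2 ^ n * \<bar>sig n\<bar>" using sig_growth[of 0 n] by (simp add: sig_0)
      then have "1 / \<bar>sig n\<bar> \<le> 2 * 2 ^ n" using sig_nz[of n] by (simp add: pos_divide_le_eq)
      then have "norm (AA $ n) * (1/8) ^ n * (1 / \<bar>sig n\<bar>) \<le> norm (AA $ n) * (1/8) ^ n * (2 * 2 ^ n)"
        by (intro mult_left_mono) auto
      also have "\<dots> = 2 * (norm (AA $ n) * ((1/8) ^ n * 2 ^ n))" by simp
      also have "(1/8 :: real) ^ n * 2 ^ n = (1/4) ^ n" by (simp only: power_mult_distrib[symmetric]) simp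
      finally show "norm (AA $ n * (1/8) ^ n / of_real (sig n)) \<le> 2 * (norm (AA $ n) * (1/4) ^ n)"
        by (simp add: norm_mult norm_power norm_divide)
    qed
    show "(\<lambda>n. 2 * (norm (AA $ n) * (1/4) ^ n)) \<longlonglongrightarrow> 0"
      using tendsto_mult[OF tendsto_const summable_LIMSEQ_zero[OF ev_AB(2)], of 2] by simp
  qed
  have "complex_of_real (Tg $ n * (1/8) ^ n / sig n) = AA $ n * (1/8) ^ n / of_real (sig n) + (\<Sum>k\<le>n. \<beta> k * of_real (sig (n - k))) / of_real (sig n)" for n
  proof -
    have "(BB * sF) $ n * (1/8) ^ n = (\<Sum>k\<le>n. BB $ k * sF $ (n - k) * (1/8) ^ n)"
      by (simp add: fps_mult_nth sum_distrib_right atLeast0AtMost)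
    also have "\<dots> = (\<Sum>k\<le>n. \<beta> k * of_real (sig (n - k)))"
    proof (rule sum.cong[OF refl])
      fix k assume "k \<in> {..n}"
      then have "(1/8 :: complex) ^ n = (1/8) ^ k * (1/8) ^ (n - k)" by (simp add: power_add[symmetric])
      then show "BB $ k * sF $ (n - k) * (1/8) ^ n = \<beta> k * of_real (sig (n - k))"
        unfolding sF_nth[symmetric] \<beta>_def by (simp add: mult_ac)
    qed
    finally have b: "(BB * sF) $ n * (1/8) ^ n = (\<Sum>k\<le>n. \<beta> k * of_real (sig (n - k)))" .
    have "complex_of_real (Tg $ n * (1/8) ^ n) = cm Tg $ n * (1/8) ^ n" by simp
    also have "\<dots> = AA $ n * (1/8) ^ n + (\<Sum>k\<le>n. \<beta> k * of_real (sig (n - k)))"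
      unfolding Tg_decomp fps_add_nth distrib_right b ..
    finally show ?thesis by (simp only: of_real_divide add_divide_distrib)
  qed
  then have "(\<lambda>n. complex_of_real (Tg $ n * (1/8) ^ n / sig n)) \<longlonglongrightarrow> of_real ((1 / r17 - 1) / 4)"
    using tendsto_add[OF 2 1] \<open>suminf \<beta> = Bf (1/8)\<close> Bf_eighth by simp
  then show ?thesis by (simp only: tendsto_of_real_iff)
qed

theorem expectation_asymp:
  assumes f: "f = sackin_max \<and> m = max \<or> f = sackin_min \<and> m = min"
    and A: "ev (cm (Ag m)) (of_real \<alpha>)" and c: "\<alpha> * (1 - 1 / r17) = c" "c \<noteq> 0"
  shows "(\<lambda>n. uniform_LGT_expectation f n) \<sim>[at_top] (\<lambda>n. c * sqrt pi * real n powr (3/2))"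
proof (rule asymp_equivI')
  define b where "b = (1 / r17 - 1) / 4"
  have b: "b \<noteq> 0" using r17_bounds by (simp add: b_def)
  have m: "m 0 0 = 0" using f by auto
  have 1: "(\<lambda>n. (Hg m $ n * (1/8) ^ n) / (Tg $ n * (1/8) ^ n / sig n)) \<longlonglongrightarrow> (1/8 * (1 - 1 / r17) ^ 2 * \<alpha>) / b"
    unfolding b_def by (rule tendsto_divide[OF Hg_limit[of m, OF m A] Tg_limit]) (use b b_def in simp)
  have v: "(1/8 * (1 - 1 / r17) ^ 2 * \<alpha>) / b / (- 1 / (2 * sqrt pi)) / (c * sqrt pi) = 1"
  proof -
    define d where "d = 1 - 1 / r17"
    have d: "d \<noteq> 0" "b = - d / 4" "\<alpha> * d = c" using b c by (auto simp: d_def b_def field_simps)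
    have "(1/8 * d ^ 2 * \<alpha>) / (- d / 4) = - (\<alpha> * d) / 2" using d(1) by (simp add: power2_eq_square field_simps)
    then have e: "(1/8 * d ^ 2 * \<alpha>) / b = - c / 2" using d by simp
    show ?thesis unfolding d_def[symmetric] e using c(2) by (simp add: field_simps)
  qed
  have "(\<lambda>n. (Hg m $ n * (1/8) ^ n) / (Tg $ n * (1/8) ^ n / sig n) / (sig n * real n powr (3/2)) / (c * sqrt pi)) \<longlonglongrightarrow> 1"
    using tendsto_divide[OF tendsto_divide[OF 1 sig_asymp] tendsto_const[of "c * sqrt pi"]] c(2) unfolding v by simp
  moreover have "eventually (\<lambda>n. (Hg m $ n * (1/8) ^ n) / (Tg $ n * (1/8) ^ n / sig n) / (sig n * real n powr (3/2)) / (c * sqrt pi)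
      = uniform_LGT_expectation f n / (c * sqrt pi * real n powr (3/2))) sequentially"
    using eventually_gt_at_top[of 1]
  proof eventually_elim
    case (elim n)
    then have e: "uniform_LGT_expectation f n = Hg m $ n / Tg $ n" using expectation_eq[OF _ f, of n] by simp
    show ?case unfolding e using sig_nz[of n] by (simp add: field_simps)
  qed
  ultimately show "(\<lambda>n. uniform_LGT_expectation f n / (c * sqrt pi * real n powr (3/2))) \<longlonglongrightarrow> 1"
    by (rule Lim_transform_eventually)
qed

theorem theorem1p1:
  shows "((\<lambda>n. uniform_LGT_expectation sackin_max n) \<sim>[at_top]
           (\<lambda>n. (47/32 + 39 * sqrt 17 / 544) * sqrt pi * real n powr (3/2))) \<and>
         ((\<lambda>n. uniform_LGT_expectation sackin_min n) \<sim>[at_top]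
           (\<lambda>n. (49/32 - 7 * sqrt 17 / 544) * sqrt pi * real n powr (3/2)))"
proof
  have inv: "1 / r17 = r17 / 17" by (simp add: field_simps)
  show "(\<lambda>n. uniform_LGT_expectation sackin_max n) \<sim>[at_top] (\<lambda>n. (47/32 + 39 * sqrt 17 / 544) * sqrt pi * real n powr (3/2))"
  proof (rule expectation_asymp[OF _ ev_Ag[OF ev_Mg_max]])
    have "47/32 + 39 * sqrt 17 / 544 > (0::real)" by (intro add_pos_pos) auto
    then show "47/32 + 39 * sqrt 17 / 544 \<noteq> (0::real)" by simp
  qed (simp_all add: inv power2_eq_square power3_eq_cube power4_eq_xxxx field_simps r17_sq)
  show "(\<lambda>n. uniform_LGT_expectation sackin_min n) \<sim>[at_top] (\<lambda>n. (49/32 - 7 * sqrt 17 / 544) * sqrt pi * real n powr (3/2))"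
  proof (rule expectation_asymp[OF _ ev_Ag[OF ev_Mg_min]])
    show "49/32 - 7 * sqrt 17 / 544 \<noteq> (0::real)" using r17_bounds by auto
  qed (simp_all add: inv power2_eq_square power3_eq_cube power4_eq_xxxx field_simps r17_sq)
qed

end
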